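(* Let $\bm x^\dagger\in\mathbb R^n$ be any $s$-sparse signal. Consider $m$ i.i.d. random vectors $\{\bm a_j\}_{j=1}^m$ with $\bm a_j\sim\mathcal{CN}(\bm 0,\bm I)$ at every update, including both the outer hard-thresholding step and the inner Gauss--Newton refinement steps (i.e. the data are resampled at every update), and noiseless measurements $y_j=|\langle\bm a_j,\bm x^\dagger\rangle|^2$, $j=1,\dots,m$. Then for some small constant $\gamma\in(0,1)$ and any $L_0\ge1$, there exist universal constants $\mu_1,\mu_2,C_1,C_2$, $\alpha\in(0,1)$ and $\beta$ such that: for any fixed $\bm z^k\in\mathcal E(\gamma)$, with probability at least $1-C_1m^{-1}$, the vector $\bm z^{k+1}$ produced from $\bm z^k$ by one outer iteration of GraHTP (defined in the context) with $L=L_0$ inner Gauss--Newton steps satisfies $$\operatorname{dist}(\bm z^{k+1},\bm x^\dagger)\le\alpha\cdot\operatorname{dist}(\bm z^k,\bm x^\dagger),$$ and $$\operatorname{dist}(\bm z^{k+1},\bm x^\dagger)\le\beta\cdot\operatorname{dist}^2(\bm z^k,\bm x^\dagger)\quad\text{if }\bm z^k\in\mathcal E\Big(\frac{x^\dagger_{\min}}{\|\bm x^\dagger\|_2}\Big),$$ provided the step size satisfies $\mu^k\in\big(\frac{\mu_1}{\|\bm x^\dagger\|_2^2},\frac{\mu_2}{\|\bm x^\dagger\|_2^2}\big)$ and $m\ge C_2\,s\log(n/s)$.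
   Context: A vector is $s$-sparse if $\|\bm x\|_0\le s$, where $\|\cdot\|_0$ counts nonzero entries. $\operatorname{dist}(\bm z,\bm x^\dagger)=\min\{\|\bm z-\bm x^\dagger\|_2,\|\bm z+\bm x^\dagger\|_2\}$. For $\gamma\ge0$, $\mathcal E(\gamma)=\{\bm z\in\mathbb R^n:\operatorname{dist}(\bm z,\bm x^\dagger)\le\gamma\|\bm x^\dagger\|_2,\ \|\bm z\|_0\le s\}$. $x^\dagger_{\min}$ is the smallest absolute value of a nonzero entry of $\bm x^\dagger$. $\bm a\sim\mathcal{CN}(\bm 0,\bm I)$ is a standard complex Gaussian vector in $\mathbb C^n$: $\bm a=\bm a_R+i\,\bm a_I$ with $\bm a_R,\bm a_I\in\mathbb R^n$ independent $\mathcal N(\bm 0,\bm I_n/2)$ vectors. $\mathcal H_s:\mathbb R^n\to\mathbb R^n$ keeps the $s$ entries of largest magnitude and sets the others to zero. Given data $\{(\bm a_j,y_j)\}_{j=1}^m$, define for $\bm z\in\mathbb R^n$ $$f(\bm z)=\frac1{4m}\sum_{j=1}^m\big(|\langle\bm a_j,\bm z\rangle|^2-y_j\big)^2,\qquad F_j(\bm z)=\frac1{2\sqrt m}\big(|\langle\bm a_j,\bm z\rangle|^2-y_j\big),$$ $\bm F(\bm z)=(F_j(\bm z))_{j=1}^m\in\mathbb R^m$, and let $\bm J(\bm z)\in\mathbb R^{m\times n}$ be the matrix whose $j$-th row is $\frac1{\sqrt m}\big(\bm a_{jR}\bm a_{jR}^\top\bm z+\bm a_{jI}\bm a_{jI}^\top\bm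 z\big)^\top$, where $\bm a_{jR},\bm a_{jI}$ are the real and imaginary parts of $\bm a_j$. One outer iteration of GraHTP (Gradient Hard Thresholding Pursuit) with step size $\mu^k>0$ and $L$ inner steps, starting from $\bm z^k\in\mathbb R^n$: (1) $\bm u^k=\mathcal H_s\big(\bm z^k-\mu^k\nabla f(\bm z^k)\big)$; (2) $\mathcal S_{k+1}=\operatorname{supp}(\bm u^k)$; (3) set $\bm z^{k,0}=\bm u^k$ and for $l=0,\dots,L-1$ let $\bm z^{k,l+1}$ be the minimizer of $\|\bm J(\bm z^{k,l})(\bm z-\bm z^{k,l})+\bm F(\bm z^{k,l})\|_2^2$ over $\{\bm z\in\mathbb R^n:\operatorname{supp}(\bm z)\subseteq\mathcal S_{k+1}\}$; (4) $\bm z^{k+1}=\bm z^{k,L}$.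
   Formalization: The quadratic bound has β/‖x†‖₂ with β universal, since a scale-free β fails under rescaling; m ≥ C₂ s is required besides m ≥ C₂ s log(n/s), since for s = n the latter allows m < s, where the Gauss–Newton minimizer is not unique. *)

theory Defs
  imports "HOL-Probability.Probability"
begin

section \<open>Sparse vectors\<close>

text \<open>
  The dimension has to range over all naturals inside a single formula (the constants are
  universal), so a vector of \<open>\<real>\<^sup>n\<close> is a function on the naturals that vanishes outside
  \<open>{..<n}\<close>.  Likewise an \<open>m \<times> n\<close> matrix is a function of two naturals of which only the entries
  \<open>j < m\<close>, \<open>i < n\<close> are used.
\<close>

definition Rn :: "nat \<Rightarrow> (nat \<Rightarrow> real) set" where
  "Rn n = {z. \<forall>i\<ge>n. z i = 0}"

definition vnorm :: "nat \<Rightarrow> (nat \<Rightarrow> real) \<Rightarrow> real" where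
  "vnorm n z = L2_set z {..<n}"

definition supp :: "(nat \<Rightarrow> real) \<Rightarrow> nat set" where
  "supp z = {i. z i \<noteq> 0}"

definition norm0 :: "(nat \<Rightarrow> real) \<Rightarrow> nat" where
  "norm0 z = card (supp z)"

definition sdist :: "nat \<Rightarrow> (nat \<Rightarrow> real) \<Rightarrow> (nat \<Rightarrow> real) \<Rightarrow> real" where
  "sdist n z x = min (vnorm n (\<lambda>i. z i - x i)) (vnorm n (\<lambda>i. z i + x i))"

definition nbhd :: "nat \<Rightarrow> nat \<Rightarrow> (nat \<Rightarrow> real) \<Rightarrow> real \<Rightarrow> (nat \<Rightarrow> real) set" where
  "nbhd n s x \<gamma> = {z \<in> Rn n. sdist n z x \<le> \<gamma> * vnorm n x \<and> norm0 z \<le> s}"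

definition min_entry :: "(nat \<Rightarrow> real) \<Rightarrow> real" where
  "min_entry x = Min ((\<lambda>i. \<bar>x i\<bar>) ` supp x)"

text \<open>Ties between entries of equal magnitude are resolved in favour of the smaller index.\<close>

definition top_entries :: "nat \<Rightarrow> nat \<Rightarrow> (nat \<Rightarrow> real) \<Rightarrow> nat set" where
  "top_entries n s v =
     {i \<in> {..<n}. card {j \<in> {..<n}. \<bar>v i\<bar> < \<bar>v j\<bar> \<or> (\<bar>v j\<bar> = \<bar>v i\<bar> \<and> j < i)} < s}"

definition hard_threshold :: "nat \<Rightarrow> nat \<Rightarrow> (nat \<Rightarrow> real) \<Rightarrow> nat \<Rightarrow> real" where
  "hard_threshold n s v = (\<lambda>i. if i \<in> top_entries n s v then v i else 0)"


section \<open>Phaseless measurements and the GraHTP iteration\<close>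

text \<open>
  A data block is a family \<open>a\<close> of \<open>m\<close> vectors of \<open>\<complex>\<^sup>n\<close>, where \<open>a j i\<close> is entry \<open>i\<close> of \<open>a\<^sub>j\<close>,
  together with the measurements \<open>y j\<close>.
\<close>

definition cinner :: "nat \<Rightarrow> (nat \<Rightarrow> complex) \<Rightarrow> (nat \<Rightarrow> real) \<Rightarrow> complex" where
  "cinner n a z = (\<Sum>i<n. cnj (a i) * of_real (z i))"

definition measurements :: "nat \<Rightarrow> (nat \<Rightarrow> nat \<Rightarrow> complex) \<Rightarrow> (nat \<Rightarrow> real) \<Rightarrow> nat \<Rightarrow> real" where
  "measurements n a x = (\<lambda>j. (cmod (cinner n (a j) x))\<^sup>2)"

definition loss ::
  "nat \<Rightarrow> nat \<Rightarrow> (nat \<Rightarrow> nat \<Rightarrow> complex) \<Rightarrow> (nat \<Rightarrow> real) \<Rightarrow> (nat \<Rightarrow> real) \<Rightarrow> real" where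
  "loss n m a y z = 1 / (4 * real m) * (\<Sum>j<m. ((cmod (cinner n (a j) z))\<^sup>2 - y j)\<^sup>2)"

definition gradient :: "nat \<Rightarrow> ((nat \<Rightarrow> real) \<Rightarrow> real) \<Rightarrow> (nat \<Rightarrow> real) \<Rightarrow> nat \<Rightarrow> real" where
  "gradient n g z = (\<lambda>i. if i < n then deriv (\<lambda>t. g (z(i := t))) (z i) else 0)"

definition residual ::
  "nat \<Rightarrow> nat \<Rightarrow> (nat \<Rightarrow> nat \<Rightarrow> complex) \<Rightarrow> (nat \<Rightarrow> real) \<Rightarrow> (nat \<Rightarrow> real) \<Rightarrow> nat \<Rightarrow> real" where
  "residual n m a y z = (\<lambda>j. 1 / (2 * sqrt (real m)) * ((cmod (cinner n (a j) z))\<^sup>2 - y j))"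

definition jacobian ::
  "nat \<Rightarrow> nat \<Rightarrow> (nat \<Rightarrow> nat \<Rightarrow> complex) \<Rightarrow> (nat \<Rightarrow> real) \<Rightarrow> nat \<Rightarrow> nat \<Rightarrow> real" where
  "jacobian n m a z = (\<lambda>j i. 1 / sqrt (real m) *
     (Re (a j i) * (\<Sum>k<n. Re (a j k) * z k) + Im (a j i) * (\<Sum>k<n. Im (a j k) * z k)))"

text \<open>If the least-squares minimizer is not unique, \<open>arg_min_on\<close> is some minimizer.\<close>

definition gauss_newton ::
  "nat \<Rightarrow> nat \<Rightarrow> nat set \<Rightarrow> (nat \<Rightarrow> nat \<Rightarrow> complex) \<Rightarrow> (nat \<Rightarrow> real) \<Rightarrow> (nat \<Rightarrow> real) \<Rightarrow> nat \<Rightarrow> real"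
where
  "gauss_newton n m S a y w =
     arg_min_on
       (\<lambda>z. (vnorm m (\<lambda>j. (\<Sum>i<n. jacobian n m a w j i * (z i - w i)) + residual n m a y w j))\<^sup>2)
       {z \<in> Rn n. supp z \<subseteq> S}"

text \<open>
  \<open>\<omega> t\<close> is the data block sampled for update \<open>t\<close>: update \<open>0\<close> is the hard-thresholding step, and
  update \<open>l + 1\<close> is the Gauss--Newton step leading from inner iterate \<open>l\<close> to inner iterate
  \<open>l + 1\<close>.
\<close>

definition ht_step ::
  "nat \<Rightarrow> nat \<Rightarrow> nat \<Rightarrow> real \<Rightarrow> (nat \<Rightarrow> real) \<Rightarrow> (nat \<Rightarrow> nat \<Rightarrow> complex) \<Rightarrow> (nat \<Rightarrow> real)
    \<Rightarrow> nat \<Rightarrow> real" where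
  "ht_step n m s \<mu> x a z =
     hard_threshold n s (\<lambda>i. z i - \<mu> * gradient n (loss n m a (measurements n a x)) z i)"

primrec inner_iterate ::
  "nat \<Rightarrow> nat \<Rightarrow> (nat \<Rightarrow> real) \<Rightarrow> (nat \<Rightarrow> nat \<Rightarrow> nat \<Rightarrow> complex) \<Rightarrow> (nat \<Rightarrow> real) \<Rightarrow> nat
    \<Rightarrow> nat \<Rightarrow> real" where
  "inner_iterate n m x \<omega> u 0 = u"
| "inner_iterate n m x \<omega> u (Suc l) =
     gauss_newton n m (supp u) (\<omega> (Suc l)) (measurements n (\<omega> (Suc l)) x)
       (inner_iterate n m x \<omega> u l)"

definition grahtp_step ::
  "nat \<Rightarrow> nat \<Rightarrow> nat \<Rightarrow> real \<Rightarrow> nat \<Rightarrow> (nat \<Rightarrow> real) \<Rightarrow> (nat \<Rightarrow> nat \<Rightarrow> nat \<Rightarrow> complex)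
    \<Rightarrow> (nat \<Rightarrow> real) \<Rightarrow> nat \<Rightarrow> real" where
  "grahtp_step n m s \<mu> L x \<omega> z = inner_iterate n m x \<omega> (ht_step n m s \<mu> x (\<omega> 0) z) L"


section \<open>The law of the resampled data\<close>

definition half_gaussian :: "nat \<Rightarrow> (nat \<Rightarrow> real) measure" where
  "half_gaussian n = (\<Pi>\<^sub>M i\<in>{..<n}. density lborel (normal_density 0 (sqrt (1/2))))"

definition complex_gaussian :: "nat \<Rightarrow> (nat \<Rightarrow> complex) measure" where
  "complex_gaussian n =
     distr (half_gaussian n \<Otimes>\<^sub>M half_gaussian n) (\<Pi>\<^sub>M i\<in>{..<n}. borel)
       (\<lambda>(p, q). \<lambda>i\<in>{..<n}. Complex (p i) (q i))"

text \<open>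
  \<open>L + 1\<close> independent blocks, one for each update of an outer iteration with \<open>L\<close> inner steps, each
  made of \<open>m\<close> independent standard complex Gaussian vectors.
\<close>

definition resampled_data :: "nat \<Rightarrow> nat \<Rightarrow> nat \<Rightarrow> (nat \<Rightarrow> nat \<Rightarrow> nat \<Rightarrow> complex) measure" where
  "resampled_data n m L = (\<Pi>\<^sub>M t\<in>{..L}. \<Pi>\<^sub>M j\<in>{..<m}. complex_gaussian n)"

text \<open>
  The event is described by a measurable subset, so that a lower bound on its probability does not
  presuppose measurability of the choice made by \<open>arg_min_on\<close> where minimizers are not unique.
\<close>

definition with_prob_ge :: "'a measure \<Rightarrow> real \<Rightarrow> ('a \<Rightarrow> bool) \<Rightarrow> bool" where
  "with_prob_ge M p P \<longleftrightarrow> (\<exists>A\<in>sets M. p \<le> measure M A \<and> (\<forall>\<omega>\<in>A. P \<omega>))"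

end

theory Submission
  imports Defs
begin

text \<open>
  Replacing \<open>x\<close> by \<open>-x\<close> if necessary, \<open>h = z - x\<close> is the short difference.  With
  \<open>B\<^sub>j p q = Re (p \<bullet> a\<^sub>j) Re (q \<bullet> a\<^sub>j) + Im (p \<bullet> a\<^sub>j) Im (q \<bullet> a\<^sub>j)\<close>, the gradient in
  direction \<open>u\<close> is the average of \<open>B\<^sub>j z u * B\<^sub>j h (z + x)\<close>; up to \<open>O(\<bar>x\<bar> \<bar>h\<bar>\<^sup>2)\<close> its mean is
  \<open>\<bar>x\<bar>\<^sup>2 (u \<bullet> h) + 3 (x \<bullet> h) (x \<bullet> u)\<close>.  For \<open>\<mu>\<close> close to \<open>1 / \<bar>x\<bar>\<^sup>2\<close> the gradient step therefore
  yields a multiple of \<open>x\<close> up to an error that is tiny compared with \<open>h\<close> on every sparse set of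
  coordinates.  An error in the scale of \<open>x\<close> does not disturb its support, so the selected support
  \<open>S\<close> misses only a part of \<open>x\<close> of norm at most \<open>\<epsilon> \<bar>h\<bar>\<close>, and none of it if \<open>\<bar>h\<bar>\<close> is at most the
  smallest entry of \<open>x\<close>.  A Gauss--Newton step from \<open>w\<close> minimizes the average of
  \<open>(B\<^sub>j w (y - x) - B\<^sub>j (w - x) (w - x) / 2)\<^sup>2\<close> over \<open>y\<close> supported on \<open>S\<close>; comparing with the restriction
  of \<open>x\<close> to \<open>S\<close> bounds the new error by a constant times \<open>\<bar>x off S\<bar> + \<bar>w - x\<bar>\<^sup>2 / \<bar>x\<bar>\<close>.

  Since the data are fresh, \<open>z\<close>, \<open>w\<close> and \<open>S\<close> are deterministic from the point of view of the block
  that is used, and only \<open>u\<close> and \<open>y\<close> vary.  Products are truncated according to their fixed factors,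
  so that the truncated part has exponential tails and a union bound over a net of sparse vectors
  applies, while the rest is governed by scalar averages, for which Chebyshev's inequality gives the
  failure probability \<open>O(1/m)\<close>.
\<close>


subsection \<open>Vectors of bounded dimension\<close>

text \<open>Freezing an iterate with respect to a fresh block is a Fubini argument, and Fubini
  requires the iterate to depend measurably on the earlier blocks; a minimizer picked by
  \<open>arg_min_on\<close> offers no such guarantee. The probabilistic part therefore runs on
  \<open>gn_chain\<close>, an explicit measurable formula, and a deterministic induction shows that
  it agrees with the actual iterates on the good event, where the least-squares problem is strictly
  convex.

  The constants are fixed backwards. A Gauss--Newton step costs a factor 1601, so thresholding has
  to be accurate to \<epsilon> = 1/10000, which dictates the radius \<epsilon>/256 and the step
  window 1 - \<epsilon>/16, 1 + \<epsilon>/16. The bound after every inner step uses only that the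
  previous error is at most five times the initial one. Hence the radius and the rates do not depend
  on the number of inner steps, which enters the failure probability alone.\<close>

definition ip :: "nat \<Rightarrow> (nat \<Rightarrow> real) \<Rightarrow> (nat \<Rightarrow> real) \<Rightarrow> real" where
  "ip n p q = (\<Sum>i<n. p i * q i)"

text \<open>Division by 0 gives 0, so \<open>nrm\<close> vanishes where \<open>vnorm n p\<close>
  does. Thus \<open>p\<close> agrees below \<open>n\<close> with \<open>vnorm n p\<close> times
  \<open>nrm n p\<close> in every case, and homogeneous estimates reduce to vectors of norm at most
  1 without singling out zero.\<close>

definition nrm :: "nat \<Rightarrow> (nat \<Rightarrow> real) \<Rightarrow> nat \<Rightarrow> real" where
  "nrm n p = (\<lambda>i. p i / vnorm n p)"

lemma vnorm_nonneg [simp]: "0 \<le> vnorm n p"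
  by (simp add: vnorm_def L2_set_nonneg)

lemma vnorm_power2: "(vnorm n p)\<^sup>2 = (\<Sum>i<n. (p i)\<^sup>2)"
  by (simp add: vnorm_def L2_set_def sum_nonneg)

lemma vnorm_power2_ip: "(vnorm n p)\<^sup>2 = ip n p p"
  unfolding vnorm_power2 by (simp add: ip_def power2_eq_square)

lemma vnorm_scale: "vnorm n (\<lambda>i. c * p i) = \<bar>c\<bar> * vnorm n p"
proof -
  have "(\<Sum>i<n. (c * p i)\<^sup>2) = c\<^sup>2 * (\<Sum>i<n. (p i)\<^sup>2)"
    by (simp add: power_mult_distrib sum_distrib_left)
  then show ?thesis by (simp add: vnorm_def L2_set_def real_sqrt_mult)
qed

lemma vnorm_uminus: "vnorm n (\<lambda>i. - p i) = vnorm n p"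
  using vnorm_scale[of n "-1" p] by simp

lemma vnorm_triangle: "vnorm n (\<lambda>i. p i + q i) \<le> vnorm n p + vnorm n q"
  unfolding vnorm_def by (rule L2_set_triangle_ineq)

lemma vnorm_triangle_diff: "vnorm n (\<lambda>i. p i - q i) \<le> vnorm n p + vnorm n q"
  using vnorm_triangle[of n p "\<lambda>i. - q i"] by (simp add: vnorm_uminus)

lemma vnorm_mono: "(\<And>i. i < n \<Longrightarrow> \<bar>p i\<bar> \<le> \<bar>q i\<bar>) \<Longrightarrow> vnorm n p \<le> vnorm n q"
  unfolding vnorm_def L2_set_def
  by (intro real_sqrt_le_mono sum_mono) (simp add: abs_le_square_iff)

lemma vnorm_cong: "(\<And>i. i < n \<Longrightarrow> p i = q i) \<Longrightarrow> vnorm n p = vnorm n q"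
  unfolding vnorm_def by (rule L2_set_cong) auto

lemma vnorm_eq_0D: "vnorm n p = 0 \<Longrightarrow> i < n \<Longrightarrow> p i = 0"
  unfolding vnorm_def by (subst (asm) L2_set_eq_0_iff) auto

lemma abs_le_vnorm: "i < n \<Longrightarrow> \<bar>p i\<bar> \<le> vnorm n p"
  by (rule power2_le_imp_le) (auto simp: vnorm_power2 intro!: member_le_sum)

lemma nrm_scale: "p i = vnorm n p * nrm n p i" if "i < n"
  using that by (cases "vnorm n p = 0") (auto simp: nrm_def dest: vnorm_eq_0D)

lemma vnorm_nrm_le: "vnorm n (nrm n p) \<le> 1"
proof -
  have "nrm n p = (\<lambda>i. (1 / vnorm n p) * p i)" by (auto simp: nrm_def)
  then show ?thesis using vnorm_scale[of n "1 / vnorm n p" p] by simp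
qed

lemma ip_commute: "ip n p q = ip n q p"
  by (simp add: ip_def mult.commute)

lemma ip_Cauchy_Schwarz: "\<bar>ip n p q\<bar> \<le> vnorm n p * vnorm n q"
proof -
  have "\<bar>ip n p q\<bar> \<le> (\<Sum>i<n. \<bar>p i\<bar> * \<bar>q i\<bar>)"
    unfolding ip_def using sum_abs[of "\<lambda>i. p i * q i" "{..<n}"] by (simp add: abs_mult)
  also have "\<dots> \<le> vnorm n p * vnorm n q"
    unfolding vnorm_def by (rule L2_set_mult_ineq)
  finally show ?thesis .
qed

lemma supp_Rn: "p \<in> Rn n \<Longrightarrow> supp p \<subseteq> {..<n}"
  by (metis (mono_tags, lifting) Rn_def mem_Collect_eq lessThan_iff not_le subsetI supp_def)

lemma finite_supp_Rn: "p \<in> Rn n \<Longrightarrow> finite (supp p)"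
  using supp_Rn finite_subset by blast

subsection \<open>Lattice nets of sparse vectors\<close>

definition sparse_ball :: "nat \<Rightarrow> nat \<Rightarrow> (nat \<Rightarrow> real) set" where
  "sparse_ball n k = {u \<in> Rn n. card (supp u) \<le> k \<and> vnorm n u \<le> 1}"

text \<open>The l1 norm of a \<open>k\<close>-sparse unit vector is at most \<open>sqrt k\<close>,
  so rounding \<open>D * sqrt k\<close> times such a vector towards zero leaves entries whose
  absolute values sum to at most \<open>D * k\<close>, the value of \<open>M\<close> in
  \<open>net\<close>. Bounding the sum instead of single entries keeps the count exponential in
  \<open>k\<close>, without an additional factor \<open>ln k\<close> in the exponent.\<close>

definition int_points :: "nat \<Rightarrow> nat \<Rightarrow> nat \<Rightarrow> (nat \<Rightarrow> int) set" where
  "int_points n k M = {v \<in> {..<n} \<rightarrow>\<^sub>E {- int M..int M}.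
      card {i\<in>{..<n}. v i \<noteq> 0} \<le> k \<and> (\<Sum>i<n. nat \<bar>v i\<bar>) \<le> M}"

definition net :: "nat \<Rightarrow> nat \<Rightarrow> nat \<Rightarrow> (nat \<Rightarrow> real) set" where
  "net n k D = (\<lambda>v i. if i < n then real_of_int (v i) / (D * sqrt k) else 0) ` int_points n k (D * k)
    \<inter> {u. vnorm n u \<le> 1}"

lemma finite_int_points: "finite (int_points n k M)"
  unfolding int_points_def by (intro finite_subset[OF _ finite_PiE[of "{..<n}" "\<lambda>_. {- int M..int M}"]]) auto

lemma finite_net: "finite (net n k D)"
  unfolding net_def by (intro finite_Int disjI1 finite_imageI finite_int_points)

lemma sum_half_power_int: "(\<Sum>v\<in>{- int M..int M}. (1/2::real) ^ nat \<bar>v\<bar>) \<le> 3"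
proof -
  have geo: "(\<Sum>i\<in>{1..M}. (1/2::real)^i) \<le> 1"
  proof -
    have "(\<Sum>i\<in>{1..M}. (1/2::real)^i) = 1 - (1/2)^M" by (induction M) auto
    then show ?thesis by simp
  qed
  have im1: "{1..int M} = int ` {1..M}" 
    using image_int_atLeastAtMost[of 1 M] by simp
  have im2: "{- int M.. -1} = (\<lambda>i. - int i) ` {1..M}"
  proof -
    have "{- int M.. -1} = uminus ` {1..int M}" by simp
    also have "\<dots> = uminus ` (int ` {1..M})" by (simp only: im1)
    also have "\<dots> = (\<lambda>i. - int i) ` {1..M}" by (simp only: image_image)
    finally show ?thesis .
  qed
  have "{- int M..int M} = {- int M.. -1} \<union> ({0} \<union> {1..int M})" by auto
  then have "(\<Sum>v\<in>{- int M..int M}. (1/2::real) ^ nat \<bar>v\<bar>) =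
      (\<Sum>v\<in>{- int M.. -1}. (1/2::real) ^ nat \<bar>v\<bar>) + (\<Sum>v\<in>{0} \<union> {1..int M}. (1/2::real) ^ nat \<bar>v\<bar>)"
    by (simp only:) (rule sum.union_disjoint, auto)
  also have "(\<Sum>v\<in>{0} \<union> {1..int M}. (1/2::real) ^ nat \<bar>v\<bar>) = 1 + (\<Sum>v\<in>{1..int M}. (1/2::real) ^ nat \<bar>v\<bar>)"
    by (subst sum.union_disjoint) auto
  also have "(\<Sum>v\<in>{1..int M}. (1/2::real) ^ nat \<bar>v\<bar>) = (\<Sum>i\<in>{1..M}. (1/2)^i)"
    unfolding im1 by (subst sum.reindex) (auto simp: inj_on_def)
  also have "(\<Sum>v\<in>{- int M.. -1}. (1/2::real) ^ nat \<bar>v\<bar>) = (\<Sum>i\<in>{1..M}. (1/2)^i)"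
    unfolding im2 by (subst sum.reindex) (auto simp: inj_on_def)
  finally show ?thesis using geo by linarith
qed

text \<open>A generating function with weight \<open>(1/2) ^ \<bar>v i\<bar>\<close> per entry and an extra factor \<open>t = k / n\<close>
  per nonzero entry counts supports and lattice points at once.\<close>

lemma card_int_points:
  assumes "1 \<le> k" "k \<le> n"
  shows "real (card (int_points n k M)) \<le> exp (M * ln 2 + k * ln (n / k) + 2 * k)"
proof -
  define t :: real where "t = k / n"
  have t: "0 < t" "t \<le> 1" using assms by (auto simp: t_def)
  define g :: "int \<Rightarrow> real" where "g v = (if v = 0 then 1 else t) * (1/2) ^ nat \<bar>v\<bar>" for v
  have g0: "0 \<le> g v" for v using t by (simp add: g_def)
  let ?B = "{..<n} \<rightarrow>\<^sub>E {- int M..int M}"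
  have low: "t ^ k * (1/2) ^ M \<le> (\<Prod>i<n. g (v i))" if v: "v \<in> int_points n k M" for v
  proof -
    have "(\<Prod>i<n. g (v i)) = (\<Prod>i<n. if v i = 0 then 1 else t) * (\<Prod>i<n. (1/2) ^ nat \<bar>v i\<bar>)"
      by (simp add: g_def prod.distrib)
    also have "(\<Prod>i<n. if v i = 0 then 1 else t) = t ^ card {i\<in>{..<n}. v i \<noteq> 0}"
    proof -
      have "(\<Prod>i<n. if v i = 0 then 1 else t) = (\<Prod>i\<in>{i\<in>{..<n}. v i \<noteq> 0}. t)"
        by (rule prod.mono_neutral_cong_right) auto
      then show ?thesis by simp
    qed
    also have "(\<Prod>i<n. (1/2::real) ^ nat \<bar>v i\<bar>) = (1/2) ^ (\<Sum>i<n. nat \<bar>v i\<bar>)"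
      by (simp add: power_sum)
    finally have eq: "(\<Prod>i<n. g (v i)) = t ^ card {i\<in>{..<n}. v i \<noteq> 0} * (1/2) ^ (\<Sum>i<n. nat \<bar>v i\<bar>)" .
    show ?thesis unfolding eq
      using v t by (intro mult_mono power_decreasing) (auto simp: int_points_def)
  qed
  have "real (card (int_points n k M)) * (t ^ k * (1/2) ^ M) = (\<Sum>v\<in>int_points n k M. t ^ k * (1/2) ^ M)"
    by simp
  also have "\<dots> \<le> (\<Sum>v\<in>int_points n k M. \<Prod>i<n. g (v i))"
    by (intro sum_mono low)
  also have "\<dots> \<le> (\<Sum>v\<in>?B. \<Prod>i<n. g (v i))"
    by (intro sum_mono2 finite_PiE prod_nonneg g0) (auto simp: int_points_def)
  also have "\<dots> = (\<Prod>i<n. \<Sum>v\<in>{- int M..int M}. g v)"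
    by (rule prod_sum_PiE[symmetric]) auto
  \<comment> \<open>One coordinate contributes at most (1 - t) + 3t = 1 + 2t, and
    \<open>n * t = k\<close>.\<close>
  also have "\<dots> \<le> (\<Prod>i<n. exp (2 * t))"
  proof (intro prod_mono conjI sum_nonneg g0)
    have "g v \<le> (if v = 0 then 1 - t else 0) + t * (1/2) ^ nat \<bar>v\<bar>" for v
      by (simp add: g_def)
    then have "(\<Sum>v\<in>{- int M..int M}. g v) \<le> (\<Sum>v\<in>{- int M..int M}. (if v = 0 then 1 - t else 0) + t * (1/2) ^ nat \<bar>v\<bar>)"
      by (intro sum_mono)
    also have "\<dots> = (1 - t) + t * (\<Sum>v\<in>{- int M..int M}. (1/2) ^ nat \<bar>v\<bar>)"
      by (simp add: sum.distrib sum_distrib_left)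
    also have "\<dots> \<le> (1 - t) + t * 3"
      using t sum_half_power_int[of M] by (intro add_left_mono mult_left_mono) auto
    also have "\<dots> \<le> exp (2 * t)" using exp_ge_add_one_self[of "2*t"] by (simp add: algebra_simps)
    finally show "(\<Sum>v\<in>{- int M..int M}. g v) \<le> exp (2 * t)" .
  qed
  also have "\<dots> = exp (2 * k)"
    using assms by (simp add: exp_of_nat_mult[symmetric] t_def)
  finally have main: "real (card (int_points n k M)) * (t ^ k * (1/2) ^ M) \<le> exp (2 * k)" .
  have "t ^ k * (1/2) ^ M = exp (- (M * ln 2 + k * ln (n / k)))"
  proof -
    have l1: "ln t = - ln (n / k)" using assms by (simp add: t_def ln_div)
    have "t ^ k = exp (k * ln t)" using t by (simp add: exp_of_nat_mult)
    then have 1: "t ^ k = exp (- (k * ln (n / k)))" by (simp only: l1 mult_minus_right)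
    have l2: "ln (1/2::real) = - ln 2" by (simp add: ln_div)
    have "(1/2::real) ^ M = exp (M * ln (1/2))" by (simp only: exp_of_nat_mult) simp
    then have 2: "(1/2::real) ^ M = exp (- (M * ln 2))" by (simp only: l2 mult_minus_right)
    have "t ^ k * (1/2) ^ M = exp (- (k * ln (n / k))) * exp (- (M * ln 2))" by (simp only: 1 2)
    also have "\<dots> = exp (- (k * ln (n / k)) + - (M * ln 2))" by (rule exp_add[symmetric])
    finally show ?thesis by (simp only: minus_add_distrib add.commute)
  qed
  then have "t ^ k * (1/2) ^ M * exp (M * ln 2 + k * ln (n / k)) = 1"
    by (simp add: exp_add[symmetric])
  then have "real (card (int_points n k M)) =
      real (card (int_points n k M)) * (t ^ k * (1/2) ^ M) * exp (M * ln 2 + k * ln (n / k))"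
    by (metis mult.assoc mult.right_neutral)
  also have "\<dots> \<le> exp (2 * k) * exp (M * ln 2 + k * ln (n / k))"
    by (intro mult_right_mono main) simp
  also have "\<dots> = exp (2 * k + (M * ln 2 + k * ln (n / k)))" by (rule exp_add[symmetric])
  finally show ?thesis by (simp add: add.commute)
qed

lemma card_net:
  assumes "1 \<le> k" "k \<le> n"
  shows "real (card (net n k D)) \<le> exp (k * ln (n / k) + (real D + 2) * k)"
proof -
  have "real (card (net n k D)) \<le> real (card (int_points n k (D * k)))"
    unfolding net_def
    by (intro of_nat_mono order.trans[OF card_mono card_image_le] finite_imageI finite_int_points) auto
  also have "\<dots> \<le> exp (real (D * k) * ln 2 + real k * ln (n / k) + 2 * real k)"
    by (rule card_int_points[OF assms])
  also have "\<dots> \<le> exp (k * ln (n / k) + (real D + 2) * k)"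
  proof -
    have "ln 2 \<le> (1::real)" using ln_le_minus_one[of "2::real"] by simp
    then have "real (D * k) * ln 2 \<le> D * k" by (intro mult_left_le) auto
    then have "real (D * k) * ln 2 + k * ln (n / k) + 2 * k \<le> k * ln (n / k) + (real D + 2) * k"
      by (simp add: distrib_right)
    then show ?thesis by simp
  qed
  finally show ?thesis .
qed

text \<open>Rounding towards zero neither enlarges the support nor any entry, so \<open>u0\<close>
  stays in the unit ball and \<open>u - u0\<close> is again \<open>k\<close>-sparse. At most
  \<open>k\<close> entries are affected, each by at most \<open>1 / (D * sqrt k)\<close>.\<close>

lemma net_approx:
  assumes k: "1 \<le> k" and D: "1 \<le> D" and u: "u \<in> sparse_ball n k"
  obtains u0 where "u0 \<in> net n k D" "u0 \<in> Rn n" "supp u0 \<subseteq> supp u" "vnorm n u0 \<le> 1"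
    "vnorm n (\<lambda>i. u i - u0 i) \<le> 1 / D"
proof -
  define c where "c = D * sqrt k"
  have c: "0 < c" using k D by (auto simp: c_def)
  define w where "w i = (if 0 \<le> u i then \<lfloor>c * u i\<rfloor> else - \<lfloor>- (c * u i)\<rfloor>)" for i
  have uR: "u \<in> Rn n" and cu: "card (supp u) \<le> k" and nu: "vnorm n u \<le> 1"
    using u by (auto simp: sparse_ball_def)
  have w_abs: "real_of_int \<bar>w i\<bar> \<le> c * \<bar>u i\<bar>" and w_diff: "\<bar>c * u i - w i\<bar> \<le> 1"
    and w_0: "u i = 0 \<Longrightarrow> w i = 0" for i
  proof -
    show "real_of_int \<bar>w i\<bar> \<le> c * \<bar>u i\<bar>"
    proof (cases "0 \<le> u i")
      case True
      then have "0 \<le> \<lfloor>c * u i\<rfloor>" using c by simp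
      then show ?thesis using True by (simp add: w_def)
    next
      case False
      then have "0 \<le> \<lfloor>- (c * u i)\<rfloor>" using c by (simp add: mult_le_0_iff)
      then show ?thesis using False by (simp add: w_def)
    qed
    show "\<bar>c * u i - w i\<bar> \<le> 1" by (simp add: w_def) linarith
    show "u i = 0 \<Longrightarrow> w i = 0" by (simp add: w_def)
  qed
  define v where "v = restrict w {..<n}"
  have l1: "(\<Sum>i<n. \<bar>u i\<bar>) \<le> sqrt k"
  proof -
    have "(\<Sum>i<n. \<bar>u i\<bar>) = (\<Sum>i<n. \<bar>u i\<bar> * \<bar>if u i = 0 then 0 else 1\<bar>)"
      by (intro sum.cong) auto
    also have "\<dots> \<le> vnorm n u * L2_set (\<lambda>i. if u i = 0 then 0 else 1) {..<n}"
      unfolding vnorm_def by (rule L2_set_mult_ineq)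
    also have "L2_set (\<lambda>i. if u i = 0 then 0 else 1) {..<n} = sqrt (card (supp u))"
    proof -
      have "(\<Sum>i<n. (if u i = 0 then 0 else 1::real)\<^sup>2) = (\<Sum>i\<in>supp u. 1)"
        using supp_Rn[OF uR] by (intro sum.mono_neutral_cong_right) (auto simp: supp_def)
      then show ?thesis by (simp add: L2_set_def)
    qed
    also have "vnorm n u * sqrt (card (supp u)) \<le> 1 * sqrt k"
      using nu cu by (intro mult_mono) auto
    finally show ?thesis by simp
  qed
  have sumw: "(\<Sum>i<n. nat \<bar>w i\<bar>) \<le> D * k"
  proof -
    have "real (\<Sum>i<n. nat \<bar>w i\<bar>) = (\<Sum>i<n. real_of_int \<bar>w i\<bar>)" by simp
    also have "\<dots> \<le> (\<Sum>i<n. c * \<bar>u i\<bar>)" by (intro sum_mono w_abs)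
    also have "\<dots> = c * (\<Sum>i<n. \<bar>u i\<bar>)" by (simp add: sum_distrib_left)
    also have "\<dots> \<le> c * sqrt k" using l1 c by (intro mult_left_mono) auto
    also have "\<dots> = real (D * k)" by (simp add: c_def)
    finally show ?thesis by linarith
  qed
  have vin: "v \<in> int_points n k (D * k)"
    unfolding int_points_def
  proof (intro CollectI conjI)
    show "v \<in> {..<n} \<rightarrow>\<^sub>E {- int (D * k)..int (D * k)}"
    proof (rule PiE_I)
      fix i assume i: "i \<in> {..<n}"
      have "nat \<bar>w i\<bar> \<le> (\<Sum>i<n. nat \<bar>w i\<bar>)" using i by (intro member_le_sum) auto
      then have "\<bar>w i\<bar> \<le> int (D * k)" using sumw by linarith
      then show "v i \<in> {- int (D * k)..int (D * k)}"
        using i unfolding v_def by (simp add: abs_le_iff)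
    qed (auto simp: v_def)
    have "{i \<in> {..<n}. v i \<noteq> 0} \<subseteq> supp u" using w_0 by (auto simp: v_def supp_def)
    then have "card {i \<in> {..<n}. v i \<noteq> 0} \<le> card (supp u)"
      by (intro card_mono finite_supp_Rn[OF uR])
    then show "card {i \<in> {..<n}. v i \<noteq> 0} \<le> k" using cu by linarith
    show "(\<Sum>i<n. nat \<bar>v i\<bar>) \<le> D * k" using sumw by (simp add: v_def)
  qed
  define u0 where "u0 = (\<lambda>i. if i < n then real_of_int (v i) / (D * sqrt k) else 0)"
  have u0: "u0 i = w i / c" if "i < n" for i using that by (simp add: u0_def v_def c_def)
  show thesis
  proof
    show "u0 \<in> Rn n" by (simp add: Rn_def u0_def)
    show "supp u0 \<subseteq> supp u"
      using w_0 by (auto simp: supp_def u0_def v_def split: if_splits)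
    have "vnorm n u0 \<le> vnorm n u"
    proof (rule vnorm_mono)
      fix i assume "i < n"
      then have "\<bar>u0 i\<bar> = real_of_int \<bar>w i\<bar> / c" using c u0 by (simp add: abs_divide)
      also have "\<dots> \<le> \<bar>u i\<bar>" using w_abs[of i] c by (simp add: pos_divide_le_eq mult.commute)
      finally show "\<bar>u0 i\<bar> \<le> \<bar>u i\<bar>" .
    qed
    then show le1: "vnorm n u0 \<le> 1" using nu by simp
    then show "u0 \<in> net n k D"
      unfolding net_def by (intro IntI image_eqI[OF _ vin] CollectI) (simp_all only: u0_def)
    have le: "\<bar>u i - u0 i\<bar> \<le> (if u i = 0 then 0 else 1 / c)" if "i < n" for i
    proof -
      have "u i - u0 i = (c * u i - w i) / c" using c u0[OF that] by (simp add: diff_divide_distrib)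
      then have "\<bar>u i - u0 i\<bar> = \<bar>c * u i - w i\<bar> / c" using c by (simp add: abs_divide)
      also have "\<dots> \<le> 1 / c" using w_diff[of i] c by (intro divide_right_mono) auto
      finally show ?thesis using w_0[of i] u0[OF that] by auto
    qed
    have "(vnorm n (\<lambda>i. u i - u0 i))\<^sup>2 \<le> (\<Sum>i<n. (if u i = 0 then 0 else 1 / c)\<^sup>2)"
      unfolding vnorm_power2
    proof (rule sum_mono)
      fix i assume "i \<in> {..<n}"
      then have "\<bar>u i - u0 i\<bar>\<^sup>2 \<le> (if u i = 0 then 0 else 1 / c)\<^sup>2"
        using le[of i] by (intro power_mono) auto
      then show "(u i - u0 i)\<^sup>2 \<le> (if u i = 0 then 0 else 1 / c)\<^sup>2" by simp
    qed
    also have "\<dots> = (\<Sum>i\<in>supp u. (1 / c)\<^sup>2)"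
      using supp_Rn[OF uR] by (intro sum.mono_neutral_cong_right) (auto simp: supp_def)
    also have "\<dots> \<le> k * (1 / c)\<^sup>2"
      using cu by (simp add: mult_right_mono)
    also have "\<dots> = (1 / D)\<^sup>2" using k D by (simp add: c_def power_mult_distrib power_divide)
    finally show "vnorm n (\<lambda>i. u i - u0 i) \<le> 1 / D"
      by (rule power2_le_imp_le) auto
  qed
qed

lemma net_vnorm:
  assumes "v \<in> net n k D" shows "v \<in> Rn n" "vnorm n v \<le> 1"
  using assms by (auto simp: net_def Rn_def)

subsection \<open>Gaussian linear forms\<close>

lemma prob_space_half_gaussian: "prob_space (half_gaussian n)"
  unfolding half_gaussian_def by (intro prob_space_PiM prob_space_normal_density) simp

lemma sets_half_gaussian [measurable_cong]: "sets (half_gaussian n) = sets (\<Pi>\<^sub>M i\<in>{..<n}. borel)"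
  unfolding half_gaussian_def by (intro sets_PiM_cong) auto

lemma ip_measurable_half [measurable]: "(\<lambda>w. ip n w c) \<in> borel_measurable (half_gaussian n)"
  unfolding ip_def by measurable

lemma ip_distributed:
  assumes c: "vnorm n c > 0"
  shows "distributed (half_gaussian n) lborel (\<lambda>w. ip n w c) (normal_density 0 (vnorm n c * sqrt (1/2)))"
proof -
  let ?H = "half_gaussian n" and ?N = "density lborel (normal_density 0 (sqrt (1/2)))"
  interpret prob_space ?H by (rule prob_space_half_gaussian)
  \<comment> \<open>Vanishing coefficients are dropped: the rules for affine images and for sums of
    independent normal variables require positive standard deviations.\<close>
  define J where "J = {i\<in>{..<n}. c i \<noteq> 0}"
  have J: "finite J" "J \<subseteq> {..<n}" by (auto simp: J_def)
  have "J \<noteq> {}"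
  proof
    assume "J = {}"
    then have "\<And>i. i < n \<Longrightarrow> c i = 0" by (auto simp: J_def)
    then have "vnorm n c = vnorm n (\<lambda>_. 0)" by (intro vnorm_cong) auto
    with c show False by (simp add: vnorm_def L2_set_def)
  qed
  then have ne: "{..<n} \<noteq> {}" using J by auto
  have comp: "distr ?H ?N (\<lambda>w. w i) = ?N" if "i < n" for i
    unfolding half_gaussian_def using that
    by (intro distr_PiM_component prob_space_normal_density) auto
  have iv: "indep_vars (\<lambda>_. ?N) (\<lambda>i w. w i) {..<n}"
  proof (subst indep_vars_iff_distr_eq_PiM'[OF ne])
    show "(\<lambda>w. w i) \<in> measurable ?H ?N" if "i \<in> {..<n}" for i
      using measurable_component_singleton[OF that, of "\<lambda>_. ?N"] by (simp add: half_gaussian_def)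
    have "distr ?H (\<Pi>\<^sub>M i\<in>{..<n}. ?N) (\<lambda>x. \<lambda>i\<in>{..<n}. x i) = distr ?H ?H (\<lambda>x. x)"
      by (intro distr_cong) (auto simp: half_gaussian_def space_PiM restrict_def fun_eq_iff PiE_def extensional_def)
    also have "\<dots> = ?H" by simp
    also have "\<dots> = (\<Pi>\<^sub>M i\<in>{..<n}. distr ?H ?N (\<lambda>w. w i))"
      unfolding half_gaussian_def[of n] by (intro PiM_cong) (use comp in \<open>auto simp: half_gaussian_def\<close>)
    finally show "distr ?H (\<Pi>\<^sub>M i\<in>{..<n}. ?N) (\<lambda>x. \<lambda>i\<in>{..<n}. x i) = (\<Pi>\<^sub>M i\<in>{..<n}. distr ?H ?N (\<lambda>w. w i))" .
  qed
  have iv2: "indep_vars (\<lambda>_. borel) (\<lambda>i w. 0 + c i * w i) J"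
    by (rule indep_vars_compose2[OF indep_vars_subset[OF iv J(2)]]) simp
  have d: "distributed ?H lborel (\<lambda>w. 0 + c i * w i) (normal_density (0 + c i * 0) (\<bar>c i\<bar> * sqrt (1/2)))" if "i \<in> J" for i
  proof (rule normal_density_affine)
    show "distributed ?H lborel (\<lambda>w. w i) (normal_density 0 (sqrt (1/2)))"
      unfolding distributed_def
    proof (intro conjI)
      have "distr ?H lborel (\<lambda>w. w i) = distr ?H ?N (\<lambda>w. w i)" by (intro distr_cong) auto
      then show "distr ?H lborel (\<lambda>w. w i) = density lborel (normal_density 0 (sqrt (1/2)))"
        using comp[of i] that J by auto
      show "(\<lambda>w. w i) \<in> measurable ?H lborel"
        using that J measurable_component_singleton[of i "{..<n}" "\<lambda>_. ?N"] by (auto simp: half_gaussian_def)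
    qed simp
  qed (use that in \<open>auto simp: J_def\<close>)
  have "distributed ?H lborel (\<lambda>w. \<Sum>i\<in>J. 0 + c i * w i)
     (normal_density (\<Sum>i\<in>J. 0 + c i * 0) (sqrt (\<Sum>i\<in>J. (\<bar>c i\<bar> * sqrt (1/2))\<^sup>2)))"
    by (rule sum_indep_normal[OF J(1) \<open>J \<noteq> {}\<close> iv2 _ d]) (auto simp: J_def)
  moreover have "(\<Sum>i\<in>J. 0 + c i * w i) = ip n w c" for w
    unfolding ip_def by (rule sum.mono_neutral_cong_left) (auto simp: J_def)
  moreover have "sqrt (\<Sum>i\<in>J. (\<bar>c i\<bar> * sqrt (1/2))\<^sup>2) = vnorm n c * sqrt (1/2)"
  proof -
    have "(\<Sum>i\<in>J. (\<bar>c i\<bar> * sqrt (1/2))\<^sup>2) = (\<Sum>i\<in>J. (c i)\<^sup>2) * (1/2)"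
      by (simp add: power_mult_distrib sum_distrib_right real_sqrt_pow2)
    also have "(\<Sum>i\<in>J. (c i)\<^sup>2) = (\<Sum>i<n. (c i)\<^sup>2)"
      by (rule sum.mono_neutral_left) (auto simp: J_def)
    finally show ?thesis by (simp only: real_sqrt_mult vnorm_def L2_set_def)
  qed
  ultimately show ?thesis by simp
qed

lemma ip_moments:
  shows "integrable (half_gaussian n) (\<lambda>w. (ip n w c)\<^sup>2)"
    and "integrable (half_gaussian n) (\<lambda>w. (ip n w c)^4)"
    and "(\<integral>w. (ip n w c)\<^sup>2 \<partial>half_gaussian n) = (vnorm n c)\<^sup>2 / 2"
    and "(\<integral>w. (ip n w c)^4 \<partial>half_gaussian n) = 3 / 4 * (vnorm n c)^4"
proof -
  interpret prob_space "half_gaussian n" by (rule prob_space_half_gaussian)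
  have "integrable (half_gaussian n) (\<lambda>w. (ip n w c)\<^sup>2) \<and> integrable (half_gaussian n) (\<lambda>w. (ip n w c)^4) \<and>
    (\<integral>w. (ip n w c)\<^sup>2 \<partial>half_gaussian n) = (vnorm n c)\<^sup>2 / 2 \<and>
    (\<integral>w. (ip n w c)^4 \<partial>half_gaussian n) = 3 / 4 * (vnorm n c)^4"
  proof (cases "vnorm n c = 0")
    case True
    then have "ip n w c = 0" for w by (auto simp: ip_def intro!: sum.neutral dest: vnorm_eq_0D)
    then show ?thesis using True by simp
  next
    case False
    define \<sigma> where "\<sigma> = vnorm n c * sqrt (1/2)"
    have c: "vnorm n c > 0" using False vnorm_nonneg[of n c] by linarith
    then have \<sigma>: "0 < \<sigma>" by (simp add: \<sigma>_def)
    have s2: "\<sigma>\<^sup>2 = (vnorm n c)\<^sup>2 / 2" by (simp add: \<sigma>_def power_mult_distrib)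
    have eq: "(\<integral>w. (ip n w c)^(2*k) \<partial>half_gaussian n) = fact (2 * k) / ((2 / \<sigma>\<^sup>2)^k * fact k)" for k
      using distributed_integral[OF ip_distributed[OF c], of "\<lambda>x. x^(2*k)"] integral_normal_moment_even[OF \<sigma>, of 0 k]
      by (simp add: \<sigma>_def normal_density_nonneg)
    have int: "integrable (half_gaussian n) (\<lambda>w. (ip n w c)^(2*k))" for k
      using distributed_integrable[OF ip_distributed[OF c], of "\<lambda>x. x^(2*k)"]
        integrable_normal_moment[OF \<sigma>, of 0 "2*k"]
      by (simp add: \<sigma>_def normal_density_nonneg)
    have "\<sigma>^4 = (vnorm n c)^4 / 4"
      using arg_cong[OF s2, of "\<lambda>x. x\<^sup>2"] by (simp add: power_divide power_mult[symmetric])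
    then show ?thesis using eq[of 1] eq[of 2] int[of 1] int[of 2] s2
      by (simp add: fact_numeral power_divide power_mult[symmetric])
  qed
  then show "integrable (half_gaussian n) (\<lambda>w. (ip n w c)\<^sup>2)"
    and "integrable (half_gaussian n) (\<lambda>w. (ip n w c)^4)"
    and "(\<integral>w. (ip n w c)\<^sup>2 \<partial>half_gaussian n) = (vnorm n c)\<^sup>2 / 2"
    and "(\<integral>w. (ip n w c)^4 \<partial>half_gaussian n) = 3 / 4 * (vnorm n c)^4" by auto
qed

lemma ip_linear:
  "ip n w (\<lambda>i. p i + q i) = ip n w p + ip n w q" "ip n w (\<lambda>i. p i - q i) = ip n w p - ip n w q"
  "ip n w (\<lambda>i. c * p i) = c * ip n w p" "ip n (\<lambda>i. p i + q i) w = ip n p w + ip n q w"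
  "ip n (\<lambda>i. p i - q i) w = ip n p w - ip n q w" "ip n (\<lambda>i. c * p i) w = c * ip n p w"
  by (simp_all add: ip_def sum.distrib sum_subtractf sum_distrib_left algebra_simps)

text \<open>By polarization, products of two forms and of their squares are linear combinations of
  squares and fourth powers of single forms. One-dimensional normal moments therefore suffice, and
  the joint law of two forms never appears.\<close>

lemma ip_joint_moments:
  shows "integrable (half_gaussian n) (\<lambda>w. ip n w p * ip n w q)"
    and "integrable (half_gaussian n) (\<lambda>w. (ip n w p)\<^sup>2 * (ip n w q)\<^sup>2)"
    and "(\<integral>w. ip n w p * ip n w q \<partial>half_gaussian n) = ip n p q / 2"
    and "(\<integral>w. (ip n w p)\<^sup>2 * (ip n w q)\<^sup>2 \<partial>half_gaussian n) =
      ((vnorm n p)\<^sup>2 * (vnorm n q)\<^sup>2 + 2 * (ip n p q)\<^sup>2) / 4"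
proof -
  let ?H = "half_gaussian n"
  let ?a = "\<lambda>i. p i + q i" and ?d = "\<lambda>i. p i - q i"
  have 2: "ip n w p * ip n w q = ((ip n w ?a)\<^sup>2 - (ip n w ?d)\<^sup>2) / 4" for w
    by (simp add: ip_linear power2_eq_square algebra_simps)
  have 4: "(ip n w p)\<^sup>2 * (ip n w q)\<^sup>2 =
      ((ip n w ?a)^4 + (ip n w ?d)^4 - 2 * (ip n w p)^4 - 2 * (ip n w q)^4) / 12" for w
    by (simp add: ip_linear power2_eq_square power4_eq_xxxx algebra_simps)
  have pa: "(vnorm n ?a)\<^sup>2 = (vnorm n p)\<^sup>2 + (vnorm n q)\<^sup>2 + 2 * ip n p q"
    and pd: "(vnorm n ?d)\<^sup>2 = (vnorm n p)\<^sup>2 + (vnorm n q)\<^sup>2 - 2 * ip n p q"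
    by (simp_all add: vnorm_power2_ip ip_linear ip_commute[of n q p])
  have v4: "(vnorm n c)^4 = ((vnorm n c)\<^sup>2)\<^sup>2" for c by (simp add: power_mult[symmetric])
  show "integrable ?H (\<lambda>w. ip n w p * ip n w q)"
    and "(\<integral>w. ip n w p * ip n w q \<partial>?H) = ip n p q / 2"
    unfolding 2 using ip_moments(1)[of n ?a] ip_moments(1)[of n ?d]
    by (simp_all add: ip_moments pa pd field_simps)
  note i = ip_moments(2)[of n ?a] ip_moments(2)[of n ?d] ip_moments(2)[of n p] ip_moments(2)[of n q]
  show "integrable ?H (\<lambda>w. (ip n w p)\<^sup>2 * (ip n w q)\<^sup>2)"
    unfolding 4 using i by auto
  have "(\<integral>w. (ip n w p)\<^sup>2 * (ip n w q)\<^sup>2 \<partial>?H) =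
      (3/4 * (vnorm n ?a)^4 + 3/4 * (vnorm n ?d)^4 - 2 * (3/4 * (vnorm n p)^4) - 2 * (3/4 * (vnorm n q)^4)) / 12"
    unfolding 4 using i by (simp add: ip_moments(4))
  also have "\<dots> = ((vnorm n p)\<^sup>2 * (vnorm n q)\<^sup>2 + 2 * (ip n p q)\<^sup>2) / 4"
    unfolding v4 pa pd by (simp add: power2_eq_square algebra_simps)
  finally show "(\<integral>w. (ip n w p)\<^sup>2 * (ip n w q)\<^sup>2 \<partial>?H) = \<dots>" .
qed

text \<open>Tilting the normal law of variance 1/2 by this exponential gives \<open>sqrt 2\<close>
  times the law of variance 1. The exponent 1/2 stays below the critical value 1 at which the
  integral diverges.\<close>

lemma normal_density_exp_square:
  "normal_density 0 (sqrt (1/2)) x * exp (x\<^sup>2 / 2) = sqrt 2 * std_normal_density x"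
proof -
  have "exp (- x\<^sup>2) * exp (x\<^sup>2 / 2) = exp (- x\<^sup>2 / 2)"
    by (simp add: exp_add[symmetric])
  then show ?thesis
    by (simp add: normal_density_def std_normal_density_def real_sqrt_mult real_sqrt_divide field_simps)
qed

lemma ip_exp_moment:
  assumes "vnorm n c \<le> 1"
  shows "(\<integral>\<^sup>+w. exp ((ip n w c)\<^sup>2 / 2) \<partial>half_gaussian n) \<le> ennreal (sqrt 2)"
proof -
  interpret prob_space "half_gaussian n" by (rule prob_space_half_gaussian)
  show ?thesis
  proof (cases "vnorm n c = 0")
    case True
    then have "ip n w c = 0" for w by (auto simp: ip_def intro!: sum.neutral dest: vnorm_eq_0D)
    then show ?thesis by (simp add: emeasure_space_1)
  next
    case False
    let ?d = "nrm n c"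
    have d1: "vnorm n ?d = 1"
    proof -
      have "?d = (\<lambda>i. (1 / vnorm n c) * c i)" by (auto simp: nrm_def)
      then show ?thesis using False vnorm_scale[of n "1 / vnorm n c" c] by simp
    qed
    have le: "(ip n w c)\<^sup>2 \<le> (ip n w ?d)\<^sup>2" for w
    proof -
      have "ip n w c = vnorm n c * ip n w ?d"
        unfolding ip_def sum_distrib_left using False by (intro sum.cong) (auto simp: nrm_def)
      then have "\<bar>ip n w c\<bar> \<le> 1 * \<bar>ip n w ?d\<bar>"
        using assms by (simp add: abs_mult mult_left_le_one_le)
      then show ?thesis by (simp add: abs_le_square_iff)
    qed
    have "(\<integral>\<^sup>+w. exp ((ip n w c)\<^sup>2 / 2) \<partial>half_gaussian n) \<le> (\<integral>\<^sup>+w. exp ((ip n w ?d)\<^sup>2 / 2) \<partial>half_gaussian n)"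
      by (intro nn_integral_mono ennreal_leI) (use le in auto)
    also have "\<dots> = (\<integral>\<^sup>+x. ennreal (normal_density 0 (sqrt (1/2)) x) * ennreal (exp (x\<^sup>2 / 2)) \<partial>lborel)"
      using distributed_nn_integral[OF ip_distributed, of n ?d "\<lambda>x. ennreal (exp (x\<^sup>2 / 2))"] d1 by simp
    also have "\<dots> = (\<integral>\<^sup>+x. ennreal (sqrt 2) * ennreal (std_normal_density x) \<partial>lborel)"
    proof (rule nn_integral_cong)
      fix x :: real
      have "ennreal (normal_density 0 (sqrt (1/2)) x) * ennreal (exp (x\<^sup>2 / 2)) =
          ennreal (normal_density 0 (sqrt (1/2)) x * exp (x\<^sup>2 / 2))"
        by (rule ennreal_mult[symmetric]) auto
      also have "\<dots> = ennreal (sqrt 2 * std_normal_density x)" by (simp only: normal_density_exp_square)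
      also have "\<dots> = ennreal (sqrt 2) * ennreal (std_normal_density x)" by (rule ennreal_mult) auto
      finally show "ennreal (normal_density 0 (sqrt (1/2)) x) * ennreal (exp (x\<^sup>2 / 2)) = ennreal (sqrt 2) * ennreal (std_normal_density x)" .
    qed
    also have "\<dots> = ennreal (sqrt 2) * 1"
      by (subst nn_integral_cmult) (simp_all add: nn_integral_eq_integral)
    finally show ?thesis by simp
  qed
qed

section \<open>Forms in a complex Gaussian vector\<close>

definition ar :: "nat \<Rightarrow> (nat \<Rightarrow> real) \<Rightarrow> (nat \<Rightarrow> complex) \<Rightarrow> real" where
  "ar n p a = (\<Sum>i<n. Re (a i) * p i)"

definition ai :: "nat \<Rightarrow> (nat \<Rightarrow> real) \<Rightarrow> (nat \<Rightarrow> complex) \<Rightarrow> real" where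
  "ai n p a = (\<Sum>i<n. Im (a i) * p i)"

text \<open>The polar form of the phaseless measurement: \<open>bf n p p a\<close> is the squared
  modulus of the inner product of \<open>a\<close> and \<open>p\<close>. It is symmetric, bilinear
  and positive semidefinite, hence obeys Cauchy--Schwarz for each fixed \<open>a\<close>.\<close>

definition bf :: "nat \<Rightarrow> (nat \<Rightarrow> real) \<Rightarrow> (nat \<Rightarrow> real) \<Rightarrow> (nat \<Rightarrow> complex) \<Rightarrow> real" where
  "bf n p q a = ar n p a * ar n q a + ai n p a * ai n q a"

lemma ar_linear:
  "ar n (\<lambda>i. p i + q i) a = ar n p a + ar n q a" "ar n (\<lambda>i. p i - q i) a = ar n p a - ar n q a"
  "ar n (\<lambda>i. c * p i) a = c * ar n p a" "ar n (\<lambda>i. - p i) a = - ar n p a"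
  "ai n (\<lambda>i. p i + q i) a = ai n p a + ai n q a" "ai n (\<lambda>i. p i - q i) a = ai n p a - ai n q a"
  "ai n (\<lambda>i. c * p i) a = c * ai n p a" "ai n (\<lambda>i. - p i) a = - ai n p a"
  by (simp_all add: ar_def ai_def sum.distrib sum_subtractf sum_distrib_left algebra_simps sum_negf)

lemma bf_linear:
  "bf n (\<lambda>i. p i + q i) r a = bf n p r a + bf n q r a" "bf n (\<lambda>i. p i - q i) r a = bf n p r a - bf n q r a"
  "bf n (\<lambda>i. c * p i) r a = c * bf n p r a" "bf n (\<lambda>i. - p i) r a = - bf n p r a"
  "bf n r (\<lambda>i. p i + q i) a = bf n r p a + bf n r q a" "bf n r (\<lambda>i. p i - q i) a = bf n r p a - bf n r q a"
  "bf n r (\<lambda>i. c * p i) a = c * bf n r p a" "bf n r (\<lambda>i. - p i) a = - bf n r p a"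
  by (simp_all add: bf_def ar_linear algebra_simps)

lemma bf_commute: "bf n p q a = bf n q p a"
  by (simp add: bf_def mult.commute)

lemma bf_nonneg [simp]: "0 \<le> bf n p p a"
  by (simp add: bf_def)

lemma bf_cong:
  assumes "\<And>i. i < n \<Longrightarrow> p i = p' i" "\<And>i. i < n \<Longrightarrow> q i = q' i"
  shows "bf n p q a = bf n p' q' a"
  using assms by (simp add: bf_def ar_def ai_def)

lemma bf_nrm: "bf n p q a = vnorm n p * bf n (nrm n p) q a"
  unfolding bf_linear(3)[symmetric] by (rule bf_cong) (auto intro: nrm_scale)

lemma bf_nrm2: "bf n p q a = vnorm n p * vnorm n q * bf n (nrm n p) (nrm n q) a"
  using bf_nrm[of n p q a] bf_nrm[of n q "nrm n p" a] by (simp add: bf_commute)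

lemma bf_Cauchy_Schwarz: "(bf n p q a)\<^sup>2 \<le> bf n p p a * bf n q q a"
proof -
  have "bf n p p a * bf n q q a - (bf n p q a)\<^sup>2 = (ar n p a * ai n q a - ai n p a * ar n q a)\<^sup>2"
    by (simp add: bf_def power2_eq_square algebra_simps)
  then show ?thesis by (smt (verit) zero_le_power2)
qed

lemma complex_gaussian_map [measurable]:
  "(\<lambda>(p, q). \<lambda>i\<in>{..<n}. Complex (p i) (q i)) \<in>
    measurable (half_gaussian n \<Otimes>\<^sub>M half_gaussian n) (\<Pi>\<^sub>M i\<in>{..<n}. borel)"
proof -
  have [measurable]: "(\<lambda>w. Complex (fst w i) (snd w i)) \<in> borel_measurable (half_gaussian n \<Otimes>\<^sub>M half_gaussian n)"
    if "i < n" for i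
    unfolding complex_eq_iff[symmetric] using that
    by (subst borel_measurable_complex_iff) (simp, measurable)
  show ?thesis
    unfolding case_prod_beta by (rule measurable_restrict) auto
qed

lemma prob_space_complex_gaussian: "prob_space (complex_gaussian n)"
proof -
  interpret H: prob_space "half_gaussian n" by (rule prob_space_half_gaussian)
  interpret P: pair_prob_space "half_gaussian n" "half_gaussian n" by unfold_locales
  show ?thesis unfolding complex_gaussian_def by (rule P.prob_space_distr) measurable
qed

lemma sets_complex_gaussian [measurable_cong]: "sets (complex_gaussian n) = sets (\<Pi>\<^sub>M i\<in>{..<n}. borel)"
  by (simp add: complex_gaussian_def)

lemma ar_ai_measurable [measurable]:
  "ar n p \<in> borel_measurable (complex_gaussian n)" "ai n p \<in> borel_measurable (complex_gaussian n)"
  unfolding ar_def ai_def by measurable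

lemma bf_measurable [measurable]: "bf n p q \<in> borel_measurable (complex_gaussian n)"
  unfolding bf_def by measurable

lemma ar_ai_complex_gaussian_map:
  "ar n p (case w of (x, y) \<Rightarrow> \<lambda>i\<in>{..<n}. Complex (x i) (y i)) = ip n (fst w) p"
  "ai n p (case w of (x, y) \<Rightarrow> \<lambda>i\<in>{..<n}. Complex (x i) (y i)) = ip n (snd w) p"
  by (simp_all add: ar_def ai_def ip_def case_prod_beta)

text \<open>For a unit vector, \<open>bf n p p\<close> is a sum of two independent squared normal
  variables of variance 1/2, that is, exponential with mean 1; its moment at exponent 1/2 equals 2.
  All integrability and tail estimates rest on this bound.\<close>

lemma bf_exp_moment:
  assumes "vnorm n p \<le> 1"
  shows "integrable (complex_gaussian n) (\<lambda>a. exp (bf n p p a / 2))"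
    and "(\<integral>a. exp (bf n p p a / 2) \<partial>complex_gaussian n) \<le> 2"
proof -
  interpret H: prob_space "half_gaussian n" by (rule prob_space_half_gaussian)
  interpret P: pair_prob_space "half_gaussian n" "half_gaussian n" by unfold_locales
  let ?e = "\<lambda>w. ennreal (exp ((ip n w p)\<^sup>2 / 2))"
  have "(\<integral>\<^sup>+a. exp (bf n p p a / 2) \<partial>complex_gaussian n) =
    (\<integral>\<^sup>+w. exp (((ip n (fst w) p)\<^sup>2 + (ip n (snd w) p)\<^sup>2) / 2) \<partial>(half_gaussian n \<Otimes>\<^sub>M half_gaussian n))"
    unfolding complex_gaussian_def
    by (subst nn_integral_distr) (simp_all add: bf_def ar_ai_complex_gaussian_map power2_eq_square sets_complex_gaussian[unfolded complex_gaussian_def])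
  also have "\<dots> = (\<integral>\<^sup>+w. ?e (fst w) * ?e (snd w) \<partial>(half_gaussian n \<Otimes>\<^sub>M half_gaussian n))"
    by (simp add: ennreal_mult[symmetric] exp_add[symmetric] add_divide_distrib)
  also have "\<dots> = (\<integral>\<^sup>+x. \<integral>\<^sup>+y. ?e x * ?e y \<partial>half_gaussian n \<partial>half_gaussian n)"
    by (subst H.nn_integral_fst[symmetric]) simp_all
  also have "\<dots> = (\<integral>\<^sup>+x. ?e x \<partial>half_gaussian n) * (\<integral>\<^sup>+y. ?e y \<partial>half_gaussian n)"
    by (simp add: nn_integral_cmult nn_integral_multc)
  also have "\<dots> \<le> ennreal (sqrt 2) * ennreal (sqrt 2)"
    by (intro mult_mono ip_exp_moment assms) auto
  also have "\<dots> = ennreal 2" by (simp add: ennreal_mult[symmetric])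
  finally have *: "(\<integral>\<^sup>+a. exp (bf n p p a / 2) \<partial>complex_gaussian n) \<le> ennreal 2" .
  show int: "integrable (complex_gaussian n) (\<lambda>a. exp (bf n p p a / 2))"
    by (rule integrableI_bounded) (use * in \<open>auto simp: less_top[symmetric] top_unique\<close>)
  show "(\<integral>a. exp (bf n p p a / 2) \<partial>complex_gaussian n) \<le> 2"
    using * nn_integral_eq_integral[OF int] ennreal_le_iff[of 2] by simp
qed

text \<open>Three exponentials are allowed because the expressions to be averaged contain up to
  three fixed vectors; 6 is three times the bound 2 on one exponential moment.\<close>

lemma integrable_bf_dominated:
  fixes f :: "(nat \<Rightarrow> complex) \<Rightarrow> real"
  assumes [measurable]: "f \<in> borel_measurable (complex_gaussian n)"
    and p: "vnorm n p \<le> 1" and q: "vnorm n q \<le> 1" and r: "vnorm n r \<le> 1"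
    and f: "\<And>a. \<bar>f a\<bar> \<le> C * (exp (bf n p p a / 2) + exp (bf n q q a / 2) + exp (bf n r r a / 2))"
    and C: "0 \<le> C"
  shows "integrable (complex_gaussian n) f" and "\<bar>\<integral>a. f a \<partial>complex_gaussian n\<bar> \<le> 6 * C"
proof -
  let ?g = "\<lambda>a. C * (exp (bf n p p a / 2) + exp (bf n q q a / 2) + exp (bf n r r a / 2))"
  have ig: "integrable (complex_gaussian n) ?g"
    using bf_exp_moment(1)[OF p] bf_exp_moment(1)[OF q] bf_exp_moment(1)[OF r] by auto
  show 1: "integrable (complex_gaussian n) f"
    by (rule Bochner_Integration.integrable_bound[OF ig]) (use f in \<open>auto intro!: order.trans[OF f]\<close>)
  have "\<bar>\<integral>a. f a \<partial>complex_gaussian n\<bar> \<le> (\<integral>a. \<bar>f a\<bar> \<partial>complex_gaussian n)"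
    using integral_norm_bound[of "complex_gaussian n" f] by simp
  also have "\<dots> \<le> (\<integral>a. ?g a \<partial>complex_gaussian n)"
    by (intro integral_mono integrable_abs 1 ig f)
  also have "\<dots> \<le> C * (2 + 2 + 2)"
    using bf_exp_moment[OF p] bf_exp_moment[OF q] bf_exp_moment[OF r] C
    by (simp add: mult_left_mono)
  finally show "\<bar>\<integral>a. f a \<partial>complex_gaussian n\<bar> \<le> 6 * C" by simp
qed

lemma integral_complex_gaussian_product:
  assumes f: "integrable (half_gaussian n) f" and g: "integrable (half_gaussian n) (g :: _ \<Rightarrow> real)"
  shows "integrable (half_gaussian n \<Otimes>\<^sub>M half_gaussian n) (\<lambda>w. f (fst w) * g (snd w))"
    and "(\<integral>w. f (fst w) * g (snd w) \<partial>(half_gaussian n \<Otimes>\<^sub>M half_gaussian n)) =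
      (\<integral>x. f x \<partial>half_gaussian n) * (\<integral>y. g y \<partial>half_gaussian n)"
proof -
  interpret H: prob_space "half_gaussian n" by (rule prob_space_half_gaussian)
  interpret P: pair_prob_space "half_gaussian n" "half_gaussian n" by unfold_locales
  have [measurable]: "f \<in> borel_measurable (half_gaussian n)" "g \<in> borel_measurable (half_gaussian n)"
    using f g by auto
  show i: "integrable (half_gaussian n \<Otimes>\<^sub>M half_gaussian n) (\<lambda>w. f (fst w) * g (snd w))"
    by (rule P.Fubini_integrable) (use f g in \<open>auto simp: abs_mult\<close>)
  show "(\<integral>w. f (fst w) * g (snd w) \<partial>(half_gaussian n \<Otimes>\<^sub>M half_gaussian n)) =
      (\<integral>x. f x \<partial>half_gaussian n) * (\<integral>y. g y \<partial>half_gaussian n)"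
    using P.integral_fst'[OF i] by simp
qed

lemma bf_moments:
  shows "integrable (complex_gaussian n) (\<lambda>a. bf n p p a)"
    and "integrable (complex_gaussian n) (\<lambda>a. (bf n p q a)\<^sup>2)"
    and "(\<integral>a. bf n p p a \<partial>complex_gaussian n) = (vnorm n p)\<^sup>2"
    and "(\<integral>a. (bf n p q a)\<^sup>2 \<partial>complex_gaussian n) =
      (vnorm n p)\<^sup>2 * (vnorm n q)\<^sup>2 / 2 + 3 / 2 * (ip n p q)\<^sup>2"
proof -
  let ?H = "half_gaussian n" and ?T = "\<lambda>(p, q). \<lambda>i\<in>{..<n}. Complex (p i) (q i)"
  interpret H: prob_space ?H by (rule prob_space_half_gaussian)
  have c1: "integrable ?H (\<lambda>_. 1::real)" by simp
  note P = integral_complex_gaussian_product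
  note j2 = ip_joint_moments(1)[of n p p] ip_joint_moments(1)[of n p q] and j4 = ip_joint_moments(2)[of n p q]
  have d1: "bf n p p (?T w) = ip n (fst w) p * ip n (fst w) p * 1 + 1 * (ip n (snd w) p * ip n (snd w) p)" for w
    by (simp add: bf_def ar_ai_complex_gaussian_map)
  have d2: "(bf n p q (?T w))\<^sup>2 = (ip n (fst w) p)\<^sup>2 * (ip n (fst w) q)\<^sup>2 * 1 + 1 * ((ip n (snd w) p)\<^sup>2 * (ip n (snd w) q)\<^sup>2)
      + 2 * ((ip n (fst w) p * ip n (fst w) q) * (ip n (snd w) p * ip n (snd w) q))" for w
    by (simp add: bf_def ar_ai_complex_gaussian_map power2_eq_square algebra_simps)
  have e: "(\<integral>w. (ip n (fst w) p)\<^sup>2 * (ip n (fst w) q)\<^sup>2 \<partial>(?H \<Otimes>\<^sub>M ?H)) = ((vnorm n p)\<^sup>2 * (vnorm n q)\<^sup>2 + 2 * (ip n p q)\<^sup>2) / 4"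
    "(\<integral>w. (ip n (snd w) p)\<^sup>2 * (ip n (snd w) q)\<^sup>2 \<partial>(?H \<Otimes>\<^sub>M ?H)) = ((vnorm n p)\<^sup>2 * (vnorm n q)\<^sup>2 + 2 * (ip n p q)\<^sup>2) / 4"
    "(\<integral>w. (ip n (fst w) p * ip n (fst w) q) * (ip n (snd w) p * ip n (snd w) q) \<partial>(?H \<Otimes>\<^sub>M ?H)) = ip n p q / 2 * (ip n p q / 2)"
    using P(2)[OF j4 c1] P(2)[OF c1 j4] P(2)[OF j2(2) j2(2)] by (simp_all only: ip_joint_moments) (simp_all add: H.prob_space)
  have m: "bf n p q \<in> borel_measurable (\<Pi>\<^sub>M i\<in>{..<n}. borel)" for p q
    using bf_measurable[of n p q] by (simp cong: measurable_cong_sets add: sets_complex_gaussian)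
  have m2: "(\<lambda>a. (bf n p q a)\<^sup>2) \<in> borel_measurable (\<Pi>\<^sub>M i\<in>{..<n}. borel)"
    using m[of p q] by measurable
  show "integrable (complex_gaussian n) (\<lambda>a. bf n p p a)"
    unfolding complex_gaussian_def
    by (subst integrable_distr_eq[OF complex_gaussian_map m], unfold d1)
      (intro Bochner_Integration.integrable_add P(1)[OF j2(1) c1] P(1)[OF c1 j2(1)])
  show "integrable (complex_gaussian n) (\<lambda>a. (bf n p q a)\<^sup>2)"
    unfolding complex_gaussian_def
    by (subst integrable_distr_eq[OF complex_gaussian_map m2], unfold d2)
      (intro Bochner_Integration.integrable_add integrable_mult_right P(1)[OF j4 c1] P(1)[OF c1 j4] P(1)[OF j2(2) j2(2)])
  show "(\<integral>a. bf n p p a \<partial>complex_gaussian n) = (vnorm n p)\<^sup>2"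
    unfolding complex_gaussian_def
    apply (subst integral_distr[OF complex_gaussian_map m], unfold d1)
    apply (subst Bochner_Integration.integral_add[OF P(1)[OF j2(1) c1] P(1)[OF c1 j2(1)]])
    apply (simp only: P(2)[OF j2(1) c1] P(2)[OF c1 j2(1)] ip_joint_moments)
    apply (simp add: vnorm_power2_ip H.prob_space)
    done
  show "(\<integral>a. (bf n p q a)\<^sup>2 \<partial>complex_gaussian n) =
      (vnorm n p)\<^sup>2 * (vnorm n q)\<^sup>2 / 2 + 3 / 2 * (ip n p q)\<^sup>2"
    unfolding complex_gaussian_def
    apply (subst integral_distr[OF complex_gaussian_map m2], unfold d2)
    apply (subst Bochner_Integration.integral_add[OF Bochner_Integration.integrable_add[OF P(1)[OF j4 c1] P(1)[OF c1 j4]] integrable_mult_right[OF P(1)[OF j2(2) j2(2)]]])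
    apply (subst Bochner_Integration.integral_add[OF P(1)[OF j4 c1] P(1)[OF c1 j4]])
    apply (simp only: mult_1_left mult_1_right integral_mult_right_zero e)
    apply (simp add: power2_eq_square field_simps)
    done
qed

text \<open>Polarization in the second argument. Doubled, and with \<open>p = x\<close>, this is the
  formula for the leading part of the mean gradient: \<open>bf n x u * bf n x h\<close> is what
  remains to first order in \<open>h\<close>.\<close>

lemma bf_polarized_moment:
  shows "integrable (complex_gaussian n) (\<lambda>a. bf n p q a * bf n p r a)"
    and "(\<integral>a. bf n p q a * bf n p r a \<partial>complex_gaussian n) =
      (vnorm n p)\<^sup>2 * ip n q r / 2 + 3 / 2 * ip n p q * ip n p r"
proof -
  let ?s = "\<lambda>i. q i + r i" and ?d = "\<lambda>i. q i - r i"
  have eq: "bf n p q a * bf n p r a = ((bf n p ?s a)\<^sup>2 - (bf n p ?d a)\<^sup>2) / 4" for a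
    by (simp add: bf_linear power2_eq_square algebra_simps)
  have v: "(vnorm n ?s)\<^sup>2 - (vnorm n ?d)\<^sup>2 = 4 * ip n q r"
    by (simp add: vnorm_power2_ip ip_linear ip_commute[of n r q])
  have w: "(ip n p ?s)\<^sup>2 - (ip n p ?d)\<^sup>2 = 4 * ip n p q * ip n p r"
    by (simp add: ip_linear power2_eq_square algebra_simps)
  note i = bf_moments(2)[of n p ?s] bf_moments(2)[of n p ?d]
  show "integrable (complex_gaussian n) (\<lambda>a. bf n p q a * bf n p r a)"
    unfolding eq using i by auto
  have "(\<integral>a. bf n p q a * bf n p r a \<partial>complex_gaussian n) =
     ((vnorm n p)\<^sup>2 * ((vnorm n ?s)\<^sup>2 - (vnorm n ?d)\<^sup>2) / 2 + 3 / 2 * ((ip n p ?s)\<^sup>2 - (ip n p ?d)\<^sup>2)) / 4"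
    unfolding eq using i by (simp add: bf_moments(4) field_simps)
  then show "(\<integral>a. bf n p q a * bf n p r a \<partial>complex_gaussian n) =
      (vnorm n p)\<^sup>2 * ip n q r / 2 + 3 / 2 * ip n p q * ip n p r"
    unfolding v w by (simp add: field_simps)
qed

subsection \<open>Concentration of sample averages\<close>

definition block :: "nat \<Rightarrow> nat \<Rightarrow> (nat \<Rightarrow> nat \<Rightarrow> complex) measure" where
  "block n m = (\<Pi>\<^sub>M j\<in>{..<m}. complex_gaussian n)"

definition avg :: "nat \<Rightarrow> (nat \<Rightarrow> real) \<Rightarrow> real" where
  "avg m f = (\<Sum>j<m. f j) / m"

abbreviation mean :: "nat \<Rightarrow> ((nat \<Rightarrow> complex) \<Rightarrow> real) \<Rightarrow> real" where
  "mean n f \<equiv> (\<integral>a. f a \<partial>complex_gaussian n)"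

lemma prob_space_block: "prob_space (block n m)"
  unfolding block_def by (intro prob_space_PiM prob_space_complex_gaussian)

lemma block_measurable:
  assumes "f \<in> borel_measurable (complex_gaussian n)" and "j < m"
  shows "(\<lambda>a. f (a j)) \<in> borel_measurable (block n m)"
  unfolding block_def using assms
  by (intro measurable_compose[OF measurable_component_singleton]) auto

lemma avg_measurable_block [measurable]:
  assumes "f \<in> borel_measurable (complex_gaussian n)"
  shows "(\<lambda>a. avg m (\<lambda>j. f (a j)) :: real) \<in> borel_measurable (block n m)"
  unfolding avg_def by (intro borel_measurable_divide borel_measurable_sum block_measurable[OF assms]) auto

lemma avg_linear:
  "avg m (\<lambda>j. f j + g j) = avg m f + avg m g" "avg m (\<lambda>j. f j - g j) = avg m f - avg m g"
  "avg m (\<lambda>j. c * f j) = c * avg m f" "avg m (\<lambda>j. - f j) = - avg m f"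
  by (simp_all add: avg_def sum.distrib sum_subtractf sum_distrib_left[symmetric] add_divide_distrib diff_divide_distrib sum_negf)

lemma avg_mono: "(\<And>j. j < m \<Longrightarrow> f j \<le> g j) \<Longrightarrow> avg m f \<le> avg m g"
  unfolding avg_def by (intro divide_right_mono sum_mono) auto

lemma avg_nonneg: "(\<And>j. j < m \<Longrightarrow> 0 \<le> f j) \<Longrightarrow> 0 \<le> avg m f"
  unfolding avg_def by (intro divide_nonneg_nonneg sum_nonneg) auto

lemma avg_Cauchy_Schwarz: "\<bar>avg m (\<lambda>j. f j * g j)\<bar> \<le> sqrt (avg m (\<lambda>j. (f j)\<^sup>2)) * sqrt (avg m (\<lambda>j. (g j)\<^sup>2))"
proof -
  have "\<bar>\<Sum>j<m. f j * g j\<bar> \<le> (\<Sum>j<m. \<bar>f j\<bar> * \<bar>g j\<bar>)"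
    using sum_abs[of "\<lambda>j. f j * g j" "{..<m}"] by (simp add: abs_mult)
  also have "\<dots> \<le> L2_set f {..<m} * L2_set g {..<m}" by (rule L2_set_mult_ineq)
  finally have "\<bar>avg m (\<lambda>j. f j * g j)\<bar> \<le> (L2_set f {..<m} * L2_set g {..<m}) / (sqrt m * sqrt m)"
    by (simp add: avg_def divide_right_mono)
  then show ?thesis by (simp add: avg_def L2_set_def real_sqrt_divide)
qed

lemma exp_le_quadratic: "exp x \<le> 1 + x + x\<^sup>2 / 2 * exp \<bar>x\<bar>" for x :: real
proof -
  obtain t where t: "\<bar>t\<bar> \<le> \<bar>x\<bar>" "exp x = (\<Sum>k<2. x ^ k / fact k) + exp t / fact 2 * x ^ 2"
    using Maclaurin_exp_le[of x 2] by blast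
  have "exp t * x\<^sup>2 \<le> exp \<bar>x\<bar> * x\<^sup>2" using t(1) by (intro mult_right_mono) auto
  then show ?thesis using t(2) by (simp add: numeral_2_eq_2 algebra_simps)
qed

lemma power_le_exp: "0 \<le> x \<Longrightarrow> x ^ k / fact k \<le> exp (x::real)"

proof -
  assume x: "0 \<le> x"
  have s: "(\<lambda>n. x ^ n /\<^sub>R fact n) sums exp x" by (rule exp_converges)
  have "(\<Sum>n\<in>{k}. x ^ n /\<^sub>R fact n) \<le> (\<Sum>n. x ^ n /\<^sub>R fact n)"
    using x s by (intro sum_le_suminf) (auto simp: sums_iff)
  then show ?thesis using s by (simp add: sums_iff divide_inverse mult.commute)
qed

text \<open>The normalization \<open>1 + bf n u u a / 4\<close> is chosen so that
  \<open>2 * \<bar>Y a\<bar>\<close> stays below \<open>2 + bf n u u a / 2\<close>, whose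
  exponential moment is under control. The bound 18 is 9 * 2, with exp 2 at most 9.\<close>

lemma subexponential_integrable:
  fixes Y :: "(nat \<Rightarrow> complex) \<Rightarrow> real"
  assumes [measurable]: "Y \<in> borel_measurable (complex_gaussian n)"
    and u: "vnorm n u \<le> 1" and Y: "\<And>a. \<bar>Y a\<bar> \<le> 1 + bf n u u a / 4"
  shows "integrable (complex_gaussian n) Y" "integrable (complex_gaussian n) (\<lambda>a. exp (2 * \<bar>Y a\<bar>))"
    "mean n (\<lambda>a. exp (2 * \<bar>Y a\<bar>)) \<le> 18"
proof -
  have e: "exp (2::real) \<le> 9"
  proof -
    have "exp (2::real) = (exp 1)\<^sup>2" using exp_add[of 1 "1::real"] by (simp add: power2_eq_square)
    also have "\<dots> \<le> 3\<^sup>2" by (intro power_mono exp_le) simp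
    finally show ?thesis by simp
  qed
  note i = bf_exp_moment[OF u]
  have b: "exp (2 * \<bar>Y a\<bar>) \<le> 9 * exp (bf n u u a / 2)" for a
  proof -
    have "exp (2 * \<bar>Y a\<bar>) \<le> exp (2 + bf n u u a / 2)" using Y[of a] by simp
    also have "\<dots> = exp 2 * exp (bf n u u a / 2)" by (rule exp_add)
    also have "\<dots> \<le> 9 * exp (bf n u u a / 2)" using e by (intro mult_right_mono) auto
    finally show ?thesis .
  qed
  have b1: "\<bar>Y a\<bar> \<le> 9 * exp (bf n u u a / 2)" for a
    using b[of a] exp_ge_add_one_self[of "2 * \<bar>Y a\<bar>"] by linarith
  have ii: "integrable (complex_gaussian n) (\<lambda>a. 9 * exp (bf n u u a / 2))" using i by simp
  show "integrable (complex_gaussian n) Y"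
    by (rule Bochner_Integration.integrable_bound[OF ii]) (use b1 in auto)
  show *: "integrable (complex_gaussian n) (\<lambda>a. exp (2 * \<bar>Y a\<bar>))"
    by (rule Bochner_Integration.integrable_bound[OF ii]) (use b in auto)
  have "mean n (\<lambda>a. exp (2 * \<bar>Y a\<bar>)) \<le> mean n (\<lambda>a. 9 * exp (bf n u u a / 2))"
    by (intro integral_mono * ii b)
  then show "mean n (\<lambda>a. exp (2 * \<bar>Y a\<bar>)) \<le> 18" using i(2) by simp
qed

text \<open>A Chernoff bound. Second-order expansion of the exponential bounds the moment generating
  function of \<open>Y\<close> at \<open>l \<le> 1\<close> by
  \<open>exp (l * mean n Y + 18 * l\<^sup>2)\<close>, so independence leaves the exponent
  \<open>m * (18 * l\<^sup>2 - l * \<epsilon>)\<close>.\<close>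

lemma block_Bernstein:
  fixes Y :: "(nat \<Rightarrow> complex) \<Rightarrow> real"
  assumes [measurable]: "Y \<in> borel_measurable (complex_gaussian n)"
    and u: "vnorm n u \<le> 1" and Y: "\<And>a. \<bar>Y a\<bar> \<le> 1 + bf n u u a / 4"
    and \<epsilon>: "0 < \<epsilon>" "\<epsilon> \<le> 1" and m: "0 < m"
  shows "measure (block n m) {a \<in> space (block n m). avg m (\<lambda>j. Y (a j)) \<ge> mean n Y + \<epsilon>} \<le> exp (- (\<epsilon>\<^sup>2 * m / 72))"
proof -
  interpret G: prob_space "complex_gaussian n" by (rule prob_space_complex_gaussian)
  interpret B: prob_space "block n m" by (rule prob_space_block)
  interpret S: product_sigma_finite "\<lambda>_::nat. complex_gaussian n" ..
  note i = subexponential_integrable[OF assms(1) u Y]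
  \<comment> \<open>The minimizer of \<open>18 * l\<^sup>2 - l * \<epsilon>\<close>, with minimal
    value \<open>- (\<epsilon>\<^sup>2 / 72)\<close>.\<close>
  define l where "l = \<epsilon> / 36"
  have l: "0 < l" "l \<le> 1" using \<epsilon> by (auto simp: l_def)
  define g where "g a = exp (l * (Y a - mean n Y - \<epsilon>))" for a
  have [measurable]: "g \<in> borel_measurable (complex_gaussian n)" unfolding g_def[abs_def] by measurable
  have pt: "exp (l * Y a) \<le> 1 + l * Y a + l\<^sup>2 * exp (2 * \<bar>Y a\<bar>)" for a
  proof -
    have "\<bar>Y a\<bar> ^ 2 / fact 2 \<le> exp \<bar>Y a\<bar>" by (rule power_le_exp) simp
    then have "(Y a)\<^sup>2 / 2 * exp \<bar>Y a\<bar> \<le> exp \<bar>Y a\<bar> * exp \<bar>Y a\<bar>" by (intro mult_right_mono) auto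
    also have "\<dots> = exp (2 * \<bar>Y a\<bar>)" by (simp add: exp_add[symmetric])
    finally have 1: "(Y a)\<^sup>2 / 2 * exp \<bar>Y a\<bar> \<le> exp (2 * \<bar>Y a\<bar>)" .
    have "\<bar>l * Y a\<bar> \<le> \<bar>Y a\<bar>" using l by (simp add: abs_mult mult_left_le_one_le)
    then have "(l * Y a)\<^sup>2 / 2 * exp \<bar>l * Y a\<bar> \<le> (l * Y a)\<^sup>2 / 2 * exp \<bar>Y a\<bar>"
      by (intro mult_left_mono) auto
    also have "\<dots> = l\<^sup>2 * ((Y a)\<^sup>2 / 2 * exp \<bar>Y a\<bar>)" by (simp add: power_mult_distrib)
    also have "\<dots> \<le> l\<^sup>2 * exp (2 * \<bar>Y a\<bar>)" using 1 by (intro mult_left_mono) auto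
    finally show ?thesis using exp_le_quadratic[of "l * Y a"] by linarith
  qed
  have ib: "integrable (complex_gaussian n) (\<lambda>a. 1 + l * Y a + l\<^sup>2 * exp (2 * \<bar>Y a\<bar>))" using i by auto
  have ie: "integrable (complex_gaussian n) (\<lambda>a. exp (l * Y a))"
    by (rule Bochner_Integration.integrable_bound[OF ib]) (auto intro: order.trans[OF pt abs_ge_self])
  have "mean n (\<lambda>a. exp (l * Y a)) \<le> mean n (\<lambda>a. 1 + l * Y a + l\<^sup>2 * exp (2 * \<bar>Y a\<bar>))"
    by (intro integral_mono ie ib pt)
  also have "\<dots> = 1 + l * mean n Y + l\<^sup>2 * mean n (\<lambda>a. exp (2 * \<bar>Y a\<bar>))"
    using i by (simp add: G.prob_space)
  also have "\<dots> \<le> 1 + (l * mean n Y + l\<^sup>2 * 18)"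
    using i(3) by (simp add: mult_left_mono)
  also have "\<dots> \<le> exp (l * mean n Y + l\<^sup>2 * 18)" by (rule exp_ge_add_one_self)
  finally have mgf: "mean n (\<lambda>a. exp (l * Y a)) \<le> exp (l * mean n Y + l\<^sup>2 * 18)" .
  have ge: "g a = exp (l * Y a) * exp (- (l * (mean n Y + \<epsilon>)))" for a
    unfolding g_def exp_add[symmetric] by (simp add: algebra_simps)
  have ig: "integrable (complex_gaussian n) g" unfolding ge using ie by auto
  have "mean n g = mean n (\<lambda>a. exp (l * Y a)) * exp (- (l * (mean n Y + \<epsilon>)))"
    unfolding ge by simp
  also have "\<dots> \<le> exp (l * mean n Y + l\<^sup>2 * 18) * exp (- (l * (mean n Y + \<epsilon>)))"
    using mgf by (intro mult_right_mono) auto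
  also have "\<dots> = exp (- (\<epsilon>\<^sup>2 / 72))"
    unfolding exp_add[symmetric] by (simp add: l_def power2_eq_square field_simps)
  finally have mg: "mean n g \<le> exp (- (\<epsilon>\<^sup>2 / 72))" .
  have sub: "{a \<in> space (block n m). avg m (\<lambda>j. Y (a j)) \<ge> mean n Y + \<epsilon>} \<subseteq>
      {a \<in> space (block n m). 1 \<le> 1 * (\<Prod>j<m. ennreal (g (a j)))}"
  proof (clarsimp)
    fix a assume a: "mean n Y + \<epsilon> \<le> avg m (\<lambda>j. Y (a j))"
    have "(\<Prod>j<m. g (a j)) = exp (\<Sum>j<m. l * (Y (a j) - mean n Y - \<epsilon>))"
      by (simp add: g_def exp_sum)
    also have "(\<Sum>j<m. l * (Y (a j) - mean n Y - \<epsilon>)) = l * (m * (avg m (\<lambda>j. Y (a j)) - mean n Y - \<epsilon>))"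
      using m by (simp add: avg_def sum_distrib_left[symmetric] sum_subtractf field_simps)
    finally have "1 \<le> (\<Prod>j<m. g (a j))" using a l by simp
    then show "1 \<le> (\<Prod>j<m. ennreal (g (a j)))"
      by (subst prod_ennreal) (auto simp: g_def)
  qed
  have pm [measurable]: "(\<lambda>a. \<Prod>j<m. ennreal (g (a j))) \<in> borel_measurable (block n m)"
    by (auto intro!: borel_measurable_prod_ennreal measurable_compose[OF _ measurable_ennreal] block_measurable)
  have "emeasure (block n m) {a \<in> space (block n m). avg m (\<lambda>j. Y (a j)) \<ge> mean n Y + \<epsilon>} \<le>
     emeasure (block n m) {a \<in> space (block n m). 1 \<le> 1 * (\<Prod>j<m. ennreal (g (a j)))}"
    by (rule emeasure_mono[OF sub]) measurable
  also have "\<dots> \<le> 1 * (\<integral>\<^sup>+a. (\<Prod>j<m. ennreal (g (a j))) * indicator (space (block n m)) a \<partial>block n m)"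
    using nn_integral_Markov_inequality[of "\<lambda>a. \<Prod>j<m. ennreal (g (a j))" "space (block n m)" "block n m" 1]
    by simp
  also have "\<dots> = (\<integral>\<^sup>+a. (\<Prod>j<m. ennreal (g (a j))) \<partial>block n m)"
    by (auto intro!: nn_integral_cong)
  also have "\<dots> = (\<Prod>j<m. \<integral>\<^sup>+a. ennreal (g a) \<partial>complex_gaussian n)"
    unfolding block_def by (rule S.product_nn_integral_prod) (auto intro: measurable_compose)
  also have "\<dots> = (ennreal (mean n g)) ^ m"
    by (subst nn_integral_eq_integral[OF ig]) (auto simp: g_def)
  also have "\<dots> \<le> (ennreal (exp (- (\<epsilon>\<^sup>2 / 72)))) ^ m"
    by (intro power_mono ennreal_leI mg) auto
  also have "\<dots> = ennreal (exp (- (\<epsilon>\<^sup>2 * m / 72)))"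
    by (simp add: ennreal_power exp_of_nat_mult[symmetric] mult.commute)
  finally show ?thesis by (simp add: B.emeasure_eq_measure)
qed

lemma block_Bernstein_union:
  fixes Y :: "(nat \<Rightarrow> real) \<Rightarrow> (nat \<Rightarrow> complex) \<Rightarrow> real"
  assumes Ym: "\<And>u. u \<in> N \<Longrightarrow> Y u \<in> borel_measurable (complex_gaussian n)"
    and N: "finite N" and u: "\<And>u. u \<in> N \<Longrightarrow> vnorm n u \<le> 1"
    and Y: "\<And>u a. u \<in> N \<Longrightarrow> \<bar>Y u a\<bar> \<le> 1 + bf n u u a / 4"
    and \<epsilon>: "0 < \<epsilon>" "\<epsilon> \<le> 1" and m: "0 < m"
  shows "measure (block n m) {a \<in> space (block n m). \<exists>u\<in>N. avg m (\<lambda>j. Y u (a j)) \<ge> mean n (Y u) + \<epsilon>}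
    \<le> card N * exp (- (\<epsilon>\<^sup>2 * m / 72))"
proof -
  interpret B: prob_space "block n m" by (rule prob_space_block)
  let ?E = "\<lambda>u. {a \<in> space (block n m). avg m (\<lambda>j. Y u (a j)) \<ge> mean n (Y u) + \<epsilon>}"
  have "{a \<in> space (block n m). \<exists>u\<in>N. avg m (\<lambda>j. Y u (a j)) \<ge> mean n (Y u) + \<epsilon>} = (\<Union>u\<in>N. ?E u)" by auto
  moreover have "measure (block n m) (\<Union>u\<in>N. ?E u) \<le> (\<Sum>u\<in>N. measure (block n m) (?E u))"
  proof (intro B.finite_measure_subadditive_finite N image_subsetI)
    fix u assume "u \<in> N"
    then have [measurable]: "Y u \<in> borel_measurable (complex_gaussian n)" by (rule Ym)
    show "?E u \<in> sets (block n m)" by measurable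
  qed
  moreover have "\<dots> \<le> (\<Sum>u\<in>N. exp (- (\<epsilon>\<^sup>2 * m / 72)))"
    by (rule sum_mono, rule block_Bernstein[OF Ym u Y \<epsilon> m])
  ultimately show ?thesis by simp
qed

text \<open>Serves averages of variables with too heavy tails for \<open>block_Bernstein\<close>.
  The variance is at most \<open>6 * C\<close>, and since Y is at most 1 + Y squared the mean is at
  most \<open>6 * C + 1\<close>; reaching \<open>6 * C + 2\<close> thus means a deviation of at
  least 1. This is a source of the failure probability of order 1/m.\<close>

lemma block_Chebyshev:
  fixes Y :: "(nat \<Rightarrow> complex) \<Rightarrow> real"
  assumes [measurable]: "Y \<in> borel_measurable (complex_gaussian n)"
    and pqr: "vnorm n p \<le> 1" "vnorm n q \<le> 1" "vnorm n r \<le> 1"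
    and Y2: "\<And>a. (Y a)\<^sup>2 \<le> C * (exp (bf n p p a / 2) + exp (bf n q q a / 2) + exp (bf n r r a / 2))"
    and C: "0 \<le> C" and m: "0 < m"
  shows "measure (block n m) {a \<in> space (block n m). avg m (\<lambda>j. Y (a j)) \<ge> 6 * C + 2} \<le> 6 * C / m"
proof -
  interpret G: prob_space "complex_gaussian n" by (rule prob_space_complex_gaussian)
  interpret B: prob_space "block n m" by (rule prob_space_block)
  interpret S: product_sigma_finite "\<lambda>_::nat. complex_gaussian n" ..
  have iY2: "integrable (complex_gaussian n) (\<lambda>a. (Y a)\<^sup>2)" and bY2: "\<bar>mean n (\<lambda>a. (Y a)\<^sup>2)\<bar> \<le> 6 * C"
    using integrable_bf_dominated[of "\<lambda>a. (Y a)\<^sup>2", OF _ pqr _ C] Y2 by auto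
  have iY: "integrable (complex_gaussian n) Y"
    by (rule G.square_integrable_imp_integrable[OF _ iY2]) simp
  define \<mu> where "\<mu> = mean n Y"
  define Z where "Z a = Y a - \<mu>" for a
  have iZ: "integrable (complex_gaussian n) Z" using iY by (simp add: Z_def[abs_def])
  have mZ: "mean n Z = 0" using iY by (simp add: Z_def[abs_def] \<mu>_def G.prob_space)
  have Z2: "(Z a)\<^sup>2 = (Y a)\<^sup>2 - 2 * \<mu> * Y a + \<mu>\<^sup>2" for a by (simp add: Z_def power2_diff)
  have iZ2: "integrable (complex_gaussian n) (\<lambda>a. (Z a)\<^sup>2)" unfolding Z2 using iY iY2 by auto
  have "mean n (\<lambda>a. (Z a)\<^sup>2) = mean n (\<lambda>a. (Y a)\<^sup>2) - \<mu>\<^sup>2"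
    unfolding Z2 using iY iY2 by (simp add: \<mu>_def[symmetric] G.prob_space power2_eq_square)
  then have vZ: "mean n (\<lambda>a. (Z a)\<^sup>2) \<le> 6 * C" using bY2 by (smt (verit) zero_le_power2)
  have \<mu>: "\<mu> \<le> 6 * C + 1"
  proof -
    have "\<mu> \<le> mean n (\<lambda>a. 1 + (Y a)\<^sup>2)"
      unfolding \<mu>_def
    proof (rule integral_mono[OF iY])
      show "integrable (complex_gaussian n) (\<lambda>a. 1 + (Y a)\<^sup>2)" using iY2 by auto
      show "Y a \<le> 1 + (Y a)\<^sup>2" for a
      proof -
        have "0 \<le> (Y a)\<^sup>2" "2 * Y a \<le> (Y a)\<^sup>2 + 1"
          using zero_le_power2[of "Y a - 1"] by (simp_all add: power2_diff)
        then show ?thesis by linarith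
      qed
    qed
    then show ?thesis using iY2 bY2 by (simp add: G.prob_space)
  qed
  \<comment> \<open>Writes \<open>Z (a j) * Z (a k)\<close> as a product over all coordinates with
    trivial factors elsewhere, so that one product formula treats equal and distinct indices. For
    \<open>j \<noteq> k\<close> a factor \<open>mean n Z = 0\<close> occurs.\<close>
  define h where "h j k i a = (if i = j then Z a else 1) * (if i = k then Z a else 1)" for j k i :: nat and a
  have ih: "integrable (complex_gaussian n) (h j k i)" for j k i
    unfolding h_def[abs_def] using iZ iZ2 by (cases "i = j"; cases "i = k") (auto simp: power2_eq_square)
  have ph: "(\<Prod>i<m. h j k i (a i)) = Z (a j) * Z (a k)" if "j < m" "k < m" for j k a
    using that by (simp add: h_def prod.distrib prod.delta)
  have iP: "integrable (block n m) (\<lambda>a. Z (a j) * Z (a k))" if "j < m" "k < m" for j k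
    using S.product_integrable_prod[of "{..<m}" "h j k"] ih ph[OF that] by (simp add: block_def)
  have eP: "(\<integral>a. Z (a j) * Z (a k) \<partial>block n m) \<le> (if j = k then 6 * C else 0)" if jk: "j < m" "k < m" for j k
  proof -
    have "(\<integral>a. Z (a j) * Z (a k) \<partial>block n m) = (\<Prod>i<m. mean n (h j k i))"
      using S.product_integral_prod[of "{..<m}" "h j k"] ih ph[OF that] by (simp add: block_def)
    also have "\<dots> \<le> (if j = k then 6 * C else 0)"
    proof (cases "j = k")
      case True
      have "(\<Prod>i<m. mean n (h j k i)) = (\<Prod>i<m. if i = j then mean n (\<lambda>a. (Z a)\<^sup>2) else 1)"
        using True by (intro prod.cong) (auto simp: h_def power2_eq_square G.prob_space)
      then show ?thesis using True jk vZ by (simp add: prod.delta)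
    next
      case False
      have "mean n (h j k j) = 0" using False mZ by (simp add: h_def)
      then have "(\<Prod>i<m. mean n (h j k i)) = 0" using jk by (intro prod_zero finite_lessThan) auto
      then show ?thesis using False by (simp only: if_False order_refl)
    qed
    finally show ?thesis .
  qed
  let ?s = "\<lambda>a. (\<Sum>j<m. \<Sum>k<m. Z (a j) * Z (a k))"
  have sq: "?s a = (\<Sum>j<m. Z (a j))\<^sup>2" for a
    by (simp add: power2_eq_square sum_product)
  have iS: "integrable (block n m) ?s" using iP by (intro Bochner_Integration.integrable_sum) auto
  have "(\<integral>a. ?s a \<partial>block n m) = (\<Sum>j<m. \<Sum>k<m. \<integral>a. Z (a j) * Z (a k) \<partial>block n m)"
    using iP by (subst Bochner_Integration.integral_sum; (intro Bochner_Integration.integrable_sum sum.cong refl Bochner_Integration.integral_sum)?) auto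
  also have "\<dots> \<le> (\<Sum>j<m. \<Sum>k<m. if j = k then 6 * C else 0)"
    by (intro sum_mono eP) auto
  also have "\<dots> = m * (6 * C)" by simp
  finally have E: "(\<integral>a. ?s a \<partial>block n m) \<le> m * (6 * C)" .
  have "measure (block n m) {a \<in> space (block n m). avg m (\<lambda>j. Y (a j)) \<ge> 6 * C + 2} \<le>
      measure (block n m) {a \<in> space (block n m). (real m)\<^sup>2 \<le> ?s a}"
  proof (rule B.finite_measure_mono)
    show "{a \<in> space (block n m). (real m)\<^sup>2 \<le> ?s a} \<in> sets (block n m)"
      using borel_measurable_integrable[OF iS] by measurable
    show "{a \<in> space (block n m). avg m (\<lambda>j. Y (a j)) \<ge> 6 * C + 2} \<subseteq> {a \<in> space (block n m). (real m)\<^sup>2 \<le> ?s a}"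
    proof safe
      fix a assume a: "6 * C + 2 \<le> avg m (\<lambda>j. Y (a j))"
      have "(\<Sum>j<m. Z (a j)) = m * (avg m (\<lambda>j. Y (a j)) - \<mu>)"
        using m by (simp add: Z_def avg_def sum_subtractf field_simps)
      moreover have "real m * 1 \<le> m * (avg m (\<lambda>j. Y (a j)) - \<mu>)"
        using a \<mu> by (intro mult_left_mono) auto
      ultimately show "(real m)\<^sup>2 \<le> ?s a" unfolding sq by (intro power_mono) auto
    qed
  qed
  also have "\<dots> \<le> (\<integral>a. ?s a \<partial>block n m) / (real m)\<^sup>2"
    using m by (intro integral_Markov_inequality_measure[where A="{}"] iS AE_I2) (auto simp: sq)
  also have "\<dots> \<le> m * (6 * C) / (real m)\<^sup>2" using E by (intro divide_right_mono) auto
  also have "\<dots> = 6 * C / m" using m by (simp add: power2_eq_square)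
  finally show ?thesis .
qed

subsection \<open>Uniform bounds over sparse vectors\<close>

text \<open>Up to a constant, the logarithm of the bound on the net. The summand \<open>k\<close>
  accounts for the lattice points on one support and keeps the quantity at least 1 when
  \<open>k = n\<close>, where the logarithm vanishes.\<close>

definition sparse_size :: "nat \<Rightarrow> nat \<Rightarrow> real" where
  "sparse_size n k = k * ln (n / k) + k"

lemma exp_minus_le_inverse: "0 < t \<Longrightarrow> exp (- t) \<le> 1 / (t::real)"
proof -
  assume t: "0 < t"
  have "t \<le> exp t" using exp_ge_add_one_self[of t] by linarith
  then show ?thesis using t unfolding exp_minus inverse_eq_divide by (intro divide_left_mono) auto
qed

lemma sparse_size_ge: "1 \<le> k \<Longrightarrow> k \<le> n \<Longrightarrow> 1 \<le> sparse_size n k"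
proof -
  assume "1 \<le> k" "k \<le> n"
  then have "0 \<le> real k * ln (n / k)" by (intro mult_nonneg_nonneg ln_ge_zero) auto
  then show ?thesis using \<open>1 \<le> k\<close> unfolding sparse_size_def by linarith
qed

text \<open>The condition on \<open>m\<close> makes the log-cardinality of the net at most half of
  the Bernstein exponent \<open>\<epsilon>\<^sup>2 * m / 72\<close>. The other half yields an
  exponentially small bound, weakened to order 1/m to match the Chebyshev estimates.\<close>

lemma net_concentration:
  fixes Y :: "(nat \<Rightarrow> real) \<Rightarrow> (nat \<Rightarrow> complex) \<Rightarrow> real"
  assumes k: "1 \<le> k" "k \<le> n"
    and Ym: "\<And>u. Y u \<in> borel_measurable (complex_gaussian n)"
    and Y: "\<And>u a. \<bar>Y u a\<bar> \<le> 1 + bf n u u a / 4"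
    and \<epsilon>: "0 < \<epsilon>" "\<epsilon> \<le> 1"
    and m: "144 * (real D + 2) / \<epsilon>\<^sup>2 * sparse_size n k \<le> m"
  shows "measure (block n m) {a \<in> space (block n m). \<exists>u\<in>net n k D. avg m (\<lambda>j. Y u (a j)) \<ge> mean n (Y u) + \<epsilon>}
    \<le> 144 / (\<epsilon>\<^sup>2 * m)"
proof -
  have s1: "1 \<le> sparse_size n k" by (rule sparse_size_ge[OF k])
  have "0 < 144 * (real D + 2) / \<epsilon>\<^sup>2 * sparse_size n k" using \<epsilon> s1 by auto
  then have m0: "0 < m" using m by linarith
  have l0: "0 \<le> real k * ln (n / k)" using k by (intro mult_nonneg_nonneg ln_ge_zero) auto
  have "k * ln (n / k) + (real D + 2) * k \<le> (real D + 2) * sparse_size n k"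
  proof -
    have "1 * (k * ln (n / k)) \<le> (real D + 2) * (k * ln (n / k))" by (rule mult_right_mono[OF _ l0]) simp
    then show ?thesis by (simp add: sparse_size_def distrib_left)
  qed
  also have "\<dots> \<le> \<epsilon>\<^sup>2 * m / 144" using m \<epsilon> by (simp add: field_simps)
  finally have le: "k * ln (n / k) + (real D + 2) * k \<le> \<epsilon>\<^sup>2 * m / 144" .
  have "measure (block n m) {a \<in> space (block n m). \<exists>u\<in>net n k D. avg m (\<lambda>j. Y u (a j)) \<ge> mean n (Y u) + \<epsilon>}
      \<le> card (net n k D) * exp (- (\<epsilon>\<^sup>2 * m / 72))"
    by (rule block_Bernstein_union[OF Ym finite_net _ Y \<epsilon> m0]) (auto dest: net_vnorm)
  also have "\<dots> \<le> exp (\<epsilon>\<^sup>2 * m / 144) * exp (- (\<epsilon>\<^sup>2 * m / 72))"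
    using card_net[OF k, of D] le by (intro mult_right_mono) (auto intro: order.trans)
  also have "\<dots> = exp (- (\<epsilon>\<^sup>2 * m / 144))" by (simp add: exp_add[symmetric])
  also have "\<dots> \<le> 1 / (\<epsilon>\<^sup>2 * m / 144)" using \<epsilon> m0 by (intro exp_minus_le_inverse) auto
  finally show ?thesis by simp
qed

text \<open>The upper half of a restricted isometry property, on a finite net only: this makes the
  event measurable and accessible to the union bound. Extension to all sparse vectors is
  deterministic.\<close>

definition rip_net :: "nat \<Rightarrow> nat \<Rightarrow> nat \<Rightarrow> (nat \<Rightarrow> nat \<Rightarrow> complex) \<Rightarrow> bool" where
  "rip_net n k m a \<longleftrightarrow> (\<forall>u\<in>net n k 2. avg m (\<lambda>j. bf n u u (a j)) < 5)"

text \<open>The variables \<open>bf n u u a / 4\<close> have the normalization of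
  \<open>net_concentration\<close> with deviation 1. Scaled back, this is the mean, at most 1, plus
  4, hence the 5 in \<open>rip_net\<close>; and 576 = 144 * (2 + 2).\<close>

lemma rip_net_prob:
  assumes k: "1 \<le> k" "k \<le> n" and m: "576 * sparse_size n k \<le> m"
  shows "measure (block n m) {a \<in> space (block n m). \<not> rip_net n k m a} \<le> 144 / m"
proof -
  interpret B: prob_space "block n m" by (rule prob_space_block)
  have "measure (block n m) {a \<in> space (block n m). \<not> rip_net n k m a} \<le>
    measure (block n m) {a \<in> space (block n m). \<exists>u\<in>net n k 2. avg m (\<lambda>j. bf n u u (a j) / 4) \<ge> mean n (\<lambda>a. bf n u u a / 4) + 1}"
  proof (rule B.finite_measure_mono)
    show "{a \<in> space (block n m). \<exists>u\<in>net n k 2. avg m (\<lambda>j. bf n u u (a j) / 4) \<ge> mean n (\<lambda>a. bf n u u a / 4) + 1} \<in> sets (block n m)"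
      using finite_net[of n k 2] by measurable
    show "{a \<in> space (block n m). \<not> rip_net n k m a} \<subseteq> {a \<in> space (block n m). \<exists>u\<in>net n k 2. avg m (\<lambda>j. bf n u u (a j) / 4) \<ge> mean n (\<lambda>a. bf n u u a / 4) + 1}"
    proof safe
      fix a assume "\<not> rip_net n k m a"
      then obtain u where u: "u \<in> net n k 2" "5 \<le> avg m (\<lambda>j. bf n u u (a j))" by (auto simp: rip_net_def not_less)
      have "(vnorm n u)\<^sup>2 \<le> 1" using net_vnorm(2)[OF u(1)] by (simp add: power_le_one)
      moreover have "avg m (\<lambda>j. bf n u u (a j) / 4) = avg m (\<lambda>j. bf n u u (a j)) / 4"
        using avg_linear(3)[of m "1/4"] by simp
      ultimately have "avg m (\<lambda>j. bf n u u (a j) / 4) \<ge> mean n (\<lambda>a. bf n u u a / 4) + 1"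
        using u(2) by (simp add: bf_moments)
      then show "\<exists>u\<in>net n k 2. avg m (\<lambda>j. bf n u u (a j) / 4) \<ge> mean n (\<lambda>a. bf n u u a / 4) + 1"
        using u(1) by blast
    qed
  qed
  also have "\<dots> \<le> 144 / (1\<^sup>2 * real m)"
    by (rule net_concentration[OF k]) (use m in auto)
  finally show ?thesis by simp
qed

lemma sparse_ball_scale:
  assumes "u \<in> Rn n" "card (supp u) \<le> k" "\<bar>c\<bar> * vnorm n u \<le> 1"
  shows "(\<lambda>i. c * u i) \<in> sparse_ball n k"
proof -
  have "supp (\<lambda>i. c * u i) \<subseteq> supp u" by (auto simp: supp_def)
  then have "card (supp (\<lambda>i. c * u i)) \<le> card (supp u)" by (intro card_mono finite_supp_Rn[OF assms(1)])
  then show ?thesis using assms by (auto simp: sparse_ball_def Rn_def vnorm_scale)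
qed

lemma nrm_in_sparse_ball:
  assumes "u \<in> Rn n" "card (supp u) \<le> k" shows "nrm n u \<in> sparse_ball n k"
proof -
  have "nrm n u = (\<lambda>i. (1 / vnorm n u) * u i)" by (auto simp: nrm_def)
  then show ?thesis using sparse_ball_scale[OF assms, of "1 / vnorm n u"] by simp
qed

lemma sparse_ball_diff:
  assumes "u \<in> sparse_ball n k" "u0 \<in> Rn n" "supp u0 \<subseteq> supp u"
  shows "(\<lambda>i. u i - u0 i) \<in> Rn n" "card (supp (\<lambda>i. u i - u0 i)) \<le> k"
proof -
  show "(\<lambda>i. u i - u0 i) \<in> Rn n" using assms by (auto simp: sparse_ball_def Rn_def)
  have "supp (\<lambda>i. u i - u0 i) \<subseteq> supp u" using assms(3) by (auto simp: supp_def)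
  then have "card (supp (\<lambda>i. u i - u0 i)) \<le> card (supp u)"
    using assms(1) by (intro card_mono finite_supp_Rn[of u n]) (auto simp: sparse_ball_def)
  then show "card (supp (\<lambda>i. u i - u0 i)) \<le> k" using assms(1) by (auto simp: sparse_ball_def)
qed

text \<open>The supremum of \<open>sqrt (avg m (bf u u))\<close> over sparse unit vectors is at most its maximum over
  the net plus half of itself.\<close>

lemma rip_net_imp:
  assumes rip: "rip_net n k m a" and k: "1 \<le> k" and u: "u \<in> Rn n" "card (supp u) \<le> k"
  shows "avg m (\<lambda>j. bf n u u (a j)) \<le> 20 * (vnorm n u)\<^sup>2"
proof -
  define f where "f u = sqrt (avg m (\<lambda>j. bf n u u (a j)))" for u
  have f2: "(f u)\<^sup>2 = avg m (\<lambda>j. bf n u u (a j))" for u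
    by (simp add: f_def avg_nonneg)
  have f0: "0 \<le> f u" for u by (simp add: f_def avg_nonneg)
  have f_scale: "f (\<lambda>i. c * u i) = \<bar>c\<bar> * f u" for c u
  proof -
    have "avg m (\<lambda>j. bf n (\<lambda>i. c * u i) (\<lambda>i. c * u i) (a j)) = c\<^sup>2 * avg m (\<lambda>j. bf n u u (a j))"
      by (simp add: bf_linear avg_linear(3)[symmetric] power2_eq_square mult.assoc)
    then show ?thesis by (simp add: f_def real_sqrt_mult)
  qed
  \<comment> \<open>\<open>f\<close> is a seminorm: Cauchy--Schwarz is applied to \<open>bf\<close>
    for each sample and then to the average over samples.\<close>
  have f_tri: "f u \<le> f v + f (\<lambda>i. u i - v i)" for u v
  proof -
    let ?w = "\<lambda>i. u i - v i"
    have e: "bf n u u (a j) = bf n v v (a j) + 2 * bf n v ?w (a j) + bf n ?w ?w (a j)" for j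
      by (simp add: bf_linear bf_commute[of n u v])
    have cs: "\<bar>bf n v ?w (a j)\<bar> \<le> sqrt (bf n v v (a j)) * sqrt (bf n ?w ?w (a j))" for j
      using real_sqrt_le_mono[OF bf_Cauchy_Schwarz[of n v ?w "a j"]]
      by (simp only: real_sqrt_abs real_sqrt_mult)
    have "avg m (\<lambda>j. bf n v ?w (a j)) \<le> avg m (\<lambda>j. sqrt (bf n v v (a j)) * sqrt (bf n ?w ?w (a j)))"
      by (rule avg_mono, rule order.trans[OF abs_ge_self cs])
    also have "\<dots> \<le> sqrt (avg m (\<lambda>j. (sqrt (bf n v v (a j)))\<^sup>2)) * sqrt (avg m (\<lambda>j. (sqrt (bf n ?w ?w (a j)))\<^sup>2))"
      by (rule order.trans[OF abs_ge_self avg_Cauchy_Schwarz])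
    also have "\<dots> = f v * f ?w" by (simp add: f_def)
    finally have "(f u)\<^sup>2 \<le> (f v + f ?w)\<^sup>2"
      unfolding power2_sum f2 by (subst e) (simp add: avg_linear)
    then show ?thesis by (rule power2_le_imp_le) (intro add_nonneg_nonneg f0)
  qed
  let ?T = "sparse_ball n k"
  \<comment> \<open>A crude bound depending on the data is enough, but it has to come first:
    \<sigma> \<le> sqrt 5 + \<sigma>/2 can be solved for \<sigma> only once the supremum is known to
    be finite.\<close>
  have "\<exists>B. \<forall>u\<in>?T. f u \<le> B"
  proof -
    define b where "b j = (\<Sum>i<n. \<bar>Re (a j i)\<bar>)\<^sup>2 + (\<Sum>i<n. \<bar>Im (a j i)\<bar>)\<^sup>2" for j
    have "f u \<le> sqrt (avg m b)" if u: "u \<in> ?T" for u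
    proof -
      have ui: "\<bar>u i\<bar> \<le> 1" if "i < n" for i
        using abs_le_vnorm[OF that, of u] u by (auto simp: sparse_ball_def)
      have "\<bar>ar n u (a j)\<bar> \<le> (\<Sum>i<n. \<bar>Re (a j i)\<bar>)" "\<bar>ai n u (a j)\<bar> \<le> (\<Sum>i<n. \<bar>Im (a j i)\<bar>)" for j
        unfolding ar_def ai_def using ui
        by (auto intro!: order.trans[OF sum_abs] sum_mono simp: abs_mult mult_left_le)
      then have "\<bar>ar n u (a j)\<bar>\<^sup>2 \<le> (\<Sum>i<n. \<bar>Re (a j i)\<bar>)\<^sup>2" "\<bar>ai n u (a j)\<bar>\<^sup>2 \<le> (\<Sum>i<n. \<bar>Im (a j i)\<bar>)\<^sup>2" for j
        by (intro power_mono; simp)+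
      then have "bf n u u (a j) \<le> b j" for j
        unfolding bf_def b_def by (intro add_mono) (simp_all add: power2_eq_square)
      then show ?thesis unfolding f_def by (intro real_sqrt_le_mono avg_mono)
    qed
    then show ?thesis by blast
  qed
  then have bdd: "bdd_above (f ` ?T)" by (auto simp: bdd_above_def)
  have z: "(\<lambda>_. 0) \<in> ?T" by (simp add: sparse_ball_def Rn_def supp_def vnorm_def L2_set_def)
  define \<sigma> where "\<sigma> = (SUP u\<in>?T. f u)"
  have le\<sigma>: "f u \<le> \<sigma>" if "u \<in> ?T" for u unfolding \<sigma>_def by (rule cSUP_upper[OF that bdd])
  have "\<sigma> \<le> sqrt 5 + \<sigma> / 2"
    unfolding \<sigma>_def
  proof (rule cSUP_least)
    show "?T \<noteq> {}" using z by auto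
    fix u assume u: "u \<in> ?T"
    obtain u0 where u0: "u0 \<in> net n k 2" "u0 \<in> Rn n" "supp u0 \<subseteq> supp u" "vnorm n (\<lambda>i. u i - u0 i) \<le> 1 / 2"
      using net_approx[OF k _ u, of 2] by auto
    have "(\<lambda>i. 2 * (u i - u0 i)) \<in> ?T"
      using u0(4) sparse_ball_diff[OF u u0(2,3)] by (intro sparse_ball_scale) auto
    then have "f (\<lambda>i. 2 * (u i - u0 i)) \<le> \<sigma>" by (rule le\<sigma>)
    then have "f (\<lambda>i. u i - u0 i) \<le> \<sigma> / 2" unfolding f_scale by simp
    moreover have "f u0 \<le> sqrt 5" using rip u0(1) by (auto simp: rip_net_def f_def intro: less_imp_le)
    ultimately show "f u \<le> sqrt 5 + (SUP u\<in>?T. f u) / 2" using f_tri[of u u0] by (simp add: \<sigma>_def)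
  qed
  then have \<sigma>: "\<sigma> \<le> 2 * sqrt 5" by simp
  have "f u = vnorm n u * f (nrm n u)"
  proof -
    have "f u = f (\<lambda>i. vnorm n u * nrm n u i)"
      unfolding f_def using nrm_scale[of _ n u] by (intro arg_cong[where f=sqrt] arg_cong[where f="avg m"] ext bf_cong) auto
    then show ?thesis by (simp add: f_scale)
  qed
  also have "\<dots> \<le> vnorm n u * (2 * sqrt 5)"
    using le\<sigma>[OF nrm_in_sparse_ball[OF u]] \<sigma> by (intro mult_left_mono) auto
  finally have "(f u)\<^sup>2 \<le> (vnorm n u * (2 * sqrt 5))\<^sup>2" by (rule power_mono[OF _ f0])
  then show ?thesis by (simp add: f2 power_mult_distrib)
qed

lemma power_le_exp_half: "0 \<le> x \<Longrightarrow> x ^ k \<le> fact k * 2 ^ k * exp (x / 2)" for x :: real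
  using power_le_exp[of "x / 2" k] by (simp add: power_divide field_simps)

text \<open>The product is at most the cube of the largest factor, which is one of the three. A
  product of dependent forms thus becomes a sum to which \<open>bf_exp_moment\<close> applies term
  by term.\<close>

lemma prod3_power_le:
  fixes x y z :: real
  assumes "0 \<le> x" "0 \<le> y" "0 \<le> z"
  shows "(x * y * z) ^ k \<le> x ^ (3 * k) + y ^ (3 * k) + z ^ (3 * k)"
proof -
  define M where "M = max x (max y z)"
  have M: "x \<le> M" "y \<le> M" "z \<le> M" "M \<in> {x, y, z}" by (auto simp: M_def max_def)
  have "x * y * z \<le> M * M * M" using M assms by (intro mult_mono) auto
  then have "(x * y * z) ^ k \<le> (M ^ 3) ^ k"
    using assms by (intro power_mono) (auto simp: power3_eq_cube)
  also have "\<dots> = M ^ (3 * k)" by (simp add: power_mult)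
  also have "\<dots> \<le> x ^ (3 * k) + y ^ (3 * k) + z ^ (3 * k)" using M(4) assms by auto
  finally show ?thesis .
qed

section \<open>Rules for \<open>with_prob_ge\<close> and elementary inequalities\<close>

lemma with_prob_geI:
  assumes "prob_space M" "{\<omega> \<in> space M. \<not> P \<omega>} \<in> sets M" "measure M {\<omega> \<in> space M. \<not> P \<omega>} \<le> p"
  shows "with_prob_ge M (1 - p) P"
proof -
  interpret prob_space M by fact
  have "space M - {\<omega> \<in> space M. \<not> P \<omega>} \<in> sets M" using assms(2) by auto
  moreover have "prob (space M - {\<omega> \<in> space M. \<not> P \<omega>}) = 1 - prob {\<omega> \<in> space M. \<not> P \<omega>}"
    by (rule prob_compl[OF assms(2)])
  ultimately show ?thesis unfolding with_prob_ge_def using assms(3)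
    by (intro bexI[of _ "space M - {\<omega> \<in> space M. \<not> P \<omega>}"]) auto
qed

lemma with_prob_ge_conj:
  assumes "prob_space M" "with_prob_ge M (1 - p) P" "with_prob_ge M (1 - q) Q"
  shows "with_prob_ge M (1 - (p + q)) (\<lambda>\<omega>. P \<omega> \<and> Q \<omega>)"
proof -
  interpret prob_space M by fact
  obtain A B where AB: "A \<in> sets M" "1 - p \<le> measure M A" "\<forall>\<omega>\<in>A. P \<omega>" "B \<in> sets M" "1 - q \<le> measure M B" "\<forall>\<omega>\<in>B. Q \<omega>"
    using assms by (auto simp: with_prob_ge_def)
  have "measure M A + measure M B = measure M (A \<union> B) + measure M (A \<inter> B)"
    using finite_measure_Union'[OF AB(1,4)] finite_measure_Diff'[OF AB(4,1)] by (simp add: Int_commute)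
  moreover have "measure M (A \<union> B) \<le> 1" by (rule prob_le_1)
  ultimately have "1 - (p + q) \<le> measure M (A \<inter> B)" using AB(2,5) by linarith
  then show ?thesis unfolding with_prob_ge_def using AB
    by (intro bexI[of _ "A \<inter> B"]) auto
qed

lemma with_prob_ge_mono:
  assumes "with_prob_ge M p P" "q \<le> p" "\<And>\<omega>. P \<omega> \<Longrightarrow> Q \<omega>"
  shows "with_prob_ge M q Q"
  using assms unfolding with_prob_ge_def by (meson order.trans)

lemma avg_const_le: "0 \<le> c \<Longrightarrow> avg m (\<lambda>_. c) \<le> c"
  by (cases "m = 0") (simp_all add: avg_def)

lemma abs_alternating_sum_le:
  fixes a b c d e :: real
  assumes "\<bar>a\<bar> \<le> A" "\<bar>b\<bar> \<le> B" "\<bar>c\<bar> \<le> C" "\<bar>d\<bar> \<le> D" "\<bar>e\<bar> \<le> E"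
  shows "\<bar>a + b - c + d - e\<bar> \<le> A + B + C + D + E"
  using assms by linarith

text \<open>The weighted arithmetic-geometric mean inequality. It trades a product of square roots,
  which cannot be averaged directly, for a sum, with a weight \<open>l\<close> free to vary from
  sample to sample.\<close>

lemma abs_le_weighted:
  fixes x :: real
  assumes "x\<^sup>2 \<le> y" "0 < l" shows "\<bar>x\<bar> \<le> (l + y / l) / 2"
proof -
  have "0 \<le> \<bar>x\<bar>\<^sup>2 + l\<^sup>2 - 2 * \<bar>x\<bar> * l"
    unfolding power2_diff[symmetric] by simp
  then have "2 * \<bar>x\<bar> * l \<le> l * l + y" using assms(1) by (simp add: power2_eq_square)
  then show ?thesis using assms(2) by (simp add: field_simps)
qed

text \<open>The product of four Gaussian forms is too heavy-tailed for a union bound over the net.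
  It is truncated according to the two factors that do not depend on \<open>u\<close>; the remainder is
  controlled by a single scalar average together with the restricted isometry bound.\<close>

lemma bilinear_concentration_ball:
  assumes \<eta>: "0 < \<eta>"
  shows "\<exists>C>0. \<forall>n k m p q r. 1 \<le> k \<longrightarrow> k \<le> n \<longrightarrow> C * sparse_size n k \<le> real m \<longrightarrow>
    vnorm n p \<le> 1 \<longrightarrow> vnorm n q \<le> 1 \<longrightarrow> vnorm n r \<le> 1 \<longrightarrow>
    with_prob_ge (block n m) (1 - C / m) (\<lambda>a. \<forall>u\<in>sparse_ball n k.
      \<bar>avg m (\<lambda>j. bf n p u (a j) * bf n q r (a j)) - mean n (\<lambda>a. bf n p u a * bf n q r a)\<bar> \<le> \<eta>)"
proof -
  \<comment> \<open>Satisfies \<open>y ^ 12 \<le> CW * exp (y / 2)\<close> for nonnegative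
    \<open>y\<close>. Degree 12 arises because Chebyshev's inequality for the square of
    \<open>c\<close>, a quantity bounded by a product of three forms, involves
    \<open>c ^ 4\<close>.\<close>
  define CW :: real where "CW = fact 12 * 2 ^ 12"
  have CW: "0 < CW" by (simp add: CW_def)
  \<comment> \<open>The error budget: \<eta>/4 for concentration on the net, \<eta>/4 for passing
    from the net to \<open>u\<close>, and \<eta>/2 for the truncated remainder. The remainder is at
    most (6CW + 22)/(2\<tau>) on the sample and (6CW + 7)/(2\<tau>) in the mean, together
    K/(2\<tau>).\<close>
  define K where "K = 12 * CW + 29"
  have K: "0 < K" using CW by (simp add: K_def)
  define \<tau> where "\<tau> = K / \<eta> + 1"
  have \<tau>: "1 \<le> \<tau>" "K / \<tau> \<le> \<eta>" using K \<eta> by (auto simp: \<tau>_def field_simps)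
  obtain D :: nat where D: "48 * \<tau> / \<eta> \<le> D" using real_arch_simple by blast
  have "0 < 48 * \<tau> / \<eta>" using \<tau> \<eta> by auto
  then have D0: "0 < real D" using D by linarith
  then have D1: "1 \<le> D" by simp
  have D2: "12 * \<tau> / D \<le> \<eta> / 4" using D D0 \<eta> by (simp add: field_simps)
  define \<epsilon> where "\<epsilon> = min 1 (\<eta> / (4 * \<tau>))"
  have \<epsilon>: "0 < \<epsilon>" "\<epsilon> \<le> 1" using \<eta> \<tau> by (auto simp: \<epsilon>_def)
  have \<epsilon>2: "\<tau> * \<epsilon> \<le> \<eta> / 4"
  proof -
    have "\<tau> * \<epsilon> \<le> \<tau> * (\<eta> / (4 * \<tau>))" using \<tau> by (intro mult_left_mono) (auto simp: \<epsilon>_def)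
    then show ?thesis using \<tau> by simp
  qed
  define C where "C = 144 * (real D + 2) / \<epsilon>\<^sup>2 + 576 + (144 + 288 / \<epsilon>\<^sup>2 + 6 * CW)"
  have C: "0 < C" "144 * (real D + 2) / \<epsilon>\<^sup>2 \<le> C" "576 \<le> C" "144 + 288 / \<epsilon>\<^sup>2 + 6 * CW \<le> C"
    using CW \<epsilon> D0 by (auto simp: C_def intro!: add_pos_nonneg add_nonneg_nonneg)
  show ?thesis
  proof (intro exI[of _ C] conjI allI impI C(1))
    fix n k m :: nat and p q r :: "nat \<Rightarrow> real"
    assume k: "1 \<le> k" "k \<le> n" and m: "C * sparse_size n k \<le> real m"
      and p: "vnorm n p \<le> 1" and q: "vnorm n q \<le> 1" and r: "vnorm n r \<le> 1"
    have s1: "1 \<le> sparse_size n k" by (rule sparse_size_ge[OF k])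
    have m': "c * sparse_size n k \<le> real m" if "c \<le> C" for c
      using that m s1 by (meson mult_right_mono order.trans zero_le_one)
    have "0 < C * sparse_size n k" using C s1 by auto
    then have m0: "0 < m" using m by linarith
    interpret B: prob_space "block n m" by (rule prob_space_block)
    \<comment> \<open>By Cauchy--Schwarz the square of \<open>X u a\<close> is at most
      \<open>c a * bf n u u a\<close>. On the event that \<open>c\<close> is at most \<tau> squared,
      the product is therefore at most \<tau> times the square root of
      \<open>bf n u u a\<close>.\<close>
    define c where "c a = (bf n q r a)\<^sup>2 * bf n p p a" for a
    have c0: "0 \<le> c a" for a by (simp add: c_def)
    have [measurable]: "c \<in> borel_measurable (complex_gaussian n)" unfolding c_def[abs_def] by measurable
    define X where "X u a = bf n p u a * bf n q r a" for u a
    have [measurable]: "X u \<in> borel_measurable (complex_gaussian n)" for u unfolding X_def[abs_def] by measurable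
    define T where "T u a = (if c a \<le> \<tau>\<^sup>2 then X u a else 0)" for u a
    have Tm [measurable]: "T u \<in> borel_measurable (complex_gaussian n)" for u unfolding T_def[abs_def] by measurable
    have X2: "(X u a)\<^sup>2 \<le> c a * bf n u u a" for u a
      using mult_right_mono[OF bf_Cauchy_Schwarz[of n p u a], of "(bf n q r a)\<^sup>2"]
      by (simp add: X_def c_def power_mult_distrib mult_ac)
    have T2: "(T u a)\<^sup>2 \<le> \<tau>\<^sup>2 * bf n u u a" for u a
      using X2[of u a] mult_right_mono[of "c a" "\<tau>\<^sup>2" "bf n u u a"] by (auto simp: T_def)
    \<comment> \<open>The weight \<open>l\<close> is chosen later: 2 yields the hypothesis of the
      Bernstein bound, 1 yields integrability, and 1/D matches the size of the difference between
      \<open>u\<close> and its net point.\<close>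
    have Tl: "\<bar>T u a\<bar> \<le> \<tau> * ((l + bf n u u a / l) / 2)" if "0 < l" for u a l
    proof -
      have "\<bar>T u a / \<tau>\<bar> \<le> (l + bf n u u a / l) / 2"
        using T2[of u a] \<tau> that by (intro abs_le_weighted) (auto simp: power_divide field_simps)
      then show ?thesis using \<tau> by (simp add: abs_divide field_simps)
    qed
    have Tq: "\<bar>T u a / \<tau>\<bar> \<le> 1 + bf n u u a / 4" for u a
    proof -
      have "\<bar>T u a\<bar> \<le> \<tau> * ((2 + bf n u u a / 2) / 2)" by (rule Tl) simp
      then show ?thesis using \<tau> by (simp add: abs_divide field_simps)
    qed
    \<comment> \<open>Where \<open>c\<close> exceeds \<tau> squared, the weight is c squared over
      \<tau>. The remainder is then governed by the average of c squared, a single scalar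
      independent of \<open>u\<close>, and by \<open>bf n u u\<close>, which the restricted isometry
      bound controls.\<close>
    have R: "\<bar>X u a - T u a\<bar> \<le> ((c a)\<^sup>2 + bf n u u a) / (2 * \<tau>)" for u a
    proof (cases "c a \<le> \<tau>\<^sup>2")
      case True
      then show ?thesis using \<tau> by (simp add: T_def)
    next
      case False
      then have pos: "\<tau>\<^sup>2 \<le> c a" "0 < c a" using \<tau> by (auto intro: le_less_trans[of 0 "\<tau>\<^sup>2"])
      have "\<bar>X u a\<bar> \<le> ((c a)\<^sup>2 / \<tau> + (c a * bf n u u a) / ((c a)\<^sup>2 / \<tau>)) / 2"
        using \<tau> pos by (intro abs_le_weighted X2) auto
      also have "(c a * bf n u u a) / ((c a)\<^sup>2 / \<tau>) = \<tau> * bf n u u a / c a"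
        using pos by (simp add: power2_eq_square)
      also have "\<dots> \<le> \<tau> * bf n u u a / \<tau>\<^sup>2"
        using pos \<tau> by (intro divide_left_mono) auto
      also have "\<dots> = bf n u u a / \<tau>" using \<tau> by (simp add: power2_eq_square)
      finally have "\<bar>X u a\<bar> \<le> ((c a)\<^sup>2 / \<tau> + bf n u u a / \<tau>) / 2" by simp
      then show ?thesis using False by (simp add: T_def add_divide_distrib mult.commute)
    qed
    have c4: "((c a)\<^sup>2)\<^sup>2 \<le> CW * (exp (bf n p p a / 2) + exp (bf n q q a / 2) + exp (bf n r r a / 2))" for a
    proof -
      have "c a \<le> bf n q q a * bf n r r a * bf n p p a"
        unfolding c_def by (intro mult_right_mono bf_Cauchy_Schwarz) simp
      then have "(c a) ^ 4 \<le> (bf n q q a * bf n r r a * bf n p p a) ^ 4" using c0 by (intro power_mono) auto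
      also have "\<dots> \<le> bf n q q a ^ (3 * 4) + bf n r r a ^ (3 * 4) + bf n p p a ^ (3 * 4)"
        by (intro prod3_power_le) auto
      also have "\<dots> \<le> CW * exp (bf n q q a / 2) + CW * exp (bf n r r a / 2) + CW * exp (bf n p p a / 2)"
        unfolding CW_def using power_le_exp_half[of _ 12] by (intro add_mono) auto
      finally show ?thesis by (simp add: algebra_simps power_mult[symmetric])
    qed
    have c2: "\<bar>(c a)\<^sup>2\<bar> \<le> (CW + 1) * (exp (bf n p p a / 2) + exp (bf n q q a / 2) + exp (bf n r r a / 2))" for a
    proof -
      have "(c a)\<^sup>2 \<le> 1 + ((c a)\<^sup>2)\<^sup>2"
      proof -
        have "0 \<le> ((c a)\<^sup>2)\<^sup>2" "2 * (c a)\<^sup>2 \<le> ((c a)\<^sup>2)\<^sup>2 + 1" "0 \<le> (c a)\<^sup>2"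
          using zero_le_power2[of "(c a)\<^sup>2 - 1"] by (simp_all add: power2_diff)
        then show ?thesis by linarith
      qed
      moreover have "1 \<le> exp (bf n p p a / 2) + exp (bf n q q a / 2) + exp (bf n r r a / 2)"
        using one_le_exp_iff[of "bf n p p a / 2"] bf_nonneg[of n p a] exp_gt_zero[of "bf n q q a / 2"] exp_gt_zero[of "bf n r r a / 2"]
        by linarith
      ultimately show ?thesis using c4[of a] by (simp add: distrib_right)
    qed
    have ic2: "integrable (complex_gaussian n) (\<lambda>a. (c a)\<^sup>2)" and Ec2: "mean n (\<lambda>a. (c a)\<^sup>2) \<le> 6 * (CW + 1)"
      using integrable_bf_dominated[of "\<lambda>a. (c a)\<^sup>2", OF _ p q r c2] CW by auto
    define E1 where "E1 a \<longleftrightarrow> (\<exists>u\<in>net n k D. avg m (\<lambda>j. T u (a j) / \<tau>) \<ge> mean n (\<lambda>a. T u a / \<tau>) + \<epsilon>)" for a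
    define E2 where "E2 a \<longleftrightarrow> (\<exists>u\<in>net n k D. avg m (\<lambda>j. - T u (a j) / \<tau>) \<ge> mean n (\<lambda>a. - T u a / \<tau>) + \<epsilon>)" for a
    define E3 where "E3 a \<longleftrightarrow> avg m (\<lambda>j. (c (a j))\<^sup>2) \<ge> 6 * CW + 2" for a
    have [measurable]: "{a \<in> space (block n m). E1 a} \<in> sets (block n m)" "{a \<in> space (block n m). E2 a} \<in> sets (block n m)"
      "{a \<in> space (block n m). E3 a} \<in> sets (block n m)" "{a \<in> space (block n m). \<not> rip_net n k m a} \<in> sets (block n m)"
      unfolding E1_def E2_def E3_def rip_net_def using finite_net[of n k] by measurable
    have 1: "measure (block n m) {a \<in> space (block n m). E1 a} \<le> 144 / (\<epsilon>\<^sup>2 * m)"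
      unfolding E1_def by (rule net_concentration[OF k _ Tq \<epsilon> m'[OF C(2)]]) measurable
    have 2: "measure (block n m) {a \<in> space (block n m). E2 a} \<le> 144 / (\<epsilon>\<^sup>2 * m)"
      unfolding E2_def by (rule net_concentration[OF k _ _ \<epsilon> m'[OF C(2)]], measurable) (use Tq in simp)
    have 3: "measure (block n m) {a \<in> space (block n m). E3 a} \<le> 6 * CW / m"
      unfolding E3_def using CW by (intro block_Chebyshev[OF _ p q r c4 _ m0]) auto
    have 4: "measure (block n m) {a \<in> space (block n m). \<not> rip_net n k m a} \<le> 144 / m"
      by (rule rip_net_prob[OF k m'[OF C(3)]])
    note W = with_prob_geI[OF prob_space_block]
    note V = with_prob_ge_conj[OF prob_space_block]
    have wp: "with_prob_ge (block n m) (1 - (((144 / (\<epsilon>\<^sup>2 * m) + 144 / (\<epsilon>\<^sup>2 * m)) + 6 * CW / m) + 144 / m))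
        (\<lambda>a. ((\<not> E1 a \<and> \<not> E2 a) \<and> \<not> E3 a) \<and> rip_net n k m a)"
      by (intro V W) (simp_all add: 1 2 3 4)
    have pb: "1 - C / m \<le> 1 - (((144 / (\<epsilon>\<^sup>2 * m) + 144 / (\<epsilon>\<^sup>2 * m)) + 6 * CW / m) + 144 / m)"
    proof -
      have "((144 / (\<epsilon>\<^sup>2 * m) + 144 / (\<epsilon>\<^sup>2 * m)) + 6 * CW / m) + 144 / m = (144 + 288 / \<epsilon>\<^sup>2 + 6 * CW) / m"
        using m0 \<epsilon> by (simp add: field_simps)
      then show ?thesis using C(4) m0 by (simp add: divide_right_mono)
    qed
    show "with_prob_ge (block n m) (1 - C / m) (\<lambda>a. \<forall>u\<in>sparse_ball n k.
      \<bar>avg m (\<lambda>j. bf n p u (a j) * bf n q r (a j)) - mean n (\<lambda>a. bf n p u a * bf n q r a)\<bar> \<le> \<eta>)"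
    proof (rule with_prob_ge_mono[OF wp pb], intro ballI)
      fix a u assume G: "((\<not> E1 a \<and> \<not> E2 a) \<and> \<not> E3 a) \<and> rip_net n k m a"
        and u: "u \<in> sparse_ball n k"
      have rip: "rip_net n k m a" using G by simp
      have uR: "u \<in> Rn n" "card (supp u) \<le> k" "vnorm n u \<le> 1" using u by (auto simp: sparse_ball_def)
      obtain u0 where u0: "u0 \<in> net n k D" "u0 \<in> Rn n" "supp u0 \<subseteq> supp u" "vnorm n u0 \<le> 1"
        "vnorm n (\<lambda>i. u i - u0 i) \<le> 1 / D"
        using net_approx[OF k(1) D1 u] by blast
      let ?v = "\<lambda>i. u i - u0 i"
      have ripu: "avg m (\<lambda>j. bf n u u (a j)) \<le> 20"
        using rip_net_imp[OF rip k(1) uR(1,2)] uR(3) by (smt (verit) power_le_one vnorm_nonneg)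
      have v2: "(vnorm n ?v)\<^sup>2 \<le> (1 / D)\<^sup>2" by (intro power_mono u0) simp
      have ripv: "avg m (\<lambda>j. bf n ?v ?v (a j)) \<le> 20 * (1 / D)\<^sup>2"
        using rip_net_imp[OF rip k(1) sparse_ball_diff[OF u u0(2,3)]] v2 by linarith
      have iT: "integrable (complex_gaussian n) (T u)" for u
      proof (rule Bochner_Integration.integrable_bound)
        show "integrable (complex_gaussian n) (\<lambda>a. \<tau> * ((1 + bf n u u a / 1) / 2))"
          using bf_moments(1)[of n u] prob_space.prob_space[OF prob_space_complex_gaussian] 
          by (auto intro!: integrable_mult_right Bochner_Integration.integrable_add prob_space.finite_measure prob_space_complex_gaussian finite_measure.integrable_const)
        show "AE x in complex_gaussian n. norm (T u x) \<le> norm (\<tau> * ((1 + bf n u u x / 1) / 2))"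
          using Tl[of 1 u] by (auto intro: order.trans[OF _ abs_ge_self])
      qed measurable
      have iX: "integrable (complex_gaussian n) (X u)"
      proof (rule Bochner_Integration.integrable_bound)
        show "integrable (complex_gaussian n) (\<lambda>a. \<bar>T u a\<bar> + ((c a)\<^sup>2 + bf n u u a) / (2 * \<tau>))"
          using iT ic2 bf_moments(1)[of n u] by auto
        show "AE x in complex_gaussian n. norm (X u x) \<le> norm (\<bar>T u x\<bar> + ((c x)\<^sup>2 + bf n u u x) / (2 * \<tau>))"
        proof (rule AE_I2)
          fix x show "norm (X u x) \<le> norm (\<bar>T u x\<bar> + ((c x)\<^sup>2 + bf n u u x) / (2 * \<tau>))"
            using R[of u x] by simp
        qed
      qed measurable
      \<comment> \<open>The truncation event does not involve \<open>u\<close>, so truncation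
        preserves linearity in \<open>u\<close>.\<close>
      have Tlin: "T u a = T u0 a + T ?v a" for a by (simp add: T_def X_def bf_linear algebra_simps)
      have lin1: "avg m (\<lambda>j. T u (a j)) = avg m (\<lambda>j. T u0 (a j)) + avg m (\<lambda>j. T ?v (a j))"
        unfolding Tlin by (rule avg_linear)
      have lin2: "mean n (T u) = mean n (T u0) + mean n (T ?v)"
        unfolding Bochner_Integration.integral_add[OF iT iT, symmetric] by (intro Bochner_Integration.integral_cong refl Tlin)
      have net: "\<bar>avg m (\<lambda>j. T u0 (a j)) - mean n (T u0)\<bar> \<le> \<tau> * \<epsilon>"
      proof -
        have e1: "avg m (\<lambda>j. T u0 (a j) / \<tau>) = avg m (\<lambda>j. T u0 (a j)) / \<tau>"
          "avg m (\<lambda>j. - T u0 (a j) / \<tau>) = - avg m (\<lambda>j. T u0 (a j)) / \<tau>"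
          using avg_linear(3)[of m "1/\<tau>"] avg_linear(3)[of m "-1/\<tau>"] by simp_all
        have e2: "mean n (\<lambda>a. T u0 a / \<tau>) = mean n (T u0) / \<tau>" "mean n (\<lambda>a. - T u0 a / \<tau>) = - mean n (T u0) / \<tau>"
          by simp_all
        have "avg m (\<lambda>j. T u0 (a j) / \<tau>) < mean n (\<lambda>a. T u0 a / \<tau>) + \<epsilon>"
          "avg m (\<lambda>j. - T u0 (a j) / \<tau>) < mean n (\<lambda>a. - T u0 a / \<tau>) + \<epsilon>"
          using G u0(1) unfolding E1_def E2_def not_le[symmetric] by blast+
        then have "avg m (\<lambda>j. T u0 (a j)) / \<tau> < mean n (T u0) / \<tau> + \<epsilon>" "- avg m (\<lambda>j. T u0 (a j)) / \<tau> < - mean n (T u0) / \<tau> + \<epsilon>"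
          unfolding e1 e2 by auto
        then show ?thesis using \<tau> by (simp add: field_simps abs_le_iff)
      qed
      have va: "\<bar>avg m (\<lambda>j. T ?v (a j))\<bar> \<le> \<tau> * (21 / D / 2)"
      proof -
        let ?g = "\<lambda>j. \<tau> * ((1 / D + bf n ?v ?v (a j) / (1 / D)) / 2)"
        have l: "0 < 1 / real D" using D0 by simp
        have "avg m ?g = avg m (\<lambda>j. \<tau> / (2 * D)) + (\<tau> * D / 2) * avg m (\<lambda>j. bf n ?v ?v (a j))"
          unfolding avg_linear(1,3)[symmetric] by (simp add: field_simps)
        also have "\<dots> \<le> \<tau> / (2 * D) + (\<tau> * D / 2) * (20 * (1 / D)\<^sup>2)"
          using \<tau> by (intro add_mono avg_const_le mult_left_mono ripv) auto
        also have "\<dots> = \<tau> * (21 / D / 2)" using D0 by (simp add: power2_eq_square field_simps)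
        finally have "avg m ?g \<le> \<tau> * (21 / D / 2)" .
        moreover have "avg m (\<lambda>j. T ?v (a j)) \<le> avg m ?g"
          by (rule avg_mono, rule order.trans[OF abs_ge_self Tl[OF l]])
        moreover have "avg m (\<lambda>j. - T ?v (a j)) \<le> avg m ?g"
          by (rule avg_mono, rule order.trans[OF _ Tl[OF l]]) simp
        ultimately show ?thesis unfolding avg_linear by linarith
      qed
      have vm: "\<bar>mean n (T ?v)\<bar> \<le> \<tau> * (1 / D)"
      proof -
        let ?g = "\<lambda>a. \<tau> * ((1 / D + bf n ?v ?v a / (1 / D)) / 2)"
        have l: "0 < 1 / real D" using D0 by simp
        have ig: "integrable (complex_gaussian n) ?g"
          using bf_moments(1)[of n ?v]
          by (auto intro!: integrable_mult_right Bochner_Integration.integrable_add prob_space.finite_measure prob_space_complex_gaussian finite_measure.integrable_const)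
        have "\<bar>mean n (T ?v)\<bar> \<le> mean n (\<lambda>a. \<bar>T ?v a\<bar>)"
          using integral_norm_bound[of "complex_gaussian n" "T ?v"] by simp
        also have "\<dots> \<le> mean n ?g" by (intro integral_mono integrable_abs iT ig Tl l)
        also have "\<dots> = \<tau> * ((1 / D + (vnorm n ?v)\<^sup>2 * D) / 2)"
          using bf_moments(1)[of n ?v] by (simp add: bf_moments(3) prob_space.prob_space[OF prob_space_complex_gaussian]
            prob_space.finite_measure prob_space_complex_gaussian finite_measure.integrable_const)
        also have "\<dots> \<le> \<tau> * ((1 / D + (1 / D)\<^sup>2 * D) / 2)"
          using \<tau> v2 by (intro mult_left_mono divide_right_mono add_left_mono mult_right_mono) auto
        also have "\<dots> = \<tau> * (1 / D)" using D0 by (simp add: power2_eq_square field_simps)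
        finally show ?thesis .
      qed
      have ra: "\<bar>avg m (\<lambda>j. X u (a j) - T u (a j))\<bar> \<le> (6 * CW + 22) / (2 * \<tau>)"
      proof -
        let ?g = "\<lambda>j. ((c (a j))\<^sup>2 + bf n u u (a j)) / (2 * \<tau>)"
        have "avg m ?g = (avg m (\<lambda>j. (c (a j))\<^sup>2) + avg m (\<lambda>j. bf n u u (a j))) * (1 / (2 * \<tau>))"
          unfolding mult.commute[of _ "1 / (2 * \<tau>)"] avg_linear(1,3)[symmetric] by simp
        also have "\<dots> \<le> ((6 * CW + 2) + 20) * (1 / (2 * \<tau>))"
          using G ripu \<tau> by (intro mult_right_mono add_mono) (auto simp: E3_def)
        finally have "avg m ?g \<le> (6 * CW + 22) / (2 * \<tau>)" by (simp add: add.commute)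
        moreover have "avg m (\<lambda>j. X u (a j) - T u (a j)) \<le> avg m ?g"
          by (rule avg_mono, rule order.trans[OF abs_ge_self R])
        moreover have "avg m (\<lambda>j. - (X u (a j) - T u (a j))) \<le> avg m ?g"
          by (rule avg_mono, rule order.trans[OF abs_ge_minus_self R])
        ultimately show ?thesis unfolding avg_linear(4) by linarith
      qed
      have rm: "\<bar>mean n (\<lambda>a. X u a - T u a)\<bar> \<le> (6 * CW + 7) / (2 * \<tau>)"
      proof -
        let ?g = "\<lambda>a. ((c a)\<^sup>2 + bf n u u a) / (2 * \<tau>)"
        have ig: "integrable (complex_gaussian n) ?g" using ic2 bf_moments(1)[of n u] by auto
        have "\<bar>mean n (\<lambda>a. X u a - T u a)\<bar> \<le> mean n (\<lambda>a. \<bar>X u a - T u a\<bar>)"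
          using integral_norm_bound[of "complex_gaussian n" "\<lambda>a. X u a - T u a"] by simp
        also have "\<dots> \<le> mean n ?g"
          by (intro integral_mono integrable_abs Bochner_Integration.integrable_diff iX iT ig R)
        also have "\<dots> = (mean n (\<lambda>a. (c a)\<^sup>2) + (vnorm n u)\<^sup>2) / (2 * \<tau>)"
          using ic2 bf_moments(1)[of n u] by (simp add: bf_moments(3))
        also have "\<dots> \<le> (6 * (CW + 1) + 1) / (2 * \<tau>)"
          using Ec2 uR(3) \<tau> by (intro divide_right_mono add_mono power_le_one) auto
        finally show ?thesis by (simp add: add.commute)
      qed
      have "avg m (\<lambda>j. X u (a j)) - mean n (X u) =
        (avg m (\<lambda>j. T u0 (a j)) - mean n (T u0)) + avg m (\<lambda>j. T ?v (a j)) - mean n (T ?v)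
        + avg m (\<lambda>j. X u (a j) - T u (a j)) - mean n (\<lambda>a. X u a - T u a)"
        using lin1 lin2 iX iT by (simp add: avg_linear)
      then have "\<bar>avg m (\<lambda>j. X u (a j)) - mean n (X u)\<bar> \<le>
         \<tau> * \<epsilon> + \<tau> * (21 / D / 2) + \<tau> * (1 / D) + (6 * CW + 22) / (2 * \<tau>) + (6 * CW + 7) / (2 * \<tau>)"
        using abs_alternating_sum_le[OF net va vm ra rm] by simp
      also have "\<dots> \<le> \<tau> * \<epsilon> + 12 * \<tau> / D + (12 * CW + 29) / (2 * \<tau>)"
        using \<tau> D0 by (simp add: field_simps)
      also have "(12 * CW + 29) / (2 * \<tau>) = (K / \<tau>) / 2"
        by (simp add: K_def)
      also have "\<tau> * \<epsilon> + 12 * \<tau> / D + (K / \<tau>) / 2 \<le> \<eta> / 4 + \<eta> / 4 + \<eta> / 2"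
        using D2 \<epsilon>2 \<tau>(2) by (intro add_mono divide_right_mono) auto
      also have "\<dots> = \<eta>" by simp
      finally have "\<bar>avg m (\<lambda>j. X u (a j)) - mean n (X u)\<bar> \<le> \<eta>" .
      then show "\<bar>avg m (\<lambda>j. bf n p u (a j) * bf n q r (a j)) - mean n (\<lambda>a. bf n p u a * bf n q r a)\<bar> \<le> \<eta>"
        unfolding X_def .
    qed
  qed
qed

subsection \<open>The hard-thresholding step\<close>

text \<open>After normalizing all four vectors, the product is at most half the sum of the two
  squares, and each square has mean at most 1/2 + 3/2 = 2.\<close>

lemma mean_bf_product_bound:
  "\<bar>mean n (\<lambda>a. bf n p u a * bf n q r a)\<bar> \<le> 2 * (vnorm n p * vnorm n u * vnorm n q * vnorm n r)"
  and integrable_bf_product: "integrable (complex_gaussian n) (\<lambda>a. bf n p u a * bf n q r a)"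
proof -
  have bound: "integrable (complex_gaussian n) (\<lambda>a. bf n p u a * bf n q r a) \<and>
      \<bar>mean n (\<lambda>a. bf n p u a * bf n q r a)\<bar> \<le> 2"
    if "vnorm n p \<le> 1" "vnorm n u \<le> 1" "vnorm n q \<le> 1" "vnorm n r \<le> 1" for p u q r
  proof -
    have sq: "mean n (\<lambda>a. (bf n p q a)\<^sup>2) \<le> 2" if "vnorm n p \<le> 1" "vnorm n q \<le> 1" for p q
    proof -
      have "(vnorm n p)\<^sup>2 * (vnorm n q)\<^sup>2 \<le> 1"
        using that by (intro mult_le_one power_le_one) auto
      moreover have "\<bar>ip n p q\<bar>\<^sup>2 \<le> (vnorm n p * vnorm n q)\<^sup>2"
        by (intro power_mono ip_Cauchy_Schwarz) auto
      ultimately show ?thesis by (simp add: bf_moments(4) power_mult_distrib)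
    qed
    let ?g = "\<lambda>a. ((bf n p u a)\<^sup>2 + (bf n q r a)\<^sup>2) / 2"
    have le: "\<bar>bf n p u a * bf n q r a\<bar> \<le> ?g a" for a
    proof -
      have "0 \<le> \<bar>bf n p u a\<bar>\<^sup>2 + \<bar>bf n q r a\<bar>\<^sup>2 - 2 * \<bar>bf n p u a\<bar> * \<bar>bf n q r a\<bar>"
        unfolding power2_diff[symmetric] by simp
      then show ?thesis by (simp add: abs_mult)
    qed
    have ig: "integrable (complex_gaussian n) ?g" using bf_moments(2) by auto
    have i: "integrable (complex_gaussian n) (\<lambda>a. bf n p u a * bf n q r a)"
      by (rule Bochner_Integration.integrable_bound[OF ig])
        (measurable, rule AE_I2, unfold real_norm_def, rule order.trans[OF le abs_ge_self])
    have "\<bar>mean n (\<lambda>a. bf n p u a * bf n q r a)\<bar> \<le> mean n (\<lambda>a. \<bar>bf n p u a * bf n q r a\<bar>)"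
      using integral_norm_bound[of "complex_gaussian n" "\<lambda>a. bf n p u a * bf n q r a"] by simp
    also have "\<dots> \<le> mean n ?g" by (intro integral_mono integrable_abs i ig le)
    also have "\<dots> \<le> 2" using sq[OF that(1,2)] sq[OF that(3,4)] bf_moments(2) by simp
    finally show ?thesis using i by simp
  qed
  have eq: "bf n p u a * bf n q r a = (vnorm n p * vnorm n u * vnorm n q * vnorm n r) *
      (bf n (nrm n p) (nrm n u) a * bf n (nrm n q) (nrm n r) a)" for a
    using bf_nrm2[of n p u a] bf_nrm2[of n q r a] by simp
  note b = bound[OF vnorm_nrm_le vnorm_nrm_le vnorm_nrm_le vnorm_nrm_le, of p u q r]
  show "integrable (complex_gaussian n) (\<lambda>a. bf n p u a * bf n q r a)"
    unfolding eq using b by simp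
  have "\<bar>mean n (\<lambda>a. bf n p u a * bf n q r a)\<bar> = (vnorm n p * vnorm n u * vnorm n q * vnorm n r) *
     \<bar>mean n (\<lambda>a. bf n (nrm n p) (nrm n u) a * bf n (nrm n q) (nrm n r) a)\<bar>"
    unfolding eq by (simp add: abs_mult)
  also have "\<dots> \<le> (vnorm n p * vnorm n u * vnorm n q * vnorm n r) * 2"
    using b by (intro mult_left_mono) auto
  finally show "\<bar>mean n (\<lambda>a. bf n p u a * bf n q r a)\<bar> \<le> 2 * (vnorm n p * vnorm n u * vnorm n q * vnorm n r)"
    by (simp add: mult.commute)
qed

lemma bilinear_concentration:
  assumes \<eta>: "0 < \<eta>"
  shows "\<exists>C>0. \<forall>n k m p q r. 1 \<le> k \<longrightarrow> k \<le> n \<longrightarrow> C * sparse_size n k \<le> real m \<longrightarrow>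
    with_prob_ge (block n m) (1 - C / m) (\<lambda>a. \<forall>u\<in>Rn n. card (supp u) \<le> k \<longrightarrow>
      \<bar>avg m (\<lambda>j. bf n p u (a j) * bf n q r (a j)) - mean n (\<lambda>a. bf n p u a * bf n q r a)\<bar>
        \<le> \<eta> * (vnorm n p * vnorm n u * vnorm n q * vnorm n r))"
proof -
  obtain C where C: "0 < C" and H: "\<And>n k m p q r. 1 \<le> k \<Longrightarrow> k \<le> n \<Longrightarrow> C * sparse_size n k \<le> real m \<Longrightarrow>
    vnorm n p \<le> 1 \<Longrightarrow> vnorm n q \<le> 1 \<Longrightarrow> vnorm n r \<le> 1 \<Longrightarrow>
    with_prob_ge (block n m) (1 - C / m) (\<lambda>a. \<forall>u\<in>sparse_ball n k.
      \<bar>avg m (\<lambda>j. bf n p u (a j) * bf n q r (a j)) - mean n (\<lambda>a. bf n p u a * bf n q r a)\<bar> \<le> \<eta>)"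
    using bilinear_concentration_ball[OF \<eta>] by blast
  show ?thesis
  proof (intro exI[of _ C] conjI allI impI C)
    fix n k m :: nat and p q r :: "nat \<Rightarrow> real"
    assume k: "1 \<le> k" "k \<le> n" and m: "C * sparse_size n k \<le> real m"
    show "with_prob_ge (block n m) (1 - C / m) (\<lambda>a. \<forall>u\<in>Rn n. card (supp u) \<le> k \<longrightarrow>
      \<bar>avg m (\<lambda>j. bf n p u (a j) * bf n q r (a j)) - mean n (\<lambda>a. bf n p u a * bf n q r a)\<bar>
        \<le> \<eta> * (vnorm n p * vnorm n u * vnorm n q * vnorm n r))"
    proof (rule with_prob_ge_mono[OF H[OF k m vnorm_nrm_le[of n p] vnorm_nrm_le[of n q] vnorm_nrm_le[of n r]] order_refl], intro ballI impI)
      fix a u assume G: "\<forall>u\<in>sparse_ball n k.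
          \<bar>avg m (\<lambda>j. bf n (nrm n p) u (a j) * bf n (nrm n q) (nrm n r) (a j)) -
            mean n (\<lambda>a. bf n (nrm n p) u a * bf n (nrm n q) (nrm n r) a)\<bar> \<le> \<eta>"
        and u: "u \<in> Rn n" "card (supp u) \<le> k"
      let ?s = "vnorm n p * vnorm n u * vnorm n q * vnorm n r"
      have eq: "bf n p u a * bf n q r a = ?s * (bf n (nrm n p) (nrm n u) a * bf n (nrm n q) (nrm n r) a)" for a
        using bf_nrm2[of n p u a] bf_nrm2[of n q r a] by simp
      have "\<bar>avg m (\<lambda>j. bf n p u (a j) * bf n q r (a j)) - mean n (\<lambda>a. bf n p u a * bf n q r a)\<bar> =
        \<bar>?s * (avg m (\<lambda>j. bf n (nrm n p) (nrm n u) (a j) * bf n (nrm n q) (nrm n r) (a j)) -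
            mean n (\<lambda>a. bf n (nrm n p) (nrm n u) a * bf n (nrm n q) (nrm n r) a))\<bar>"
        unfolding eq avg_linear(3) by (simp add: right_diff_distrib)
      also have "\<dots> = ?s * \<bar>avg m (\<lambda>j. bf n (nrm n p) (nrm n u) (a j) * bf n (nrm n q) (nrm n r) (a j)) -
            mean n (\<lambda>a. bf n (nrm n p) (nrm n u) a * bf n (nrm n q) (nrm n r) a)\<bar>"
        unfolding abs_mult[of ?s] by simp
      also have "\<dots> \<le> ?s * \<eta>"
        using G nrm_in_sparse_ball[OF u] by (intro mult_left_mono) auto
      finally show "\<bar>avg m (\<lambda>j. bf n p u (a j) * bf n q r (a j)) - mean n (\<lambda>a. bf n p u a * bf n q r a)\<bar> \<le> \<eta> * ?s"
        by (simp add: mult.commute)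
    qed
  qed
qed

section \<open>Loss and gradient as averages of \<open>bf\<close>\<close>

lemma cmod_cinner_power2: "(cmod (cinner n b z))\<^sup>2 = bf n z z b"
proof -
  have "Re (cinner n b z) = ar n z b" "Im (cinner n b z) = - ai n z b"
    by (simp_all add: cinner_def ar_def ai_def sum_negf[symmetric])
  then show ?thesis unfolding cmod_power2 bf_def by (simp add: power2_eq_square)
qed

lemma measurements_bf: "measurements n a x j = bf n x x (a j)"
  by (simp add: measurements_def cmod_cinner_power2)

definition basis :: "nat \<Rightarrow> nat \<Rightarrow> real" where "basis i = (\<lambda>k. if k = i then 1 else 0)"

lemma gradient_loss:
  assumes "i < n"
  shows "gradient n (loss n m a (measurements n a x)) z i =
    avg m (\<lambda>j. bf n z (basis i) (a j) * (bf n z z (a j) - bf n x x (a j)))"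
proof -
  have upd: "z(i := t) = (\<lambda>k. z k + (t - z i) * basis i k)" for t by (auto simp: basis_def)
  have e: "bf n (z(i := t)) (z(i := t)) b = bf n z z b + 2 * (t - z i) * bf n z (basis i) b + (t - z i)\<^sup>2 * bf n (basis i) (basis i) b" for t b
    unfolding upd by (simp add: bf_linear bf_commute[of n "basis i" z] power2_eq_square algebra_simps)
  have "((\<lambda>t. loss n m a (measurements n a x) (z(i := t))) has_field_derivative
     (1 / (4 * real m) * (\<Sum>j<m. 4 * (bf n z (basis i) (a j) * (bf n z z (a j) - bf n x x (a j)))))) (at (z i))"
    unfolding loss_def cmod_cinner_power2 measurements_bf e
    by (auto intro!: derivative_eq_intros simp: sum_distrib_left intro!: sum.cong)
  then have "deriv (\<lambda>t. loss n m a (measurements n a x) (z(i := t))) (z i) =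
      1 / (4 * real m) * (\<Sum>j<m. 4 * (bf n z (basis i) (a j) * (bf n z z (a j) - bf n x x (a j))))"
    by (rule DERIV_imp_deriv)
  then show ?thesis using assms by (simp add: gradient_def avg_def sum_distrib_left[symmetric])
qed

lemma bf_basis_sum: "(\<Sum>i<n. bf n z (basis i) b * u i) = bf n z u b"
proof -
  have "ar n (basis i) b = Re (b i)" "ai n (basis i) b = Im (b i)" if "i < n" for i
    using that by (simp_all add: ar_def ai_def basis_def if_distrib[where f="\<lambda>x. _ * x"] cong: if_cong)
  then have "(\<Sum>i<n. bf n z (basis i) b * u i) = (\<Sum>i<n. ar n z b * (Re (b i) * u i) + ai n z b * (Im (b i) * u i))"
    by (intro sum.cong) (auto simp: bf_def algebra_simps)
  then show ?thesis by (simp add: bf_def ar_def ai_def sum.distrib sum_distrib_left)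
qed

text \<open>Symmetry and bilinearity factor \<open>bf n z z - bf n x x\<close> as
  \<open>bf n (z - x) (z + x)\<close>. This puts the gradient tested against \<open>u\<close> into
  the shape of \<open>bilinear_concentration\<close>, where only \<open>u\<close> varies over a
  sparse class.\<close>

lemma ip_gradient_loss:
  "ip n (gradient n (loss n m a (measurements n a x)) z) u =
    avg m (\<lambda>j. bf n z u (a j) * bf n (\<lambda>i. z i - x i) (\<lambda>i. z i + x i) (a j))"
proof -
  have "ip n (gradient n (loss n m a (measurements n a x)) z) u =
    (\<Sum>i<n. avg m (\<lambda>j. bf n z (basis i) (a j) * (bf n z z (a j) - bf n x x (a j))) * u i)"
    unfolding ip_def by (intro sum.cong) (auto simp: gradient_loss)
  also have "\<dots> = avg m (\<lambda>j. (\<Sum>i<n. bf n z (basis i) (a j) * u i) * (bf n z z (a j) - bf n x x (a j)))"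
    unfolding avg_def sum_distrib_right sum_divide_distrib
    by (subst sum.swap) (simp add: mult_ac)
  also have "\<dots> = avg m (\<lambda>j. bf n z u (a j) * bf n (\<lambda>i. z i - x i) (\<lambda>i. z i + x i) (a j))"
    unfolding bf_basis_sum by (simp add: bf_linear bf_commute[of n x z])
  finally show ?thesis .
qed

text \<open>Breaking ties by index makes the comparison a strict total order, so the rank (the
  number of preceding indices) is an injection of \<open>{..<n}\<close> into itself, hence a
  bijection. Exactly \<open>s\<close> indices then have rank below \<open>s\<close>.\<close>

lemma top_entries_props:
  assumes "s \<le> n"
  shows "card (top_entries n s v) = s"
    and "\<lbrakk>i < n; i \<notin> top_entries n s v; j \<in> top_entries n s v\<rbrakk> \<Longrightarrow> \<bar>v i\<bar> \<le> \<bar>v j\<bar>"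
proof -
  define P where "P j i \<longleftrightarrow> \<bar>v i\<bar> < \<bar>v j\<bar> \<or> (\<bar>v j\<bar> = \<bar>v i\<bar> \<and> j < i)" for i j
  define rk where "rk i = card {j \<in> {..<n}. P j i}" for i
  have top: "top_entries n s v = {i \<in> {..<n}. rk i < s}" by (simp add: top_entries_def rk_def P_def)
  have Ptrans: "P i j \<Longrightarrow> P j k \<Longrightarrow> P i k" for i j k by (auto simp: P_def)
  have Pirr: "\<not> P i i" for i by (simp add: P_def)
  have Ptot: "i \<noteq> j \<Longrightarrow> P i j \<or> P j i" for i j by (auto simp: P_def)
  have mono: "rk i < rk j" if "P i j" "i < n" for i j
    unfolding rk_def
  proof (rule psubset_card_mono)
    have "i \<in> {k \<in> {..<n}. P k j}" "i \<notin> {k \<in> {..<n}. P k i}" using that Pirr by auto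
    moreover have "{k \<in> {..<n}. P k i} \<subseteq> {k \<in> {..<n}. P k j}" using Ptrans that by blast
    ultimately show "{k \<in> {..<n}. P k i} \<subset> {k \<in> {..<n}. P k j}" by blast
  qed simp
  have inj: "inj_on rk {..<n}"
  proof (rule inj_onI)
    fix i j assume "i \<in> {..<n}" "j \<in> {..<n}" "rk i = rk j"
    then show "i = j" using mono[of i j] mono[of j i] Ptot[of i j] by fastforce
  qed
  have "rk i < n" if "i < n" for i
  proof -
    have "rk i < card {..<n}" unfolding rk_def using that Pirr[of i] by (intro psubset_card_mono) auto
    then show ?thesis by simp
  qed
  then have "rk ` {..<n} \<subseteq> {..<n}" by auto
  then have im: "rk ` {..<n} = {..<n}" using inj by (intro endo_inj_surj) auto
  have "rk ` {i \<in> {..<n}. rk i < s} = {..<s}"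
  proof
    show "{..<s} \<subseteq> rk ` {i \<in> {..<n}. rk i < s}"
    proof
      fix y assume y: "y \<in> {..<s}"
      then have "y \<in> rk ` {..<n}" using im assms by auto
      then show "y \<in> rk ` {i \<in> {..<n}. rk i < s}" using y by auto
    qed
  qed auto
  moreover have "card (rk ` {i \<in> {..<n}. rk i < s}) = card {i \<in> {..<n}. rk i < s}"
    by (intro card_image inj_on_subset[OF inj]) auto
  ultimately show "card (top_entries n s v) = s" unfolding top by simp
  show "\<bar>v i\<bar> \<le> \<bar>v j\<bar>" if "i < n" "i \<notin> top_entries n s v" "j \<in> top_entries n s v"
  proof (rule ccontr)
    assume "\<not> \<bar>v i\<bar> \<le> \<bar>v j\<bar>"
    then have "P i j" by (auto simp: P_def)
    then show False using mono[of i j] that by (auto simp: top)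
  qed
qed

definition off :: "(nat \<Rightarrow> real) \<Rightarrow> nat set \<Rightarrow> nat \<Rightarrow> real" where
  "off x S = (\<lambda>i. if i \<in> S then 0 else x i)"

text \<open>If the thresholded vector is \<open>(1 + \<theta>) x + e\<close>, a multiple of \<open>x\<close> up to \<open>e\<close>, then the entries of
  \<open>x\<close> that are lost can be matched with spurious entries that were kept, so that only \<open>e\<close> counts.\<close>

lemma hard_threshold_error:
  assumes s: "s \<le> n" and x: "x \<in> Rn n" "norm0 x \<le> s" and \<theta>: "\<bar>\<theta>\<bar> \<le> 1/2"
    and v: "\<And>i. i < n \<Longrightarrow> v i = (1 + \<theta>) * x i + e i"
  defines "u \<equiv> hard_threshold n s v"
  defines "R \<equiv> supp x \<union> top_entries n s v"
  defines "eR \<equiv> \<lambda>i. if i \<in> R then e i else 0"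
  shows "u \<in> Rn n" "card (supp u) \<le> s" "card R \<le> 2 * s" "R \<subseteq> {..<n}"
    "vnorm n (off x (supp u)) \<le> 4 * vnorm n eR"
    "vnorm n (\<lambda>i. u i - x i) \<le> \<bar>\<theta>\<bar> * vnorm n x + vnorm n eR + vnorm n (off x (supp u))"
proof -
  let ?T = "top_entries n s v"
  note tp = top_entries_props(1)[OF s, of v] top_entries_props(2)[OF s, where v = v]
  have Tn: "?T \<subseteq> {..<n}" by (auto simp: top_entries_def)
  then have fT: "finite ?T" by (rule finite_subset) simp
  have xn: "supp x \<subseteq> {..<n}" by (rule supp_Rn[OF x(1)])
  have fx: "finite (supp x)" by (rule finite_supp_Rn[OF x(1)])
  show "u \<in> Rn n" using Tn by (auto simp: u_def hard_threshold_def Rn_def)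
  have su: "supp u = {i \<in> ?T. v i \<noteq> 0}" by (auto simp: u_def hard_threshold_def supp_def)
  have "card (supp u) \<le> card ?T" unfolding su by (intro card_mono fT) auto
  then show "card (supp u) \<le> s" by (simp add: tp)
  show "R \<subseteq> {..<n}" using xn Tn by (auto simp: R_def)
  have "card R \<le> card (supp x) + card ?T" unfolding R_def by (rule card_Un_le)
  then show "card R \<le> 2 * s" using x(2) by (simp add: tp norm0_def)
  define A where "A = supp x - ?T"
  define B where "B = ?T - supp x"
  have "card A = card (supp x) - card (supp x \<inter> ?T)"
    unfolding A_def using fx by (intro card_Diff_subset_Int) auto
  moreover have "card B = card ?T - card (supp x \<inter> ?T)"
    unfolding B_def Int_commute[of "supp x"] using fT by (intro card_Diff_subset_Int) auto
  ultimately have "card A \<le> card B" using x(2) tp(1) by (simp add: norm0_def diff_le_mono)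
  \<comment> \<open>The support of \<open>x\<close> has at most \<open>s\<close> elements while
    exactly \<open>s\<close> indices are selected, so there are at least as many spurious indices as
    lost ones.\<close>
  then obtain \<phi> where \<phi>: "\<phi> ` A \<subseteq> B" "inj_on \<phi> A"
    using card_le_inj[of A B] fx fT by (auto simp: A_def B_def)
  define e2 where "e2 i = (if i \<in> A then e (\<phi> i) else 0)" for i
  have half: "\<bar>x i\<bar> \<le> 2 * \<bar>(1 + \<theta>) * x i\<bar>" for i
  proof -
    have "1/2 \<le> \<bar>1 + \<theta>\<bar>" using \<theta> by linarith
    then have "1/2 * \<bar>x i\<bar> \<le> \<bar>1 + \<theta>\<bar> * \<bar>x i\<bar>" by (rule mult_right_mono) simp
    then show ?thesis by (simp add: abs_mult)
  qed
  have pt: "\<bar>off x (supp u) i\<bar> \<le> \<bar>2 * (\<bar>eR i\<bar> + \<bar>e2 i\<bar>)\<bar>" if i: "i < n" for i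
  proof (cases "x i = 0 \<or> i \<in> supp u")
    case True
    then show ?thesis by (auto simp: off_def)
  next
    case False
    then have xi: "i \<in> supp x" and iu: "i \<notin> supp u" by (auto simp: supp_def)
    then have iR: "i \<in> R" by (simp add: R_def)
    show ?thesis
    proof (cases "i \<in> ?T")
      case True
      \<comment> \<open>A selected index is missing from \<open>supp u\<close> only if its entry
        vanishes; then \<open>e i\<close> cancels \<open>(1 + \<theta>) * x i\<close>
        completely.\<close>
      then have "v i = 0" using iu su by auto
      then have "\<bar>(1 + \<theta>) * x i\<bar> = \<bar>e i\<bar>" using v[OF i] by linarith
      then show ?thesis using half[of i] iR iu by (simp add: off_def eR_def)
    next
      case False
      then have iA: "i \<in> A" using xi by (simp add: A_def)
      then have \<phi>i: "\<phi> i \<in> ?T" "\<phi> i \<notin> supp x" using \<phi> by (auto simp: B_def)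
      then have "v (\<phi> i) = e (\<phi> i)" using v[of "\<phi> i"] Tn by (auto simp: supp_def)
      then have "\<bar>v i\<bar> \<le> \<bar>e (\<phi> i)\<bar>" using tp(2)[OF i False \<phi>i(1)] by simp
      then have "\<bar>(1 + \<theta>) * x i\<bar> \<le> \<bar>e i\<bar> + \<bar>e (\<phi> i)\<bar>" using v[OF i] by linarith
      then show ?thesis using half[of i] iR iu iA by (simp add: off_def eR_def e2_def)
    qed
  qed
  have "(vnorm n e2)\<^sup>2 \<le> (vnorm n eR)\<^sup>2"
  proof -
    have An: "A \<subseteq> {..<n}" using xn by (auto simp: A_def)
    have "(vnorm n e2)\<^sup>2 = (\<Sum>i\<in>A. (e (\<phi> i))\<^sup>2)"
      unfolding vnorm_power2 using An by (intro sum.mono_neutral_cong_right) (auto simp: e2_def)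
    also have "\<dots> = (\<Sum>i\<in>\<phi> ` A. (e i)\<^sup>2)" using \<phi>(2) by (simp add: sum.reindex)
    also have "\<dots> = (\<Sum>i\<in>\<phi> ` A. (eR i)\<^sup>2)" using \<phi>(1) by (intro sum.cong) (auto simp: eR_def R_def B_def)
    also have "\<dots> \<le> (vnorm n eR)\<^sup>2"
      unfolding vnorm_power2 using \<phi>(1) Tn by (intro sum_mono2) (auto simp: B_def)
    finally show ?thesis .
  qed
  then have e2le: "vnorm n e2 \<le> vnorm n eR" by (rule power2_le_imp_le) simp
  have ab: "vnorm n (\<lambda>i. \<bar>p i\<bar>) = vnorm n p" for p :: "nat \<Rightarrow> real"
    by (simp add: vnorm_def L2_set_def)
  have "vnorm n (off x (supp u)) \<le> vnorm n (\<lambda>i. 2 * (\<bar>eR i\<bar> + \<bar>e2 i\<bar>))"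
    by (intro vnorm_mono pt)
  also have "\<dots> = 2 * vnorm n (\<lambda>i. \<bar>eR i\<bar> + \<bar>e2 i\<bar>)" unfolding vnorm_scale by simp
  also have "\<dots> \<le> 2 * (vnorm n eR + vnorm n e2)"
    using vnorm_triangle[of n "\<lambda>i. \<bar>eR i\<bar>" "\<lambda>i. \<bar>e2 i\<bar>"] by (simp add: ab)
  also have "\<dots> \<le> 2 * (vnorm n eR + vnorm n eR)" using e2le by (intro mult_left_mono add_left_mono) auto
  finally show "vnorm n (off x (supp u)) \<le> 4 * vnorm n eR" by simp
  have pt2: "\<bar>u i - x i\<bar> \<le> \<bar>(\<bar>\<theta> * x i\<bar> + \<bar>eR i\<bar>) + \<bar>off x (supp u) i\<bar>\<bar>" if i: "i < n" for i
  proof (cases "i \<in> supp u")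
    case True
    then have "u i = v i" "i \<in> R" using su by (auto simp: u_def hard_threshold_def R_def)
    then have "u i - x i = \<theta> * x i + eR i" using v[OF i] by (simp add: eR_def algebra_simps)
    then show ?thesis by linarith
  next
    case False
    then show ?thesis by (simp add: off_def supp_def)
  qed
  have "vnorm n (\<lambda>i. u i - x i) \<le> vnorm n (\<lambda>i. (\<bar>\<theta> * x i\<bar> + \<bar>eR i\<bar>) + \<bar>off x (supp u) i\<bar>)"
    by (intro vnorm_mono pt2)
  also have "\<dots> \<le> vnorm n (\<lambda>i. \<bar>\<theta> * x i\<bar> + \<bar>eR i\<bar>) + vnorm n (\<lambda>i. \<bar>off x (supp u) i\<bar>)"
    by (rule vnorm_triangle)
  also have "\<dots> \<le> (vnorm n (\<lambda>i. \<bar>\<theta> * x i\<bar>) + vnorm n (\<lambda>i. \<bar>eR i\<bar>)) + vnorm n (\<lambda>i. \<bar>off x (supp u) i\<bar>)"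
    by (intro add_right_mono vnorm_triangle)
  also have "vnorm n (\<lambda>i. \<bar>\<theta> * x i\<bar>) = \<bar>\<theta>\<bar> * vnorm n x" by (simp only: ab vnorm_scale)
  finally show "vnorm n (\<lambda>i. u i - x i) \<le> \<bar>\<theta>\<bar> * vnorm n x + vnorm n eR + vnorm n (off x (supp u))"
    by (simp only: ab)
qed

definition ht_good :: "nat \<Rightarrow> nat \<Rightarrow> real \<Rightarrow> (nat \<Rightarrow> real) \<Rightarrow> (nat \<Rightarrow> real) \<Rightarrow> (nat \<Rightarrow> real) \<Rightarrow> bool" where
  "ht_good n s \<epsilon> x z u \<longleftrightarrow> u \<in> Rn n \<and> card (supp u) \<le> s \<and>
     vnorm n (off x (supp u)) \<le> \<epsilon> * vnorm n (\<lambda>i. z i - x i) \<and>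
     vnorm n (\<lambda>i. u i - x i) \<le> 5 * vnorm n (\<lambda>i. z i - x i)"

text \<open>In units of H times E, the bound on the square of \<open>E\<close> collects
  \<epsilon>/16 from the distance of \<mu> X^2 to 1, and \<mu> X^2 \<le> 2 times \<epsilon>/32 +
  \<epsilon>/32 from fluctuation (\<epsilon>/192 * 2 * 3) and from the part of the mean quadratic in
  \<open>h\<close> (8 * \<epsilon>/256). The total 3\<epsilon>/16 is below \<epsilon>/4, which
  offsets the factor 4 of \<open>hard_threshold_error\<close>. The factor 5 in
  \<open>ht_good\<close> covers 13/4 + 1/4 + 1.\<close>

lemma ht_step_good:
  assumes s: "1 \<le> s" "s \<le> n" and x: "x \<in> Rn n" "norm0 x \<le> s" and x0: "0 < vnorm n x"
    and \<epsilon>: "0 < \<epsilon>" "\<epsilon> \<le> 1"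
    and h: "vnorm n (\<lambda>i. z i - x i) \<le> \<epsilon> / 256 * vnorm n x"
    and \<mu>: "(1 - \<epsilon> / 16) / (vnorm n x)\<^sup>2 < \<mu>" "\<mu> < (1 + \<epsilon> / 16) / (vnorm n x)\<^sup>2"
    and conc: "\<And>u. u \<in> Rn n \<Longrightarrow> card (supp u) \<le> min (2 * s) n \<Longrightarrow>
      \<bar>avg m (\<lambda>j. bf n z u (a j) * bf n (\<lambda>i. z i - x i) (\<lambda>i. z i + x i) (a j))
        - mean n (\<lambda>a. bf n z u a * bf n (\<lambda>i. z i - x i) (\<lambda>i. z i + x i) a)\<bar>
      \<le> \<epsilon> / 192 * (vnorm n z * vnorm n u * vnorm n (\<lambda>i. z i - x i) * vnorm n (\<lambda>i. z i + x i))"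
  shows "ht_good n s \<epsilon> x z (ht_step n m s \<mu> x a z)"
proof -
  define h where "h = (\<lambda>i. z i - x i)"
  define q where "q = (\<lambda>i. z i + x i)"
  define g where "g = gradient n (loss n m a (measurements n a x)) z"
  define v where "v = (\<lambda>i. z i - \<mu> * g i)"
  define X where "X = vnorm n x"
  define H where "H = vnorm n h"
  \<comment> \<open>The mean gradient contains \<open>3 * ip n h x\<close> times \<open>x\<close>,
    which is of the same order as \<open>h\<close> but parallel to \<open>x\<close>. It is moved
    into the scale of \<open>x\<close>, leaving \<open>e\<close> small.\<close>
  define \<theta> where "\<theta> = - 3 * \<mu> * ip n h x"
  define e where "e = (\<lambda>i. h i - \<mu> * g i - \<theta> * x i)"
  have X0: "0 < X" "0 < X\<^sup>2" using x0 by (auto simp: X_def)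
  have H0: "0 \<le> H" by (simp add: H_def)
  have HX: "H \<le> \<epsilon> / 256 * X" using assms(8) by (simp add: H_def h_def X_def)
  have \<mu>X: "\<bar>1 - \<mu> * X\<^sup>2\<bar> \<le> \<epsilon> / 16" "0 < \<mu>" "\<mu> * X\<^sup>2 \<le> 2" "\<mu> * X\<^sup>2 \<le> 17/16"
  proof -
    have "1 - \<epsilon> / 16 < \<mu> * X\<^sup>2" using \<mu>(1) X0 by (simp add: X_def[symmetric] pos_divide_less_eq)
    moreover have "\<mu> * X\<^sup>2 < 1 + \<epsilon> / 16" using \<mu>(2) X0 by (simp add: X_def[symmetric] pos_less_divide_eq)
    ultimately show "\<bar>1 - \<mu> * X\<^sup>2\<bar> \<le> \<epsilon> / 16" "\<mu> * X\<^sup>2 \<le> 2" "\<mu> * X\<^sup>2 \<le> 17/16"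
      using \<epsilon> by linarith+
    have "0 < \<mu> * X\<^sup>2" using \<open>1 - \<epsilon> / 16 < \<mu> * X\<^sup>2\<close> \<epsilon> by linarith
    then show "0 < \<mu>" using X0 by (simp add: zero_less_mult_iff)
  qed
  have th: "\<bar>\<theta>\<bar> * X \<le> 13/4 * H"
  proof -
    have "\<bar>\<theta>\<bar> = 3 * \<mu> * \<bar>ip n h x\<bar>" using \<mu>X(2) by (simp add: \<theta>_def abs_mult)
    also have "\<dots> \<le> 3 * \<mu> * (H * X)"
      using ip_Cauchy_Schwarz[of n h x] \<mu>X(2) by (intro mult_left_mono) (auto simp: H_def X_def)
    finally have "\<bar>\<theta>\<bar> * X \<le> 3 * \<mu> * (H * X) * X" using X0 by (intro mult_right_mono) auto
    also have "\<dots> = 3 * H * (\<mu> * X\<^sup>2)" by (simp add: power2_eq_square)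
    also have "\<dots> \<le> 3 * H * (17/16)" using H0 \<mu>X by (intro mult_left_mono) auto
    also have "\<dots> \<le> 13/4 * H" using H0 by simp
    finally show ?thesis .
  qed
  have \<theta>12: "\<bar>\<theta>\<bar> \<le> 1/2"
  proof -
    have "\<bar>\<theta>\<bar> * X \<le> 13/4 * (\<epsilon> / 256 * X)" using th HX by linarith
    also have "\<dots> \<le> 1/2 * X" using \<epsilon> X0 by simp
    finally show ?thesis using X0 by (simp only: mult_le_cancel_right_pos)
  qed
  have ve: "v i = (1 + \<theta>) * x i + e i" for i by (simp add: v_def e_def h_def algebra_simps)
  define u where "u = hard_threshold n s v"
  have u_eq: "ht_step n m s \<mu> x a z = u" by (simp add: ht_step_def u_def v_def g_def)
  define R where "R = supp x \<union> top_entries n s v"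
  define eR where "eR = (\<lambda>i. if i \<in> R then e i else 0)"
  note he = hard_threshold_error[OF s(2) x \<theta>12 ve, folded u_def, folded R_def, folded eR_def]
  have eRn: "eR \<in> Rn n" using he(4) by (auto simp: eR_def Rn_def)
  have "supp eR \<subseteq> R" by (auto simp: eR_def supp_def)
  then have "card (supp eR) \<le> card R" using he(4) by (intro card_mono finite_subset[of R "{..<n}"]) auto
  moreover have "card R \<le> n" using card_mono[OF _ he(4)] by simp
  ultimately have ceR: "card (supp eR) \<le> min (2 * s) n" using he(3) by simp
  define E where "E = vnorm n eR"
  have zX: "vnorm n z \<le> 2 * X" "vnorm n q \<le> 3 * X"
  proof -
    have "vnorm n z \<le> vnorm n h + vnorm n x" using vnorm_triangle[of n h x] by (simp add: h_def)
    moreover have "\<epsilon> / 256 * X \<le> 1 * X" using \<epsilon> X0 by (intro mult_right_mono) auto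
    ultimately show 1: "vnorm n z \<le> 2 * X" using HX by (simp add: H_def X_def)
    show "vnorm n q \<le> 3 * X" using vnorm_triangle[of n z x] 1 by (simp add: q_def X_def)
  qed
  have fl: "\<bar>ip n g eR - mean n (\<lambda>a. bf n z eR a * bf n h q a)\<bar> \<le> \<epsilon> / 32 * (X\<^sup>2 * H * E)"
  proof -
    have "\<bar>ip n g eR - mean n (\<lambda>a. bf n z eR a * bf n h q a)\<bar> \<le> \<epsilon> / 192 * (vnorm n z * E * H * vnorm n q)"
      using conc[OF eRn ceR] unfolding g_def ip_gradient_loss h_def q_def H_def E_def .
    also have "\<dots> \<le> \<epsilon> / 192 * ((2 * X) * E * H * (3 * X))"
      using zX \<epsilon> X0 H0 by (intro mult_left_mono mult_mono) (auto simp: E_def)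
    also have "\<dots> = \<epsilon> / 32 * (X\<^sup>2 * H * E)" by (simp add: power2_eq_square)
    finally show ?thesis .
  qed
  have mn: "\<bar>mean n (\<lambda>a. bf n z eR a * bf n h q a) - (X\<^sup>2 * ip n h eR + 3 * ip n h x * ip n x eR)\<bar> \<le> \<epsilon> / 32 * (X\<^sup>2 * H * E)"
  proof -
    \<comment> \<open>With z = x + h and q = 2x + h, the first term is linear in \<open>h\<close>
      and has an exact mean; the other two are quadratic in \<open>h\<close> and only need a
      bound.\<close>
    have exp: "bf n z eR a * bf n h q a = 2 * (bf n x eR a * bf n x h a) + (bf n x eR a * bf n h h a + bf n h eR a * bf n h q a)" for a
    proof -
      have z: "z = (\<lambda>i. x i + h i)" and q: "q = (\<lambda>i. (x i + x i) + h i)" by (auto simp: h_def q_def)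
      have "bf n z eR a = bf n x eR a + bf n h eR a" by (subst z) (rule bf_linear)
      moreover have "bf n h q a = 2 * bf n x h a + bf n h h a"
        by (subst q) (simp add: bf_linear bf_commute[of n h x])
      ultimately show ?thesis by (simp add: algebra_simps)
    qed
    have "mean n (\<lambda>a. bf n z eR a * bf n h q a) = 2 * mean n (\<lambda>a. bf n x eR a * bf n x h a)
       + (mean n (\<lambda>a. bf n x eR a * bf n h h a) + mean n (\<lambda>a. bf n h eR a * bf n h q a))"
      unfolding exp[abs_def] using integrable_bf_product by simp
    also have "2 * mean n (\<lambda>a. bf n x eR a * bf n x h a) = X\<^sup>2 * ip n h eR + 3 * ip n h x * ip n x eR"
      unfolding bf_polarized_moment(2) by (simp add: X_def ip_commute[of n x h] ip_commute[of n eR h])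
    finally have "mean n (\<lambda>a. bf n z eR a * bf n h q a) - (X\<^sup>2 * ip n h eR + 3 * ip n h x * ip n x eR) =
        mean n (\<lambda>a. bf n x eR a * bf n h h a) + mean n (\<lambda>a. bf n h eR a * bf n h q a)" by simp
    also have "\<bar>\<dots>\<bar> \<le> 2 * (X * E * H * H) + 2 * (H * E * H * vnorm n q)"
      using mean_bf_product_bound[of n x eR h h] mean_bf_product_bound[of n h eR h q]
      unfolding X_def E_def H_def by linarith
    also have "\<dots> \<le> 2 * (X * E * H * H) + 2 * (H * E * H * (3 * X))"
      using zX H0 by (intro add_left_mono mult_left_mono) (auto simp: E_def)
    also have "\<dots> = 8 * (X * H * E) * H" by simp
    also have "\<dots> \<le> 8 * (X * H * E) * (\<epsilon> / 256 * X)" using HX X0 H0 by (intro mult_left_mono) (auto simp: E_def)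
    also have "\<dots> = \<epsilon> / 32 * (X\<^sup>2 * H * E)" by (simp add: power2_eq_square)
    finally show ?thesis .
  qed
  \<comment> \<open>The error is tested against itself. Its support \<open>R\<close> depends on the
    data through the selected indices, which is why concentration has to be uniform over
    \<open>2 * s\<close>-sparse vectors. Dividing by \<open>E\<close> at the end gives the
    bound.\<close>
  have "E\<^sup>2 = ip n e eR"
  proof -
    have "E\<^sup>2 = ip n eR eR" by (simp add: E_def vnorm_power2_ip)
    also have "\<dots> = ip n e eR" unfolding ip_def by (intro sum.cong) (auto simp: eR_def)
    finally show ?thesis .
  qed
  also have "\<dots> = ip n h eR - \<mu> * ip n g eR - \<theta> * ip n x eR"
    unfolding e_def by (simp add: ip_linear)
  also have "\<dots> = (1 - \<mu> * X\<^sup>2) * ip n h eR - \<mu> * (ip n g eR - (X\<^sup>2 * ip n h eR + 3 * ip n h x * ip n x eR))"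
    by (simp add: \<theta>_def algebra_simps)
  also have "\<dots> \<le> \<epsilon> / 16 * (H * E) + \<mu> * (\<epsilon> / 16 * (X\<^sup>2 * H * E))"
  proof -
    have "(1 - \<mu> * X\<^sup>2) * ip n h eR \<le> \<bar>1 - \<mu> * X\<^sup>2\<bar> * \<bar>ip n h eR\<bar>" by (simp add: abs_mult[symmetric])
    also have "\<dots> \<le> \<epsilon> / 16 * (H * E)"
      using \<mu>X ip_Cauchy_Schwarz[of n h eR] \<epsilon> by (intro mult_mono) (auto simp: H_def E_def)
    finally have 1: "(1 - \<mu> * X\<^sup>2) * ip n h eR \<le> \<epsilon> / 16 * (H * E)" .
    have "- (ip n g eR - (X\<^sup>2 * ip n h eR + 3 * ip n h x * ip n x eR)) \<le> \<epsilon> / 16 * (X\<^sup>2 * H * E)"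
      using fl mn by linarith
    then have "\<mu> * - (ip n g eR - (X\<^sup>2 * ip n h eR + 3 * ip n h x * ip n x eR)) \<le> \<mu> * (\<epsilon> / 16 * (X\<^sup>2 * H * E))"
      using \<mu>X(2) by (intro mult_left_mono) auto
    then show ?thesis using 1 by linarith
  qed
  also have "\<mu> * (\<epsilon> / 16 * (X\<^sup>2 * H * E)) = (\<mu> * X\<^sup>2) * (\<epsilon> / 16 * (H * E))" by simp
  also have "\<dots> \<le> 2 * (\<epsilon> / 16 * (H * E))" using \<mu>X \<epsilon> H0 by (intro mult_right_mono) (auto simp: E_def)
  finally have "E * E \<le> (3 * \<epsilon> / 16 * H) * E" by (simp add: power2_eq_square algebra_simps)
  then have EH: "E \<le> \<epsilon> / 4 * H"
  proof (cases "E = 0")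
    case False
    then have "0 < E" by (simp add: E_def less_le)
    then have "E \<le> 3 * \<epsilon> / 16 * H" using \<open>E * E \<le> (3 * \<epsilon> / 16 * H) * E\<close> by simp
    moreover have "0 \<le> \<epsilon> * H" using \<epsilon> H0 by simp
    ultimately show ?thesis by simp
  qed (use \<epsilon> H0 in simp)
  have o: "vnorm n (off x (supp u)) \<le> \<epsilon> * H" using he(5) EH unfolding E_def by linarith
  have "\<epsilon> * H \<le> H" using \<epsilon> H0 by (simp add: mult_left_le_one_le)
  then have "vnorm n (\<lambda>i. u i - x i) \<le> 5 * H" using he(6) th EH o H0 unfolding E_def X_def by linarith
  then show ?thesis unfolding ht_good_def u_eq using he(1,2) o by (simp add: H_def h_def)
qed

lemma ht_step_prob:
  assumes \<epsilon>: "0 < \<epsilon>" "\<epsilon> \<le> 1"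
  shows "\<exists>C>0. \<forall>n s m x z \<mu>. 1 \<le> s \<longrightarrow> s \<le> n \<longrightarrow> x \<in> Rn n \<longrightarrow> norm0 x \<le> s \<longrightarrow> 0 < vnorm n x \<longrightarrow>
    vnorm n (\<lambda>i. z i - x i) \<le> \<epsilon> / 256 * vnorm n x \<longrightarrow>
    (1 - \<epsilon> / 16) / (vnorm n x)\<^sup>2 < \<mu> \<longrightarrow> \<mu> < (1 + \<epsilon> / 16) / (vnorm n x)\<^sup>2 \<longrightarrow>
    C * sparse_size n (min (2 * s) n) \<le> real m \<longrightarrow>
    with_prob_ge (block n m) (1 - C / m) (\<lambda>a. ht_good n s \<epsilon> x z (ht_step n m s \<mu> x a z))"
proof -
  have "0 < \<epsilon> / 192" using \<epsilon> by simp
  from bilinear_concentration[OF this] obtain C where C: "0 < C" and H: "\<And>n k m p q r. 1 \<le> k \<Longrightarrow> k \<le> n \<Longrightarrow>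
    C * sparse_size n k \<le> real m \<Longrightarrow> with_prob_ge (block n m) (1 - C / m) (\<lambda>a. \<forall>u\<in>Rn n. card (supp u) \<le> k \<longrightarrow>
      \<bar>avg m (\<lambda>j. bf n p u (a j) * bf n q r (a j)) - mean n (\<lambda>a. bf n p u a * bf n q r a)\<bar>
        \<le> \<epsilon> / 192 * (vnorm n p * vnorm n u * vnorm n q * vnorm n r))" by blast
  show ?thesis
  proof (intro exI[of _ C] conjI allI impI C, goal_cases)
    case (1 n s m x z \<mu>)
    have k: "1 \<le> min (2 * s) n" "min (2 * s) n \<le> n" using 1 by auto
    show ?case
      by (rule with_prob_ge_mono[OF H[OF k 1(9), of z "\<lambda>i. z i - x i" "\<lambda>i. z i + x i"] order_refl])
        (intro ht_step_good[OF 1(1-5) \<epsilon> 1(6-8)], blast)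
  qed
qed

subsection \<open>The Gauss--Newton step\<close>

text \<open>The level 1152 makes truncation cost at most half of the mean \<open>(vnorm n u)\<^sup>2 / 2\<close>.\<close>

definition trunc :: "nat \<Rightarrow> (nat \<Rightarrow> real) \<Rightarrow> (nat \<Rightarrow> real) \<Rightarrow> (nat \<Rightarrow> complex) \<Rightarrow> real" where
  "trunc n w u a = (if bf n (nrm n w) (nrm n w) a \<le> 1152 then (bf n (nrm n w) u a)\<^sup>2 else 0)"

text \<open>The first two conditions give a lower curvature bound on sparse vectors. The last two
  bound the two terms of the least-squares residual at the restriction of \<open>x\<close> to
  \<open>S\<close>; they involve only vectors fixed before the block is drawn, so Chebyshev's
  inequality suffices.\<close>

definition gn_good ::
  "nat \<Rightarrow> nat \<Rightarrow> nat \<Rightarrow> (nat \<Rightarrow> real) \<Rightarrow> nat set \<Rightarrow> (nat \<Rightarrow> real) \<Rightarrow> (nat \<Rightarrow> nat \<Rightarrow> complex) \<Rightarrow> bool" where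
  "gn_good n k m x S w a \<longleftrightarrow> rip_net n k m a \<and>
     (\<forall>u\<in>net n k 2000. (vnorm n u)\<^sup>2 / 4 - 1 / 32 < avg m (\<lambda>j. trunc n w u (a j))) \<and>
     avg m (\<lambda>j. (bf n (nrm n (off x S)) (nrm n w) (a j))\<^sup>2) < 2306 \<and>
     avg m (\<lambda>j. (bf n (nrm n (\<lambda>i. w i - x i)) (nrm n (\<lambda>i. w i - x i)) (a j))\<^sup>2) < 2306"

text \<open>288288 = 144 * 2002 is the constant of \<open>net_concentration\<close> for resolution
  2000, at deviation 1/147456.\<close>

definition gn_const :: real where "gn_const = 288288 * 147456\<^sup>2"

lemma trunc_measurable [measurable]: "trunc n w u \<in> borel_measurable (complex_gaussian n)"
  unfolding trunc_def[abs_def] by measurable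

lemma trunc_nonneg: "0 \<le> trunc n w u a"
  by (simp add: trunc_def)

lemma trunc_le: "trunc n w u a \<le> 1152 * bf n u u a"
proof (cases "bf n (nrm n w) (nrm n w) a \<le> 1152")
  case True
  then have "bf n (nrm n w) (nrm n w) a * bf n u u a \<le> 1152 * bf n u u a" by (intro mult_right_mono) auto
  then show ?thesis using True bf_Cauchy_Schwarz[of n "nrm n w" u a] by (simp add: trunc_def)
qed (simp add: trunc_def)

lemma vnorm_nrm: "vnorm n w \<noteq> 0 \<Longrightarrow> vnorm n (nrm n w) = 1"
proof -
  assume "vnorm n w \<noteq> 0"
  moreover have "nrm n w = (\<lambda>i. (1 / vnorm n w) * w i)" by (auto simp: nrm_def)
  ultimately show ?thesis using vnorm_scale[of n "1 / vnorm n w" w] by simp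
qed

text \<open>Before truncation the mean is at least half of \<open>vnorm n u\<close> squared. Where
  truncation acts, the factor \<open>bf / 1152\<close> exceeds 1, so the lost part is at most the
  mean of the product \<open>P\<close> divided by 1152; that mean is at most 288 = 6 * 48 with 48 =
  3! * 2^3, and 288/1152 = 1/4.\<close>

lemma mean_trunc:
  assumes w: "vnorm n w \<noteq> 0"
  shows "(vnorm n u)\<^sup>2 / 4 \<le> mean n (trunc n w u)"
proof -
  let ?w = "nrm n w" and ?u = "nrm n u"
  define P where "P a = (bf n ?w ?w a * bf n ?w ?w a * bf n ?u ?u a) ^ 1" for a
  have Pm: "P \<in> borel_measurable (complex_gaussian n)" unfolding P_def[abs_def] by measurable
  have Pb: "\<bar>P a\<bar> \<le> 48 * (exp (bf n ?w ?w a / 2) + exp (bf n ?w ?w a / 2) + exp (bf n ?u ?u a / 2))" for a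
  proof -
    have "P a \<le> bf n ?w ?w a ^ (3 * 1) + bf n ?w ?w a ^ (3 * 1) + bf n ?u ?u a ^ (3 * 1)"
      unfolding P_def by (rule prod3_power_le) auto
    also have "\<dots> \<le> 48 * exp (bf n ?w ?w a / 2) + 48 * exp (bf n ?w ?w a / 2) + 48 * exp (bf n ?u ?u a / 2)"
    proof -
      have "y ^ (3 * 1) \<le> 48 * exp (y / 2)" if "0 \<le> y" for y :: real
        using power_le_exp_half[OF that, of 3] by (simp add: fact_numeral)
      then show ?thesis by (intro add_mono) auto
    qed
    finally have "P a \<le> 48 * (exp (bf n ?w ?w a / 2) + exp (bf n ?w ?w a / 2) + exp (bf n ?u ?u a / 2))"
      by (simp add: distrib_left)
    moreover have "0 \<le> P a" by (simp add: P_def)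
    ultimately show ?thesis by simp
  qed
  note PI = integrable_bf_dominated[OF Pm vnorm_nrm_le vnorm_nrm_le vnorm_nrm_le Pb]
  have iP: "integrable (complex_gaussian n) P" and mP: "mean n P \<le> 288" using PI by auto
  have low: "(bf n ?w u a)\<^sup>2 - (vnorm n u)\<^sup>2 / 1152 * P a \<le> trunc n w u a" for a
  proof (cases "bf n ?w ?w a \<le> 1152")
    case True
    then show ?thesis by (simp add: trunc_def P_def)
  next
    case False
    have e: "bf n u u a = (vnorm n u)\<^sup>2 * bf n ?u ?u a" using bf_nrm2[of n u u a] by (simp add: power2_eq_square)
    have "(bf n ?w u a)\<^sup>2 \<le> bf n ?w ?w a * bf n u u a" by (rule bf_Cauchy_Schwarz)
    also have "\<dots> \<le> (bf n ?w ?w a * (bf n ?w ?w a / 1152)) * bf n u u a"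
      using False by (intro mult_right_mono) auto
    also have "\<dots> = (vnorm n u)\<^sup>2 / 1152 * P a" by (simp add: e P_def)
    finally show ?thesis using False by (simp add: trunc_def)
  qed
  have iT: "integrable (complex_gaussian n) (trunc n w u)"
    by (rule Bochner_Integration.integrable_bound[of _ "\<lambda>a. 1152 * bf n u u a"])
      (use bf_moments(1)[of n u] trunc_le[of n w u] trunc_nonneg[of n w u] in auto)
  have "(vnorm n u)\<^sup>2 / 2 \<le> mean n (\<lambda>a. (bf n ?w u a)\<^sup>2)"
    unfolding bf_moments(4) vnorm_nrm[OF w] by simp
  moreover have "(vnorm n u)\<^sup>2 / 1152 * mean n P \<le> (vnorm n u)\<^sup>2 / 1152 * 288"
    using mP by (intro mult_left_mono) auto
  moreover have "mean n (\<lambda>a. (bf n ?w u a)\<^sup>2 - (vnorm n u)\<^sup>2 / 1152 * P a) \<le> mean n (trunc n w u)"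
    using iP bf_moments(2) by (intro integral_mono iT low) auto
  moreover have "mean n (\<lambda>a. (bf n ?w u a)\<^sup>2 - (vnorm n u)\<^sup>2 / 1152 * P a) =
      mean n (\<lambda>a. (bf n ?w u a)\<^sup>2) - (vnorm n u)\<^sup>2 / 1152 * mean n P"
    using iP bf_moments(2) by simp
  moreover have "(vnorm n u)\<^sup>2 / 1152 * 288 = (vnorm n u)\<^sup>2 / 4" by simp
  ultimately show ?thesis by linarith
qed

text \<open>\<open>block_Chebyshev\<close> for the square of \<open>bf n p q\<close>, whose own
  square is at most a sum of two fourth powers of forms. Here 384 = 4! * 2^4, 2306 = 6 * 384 + 2 and
  2304 = 6 * 384.\<close>

lemma scalar_average_prob:
  assumes m: "0 < m" and p: "vnorm n p \<le> 1" and q: "vnorm n q \<le> 1"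
  shows "measure (block n m) {a \<in> space (block n m). avg m (\<lambda>j. (bf n p q (a j))\<^sup>2) \<ge> 2306} \<le> 2304 / m"
proof -
  have "((bf n p q a)\<^sup>2)\<^sup>2 \<le> 384 * (exp (bf n p p a / 2) + exp (bf n q q a / 2) + exp (bf n q q a / 2))" for a
  proof -
    have e: "y ^ 4 \<le> 384 * exp (y / 2)" if "0 \<le> y" for y :: real
      using power_le_exp_half[OF that, of 4] by (simp add: fact_numeral)
    have "((bf n p q a)\<^sup>2)\<^sup>2 \<le> (bf n p p a * bf n q q a)\<^sup>2"
      by (intro power_mono bf_Cauchy_Schwarz) simp
    also have "\<dots> \<le> bf n p p a ^ 4 + bf n q q a ^ 4"
    proof -
      have "0 \<le> ((bf n p p a)\<^sup>2)\<^sup>2 + ((bf n q q a)\<^sup>2)\<^sup>2 - 2 * (bf n p p a)\<^sup>2 * (bf n q q a)\<^sup>2"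
        unfolding power2_diff[symmetric] by simp
      then have "2 * (bf n p p a * bf n q q a)\<^sup>2 \<le> bf n p p a ^ 4 + bf n q q a ^ 4"
        by (simp add: power_mult_distrib power_mult[symmetric])
      moreover have "0 \<le> (bf n p p a * bf n q q a)\<^sup>2" by simp
      ultimately show ?thesis by linarith
    qed
    also have "\<dots> \<le> 384 * exp (bf n p p a / 2) + 384 * exp (bf n q q a / 2)"
      by (intro add_mono e) auto
    also have "\<dots> \<le> 384 * exp (bf n p p a / 2) + 384 * exp (bf n q q a / 2) + 384 * exp (bf n q q a / 2)" by simp
    finally show ?thesis by (simp add: distrib_left)
  qed
  from block_Chebyshev[OF _ p q q this _ m] show ?thesis by simp
qed

lemma gn_good_prob:
  assumes k: "1 \<le> k" "k \<le> n" and m: "gn_const * sparse_size n k \<le> real m" and w: "vnorm n w \<noteq> 0"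
  shows "{a \<in> space (block n m). \<not> gn_good n k m x S w a} \<in> sets (block n m)"
    and "measure (block n m) {a \<in> space (block n m). \<not> gn_good n k m x S w a} \<le> gn_const / m"
proof -
  interpret B: prob_space "block n m" by (rule prob_space_block)
  have s1: "1 \<le> sparse_size n k" by (rule sparse_size_ge[OF k])
  have gc: "0 < gn_const" by (simp add: gn_const_def)
  have "0 < gn_const * sparse_size n k" using gc s1 by (intro mult_pos_pos) auto
  then have m0: "0 < m" using m by linarith
  have m': "c * sparse_size n k \<le> real m" if "c \<le> gn_const" for c
    using that m s1 by (meson mult_right_mono order.trans zero_le_one)
  define p where "p = nrm n (off x S)"
  define h where "h = nrm n (\<lambda>i. w i - x i)"
  \<comment> \<open>4608 = 4 * 1152 turns \<open>trunc_le\<close> into the normalization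
    \<open>bf / 4\<close>, and 147456 = 32 * 4608, so the deviation amounts to 1/32 for
    \<open>trunc\<close> itself.\<close>
  let ?Y = "\<lambda>u a. - trunc n w u a / 4608"
  define E1 where "E1 a \<longleftrightarrow> (\<exists>u\<in>net n k 2000. avg m (\<lambda>j. ?Y u (a j)) \<ge> mean n (?Y u) + 1 / 147456)" for a
  define E2 where "E2 a \<longleftrightarrow> 2306 \<le> avg m (\<lambda>j. (bf n p (nrm n w) (a j))\<^sup>2)" for a
  define E3 where "E3 a \<longleftrightarrow> 2306 \<le> avg m (\<lambda>j. (bf n h h (a j))\<^sup>2)" for a
  let ?E1 = "{a \<in> space (block n m). E1 a}" and ?E2 = "{a \<in> space (block n m). E2 a}"
    and ?E3 = "{a \<in> space (block n m). E3 a}" and ?E4 = "{a \<in> space (block n m). \<not> rip_net n k m a}"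
  have ms: "?E1 \<in> sets (block n m)" "?E2 \<in> sets (block n m)" "?E3 \<in> sets (block n m)" "?E4 \<in> sets (block n m)"
    unfolding E1_def E2_def E3_def rip_net_def using finite_net[of n k] by measurable
  show "{a \<in> space (block n m). \<not> gn_good n k m x S w a} \<in> sets (block n m)"
    unfolding gn_good_def rip_net_def using finite_net[of n k] by measurable
  have "measure (block n m) ?E1 \<le> 144 / ((1 / 147456)\<^sup>2 * m)"
    unfolding E1_def
  proof (rule net_concentration[OF k])
    show "\<bar>?Y u a\<bar> \<le> 1 + bf n u u a / 4" for u a
      using trunc_le[of n w u a] trunc_nonneg[of n w u a] by simp
    show "144 * (real 2000 + 2) / (1 / 147456)\<^sup>2 * sparse_size n k \<le> real m"
      by (rule m') (simp add: gn_const_def power_divide)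
  qed auto
  then have 1: "measure (block n m) ?E1 \<le> 144 * 147456\<^sup>2 / m" by (simp add: power_divide)
  have 2: "measure (block n m) ?E2 \<le> 2304 / m"
    unfolding E2_def p_def by (intro scalar_average_prob m0 vnorm_nrm_le)
  have 3: "measure (block n m) ?E3 \<le> 2304 / m"
    unfolding E3_def h_def by (intro scalar_average_prob m0 vnorm_nrm_le)
  have 4: "measure (block n m) ?E4 \<le> 144 / m"
    by (rule rip_net_prob[OF k m']) (simp add: gn_const_def)
  have sub: "{a \<in> space (block n m). \<not> gn_good n k m x S w a} \<subseteq> (?E1 \<union> ?E2) \<union> (?E3 \<union> ?E4)"
  proof safe
    fix a assume a: "a \<in> space (block n m)" "\<not> gn_good n k m x S w a" "\<not> E2 a" "\<not> E3 a" "rip_net n k m a"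
    then obtain u where u: "u \<in> net n k 2000" "avg m (\<lambda>j. trunc n w u (a j)) \<le> (vnorm n u)\<^sup>2 / 4 - 1 / 32"
      by (auto simp: gn_good_def E2_def E3_def p_def h_def not_less not_le)
    have "avg m (\<lambda>j. ?Y u (a j)) = - avg m (\<lambda>j. trunc n w u (a j)) / 4608"
      using avg_linear(3)[of m "-1/4608" "\<lambda>j. trunc n w u (a j)"] by simp
    moreover have "mean n (?Y u) = - mean n (trunc n w u) / 4608" by simp
    ultimately have "avg m (\<lambda>j. ?Y u (a j)) \<ge> mean n (?Y u) + 1 / 147456"
      using u(2) mean_trunc[OF w, of u] by simp
    then show "E1 a" unfolding E1_def using u(1) by blast
  qed
  have "measure (block n m) {a \<in> space (block n m). \<not> gn_good n k m x S w a} \<le>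
      measure (block n m) ((?E1 \<union> ?E2) \<union> (?E3 \<union> ?E4))"
    by (intro B.finite_measure_mono sub) (use ms in auto)
  also have "\<dots> \<le> (measure (block n m) ?E1 + measure (block n m) ?E2) + (measure (block n m) ?E3 + measure (block n m) ?E4)"
    by (intro order.trans[OF measure_Un_le] add_mono measure_Un_le) (use ms in auto)
  also have "\<dots> \<le> (144 * 147456\<^sup>2 / m + 2304 / m) + (2304 / m + 144 / m)"
    by (intro add_mono 1 2 3 4)
  also have "\<dots> = (144 * 147456\<^sup>2 + 4752) / m" by (simp add: add_divide_distrib)
  also have "\<dots> \<le> gn_const / m" by (intro divide_right_mono) (simp_all add: gn_const_def)
  finally show "measure (block n m) {a \<in> space (block n m). \<not> gn_good n k m x S w a} \<le> gn_const / m" .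
qed

text \<open>At the net point near the normalized \<open>u\<close> the average exceeds 1/8 - 1/32 =
  3/32. Passing to \<open>u\<close> keeps at least half of this, minus the contribution 1152 * 20 /
  2000^2 of the difference, which leaves more than 1/128. Both terms are truncated on the same
  event, since that event involves \<open>w\<close> only.\<close>

lemma gn_lower_bound:
  assumes G: "gn_good n k m x S w a" and k: "1 \<le> k" and u: "u \<in> Rn n" "card (supp u) \<le> k"
  shows "(vnorm n w)\<^sup>2 / 128 * (vnorm n u)\<^sup>2 \<le> avg m (\<lambda>j. (bf n w u (a j))\<^sup>2)"
proof (cases "vnorm n u = 0")
  case True
  then show ?thesis by (simp add: avg_nonneg)
next
  case False
  let ?u = "nrm n u"
  have rip: "rip_net n k m a" using G by (simp add: gn_good_def)
  have uT: "?u \<in> sparse_ball n k" by (rule nrm_in_sparse_ball[OF u])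
  obtain u0 where u0: "u0 \<in> net n k 2000" "u0 \<in> Rn n" "supp u0 \<subseteq> supp ?u" "vnorm n (\<lambda>i. ?u i - u0 i) \<le> 1 / 2000"
    using net_approx[OF k _ uT, of 2000] by auto
  let ?v = "\<lambda>i. ?u i - u0 i"
  have "vnorm n ?u \<le> vnorm n ?v + vnorm n u0" using vnorm_triangle[of n ?v u0] by simp
  then have n0: "1999 / 2000 \<le> vnorm n u0" using u0(4) vnorm_nrm[OF False] by simp
  have "1 / 2 \<le> (1999 / 2000 :: real)\<^sup>2" by (simp add: power2_eq_square)
  also have "\<dots> \<le> (vnorm n u0)\<^sup>2" using n0 by (intro power_mono) auto
  finally have "3 / 32 < avg m (\<lambda>j. trunc n w u0 (a j))"
    using G u0(1) by (fastforce simp: gn_good_def)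
  moreover have "avg m (\<lambda>j. trunc n w ?v (a j)) \<le> 1152 * (20 * (1 / 2000)\<^sup>2)"
  proof -
    have "avg m (\<lambda>j. trunc n w ?v (a j)) \<le> 1152 * avg m (\<lambda>j. bf n ?v ?v (a j))"
      unfolding avg_linear(3)[symmetric] by (intro avg_mono trunc_le)
    also have "\<dots> \<le> 1152 * (20 * (vnorm n ?v)\<^sup>2)"
      by (intro mult_left_mono rip_net_imp[OF rip k sparse_ball_diff[OF uT u0(2,3)]]) simp
    also have "\<dots> \<le> 1152 * (20 * (1 / 2000)\<^sup>2)" using u0(4) by (intro mult_left_mono power_mono) auto
    finally show ?thesis .
  qed
  moreover have "avg m (\<lambda>j. 1/2 * trunc n w u0 (a j) - trunc n w ?v (a j)) \<le> avg m (\<lambda>j. (bf n (nrm n w) ?u (a j))\<^sup>2)"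
  proof (rule avg_mono)
    fix j
    have "bf n (nrm n w) ?u (a j) = bf n (nrm n w) u0 (a j) + bf n (nrm n w) ?v (a j)" by (simp add: bf_linear)
    moreover have "1/2 * p\<^sup>2 - q\<^sup>2 \<le> (p + q)\<^sup>2" for p q :: real
    proof -
      have "0 \<le> (p + 2 * q)\<^sup>2" by simp
      then have "0 \<le> p\<^sup>2 + 4 * p * q + 4 * q\<^sup>2" by (simp add: power2_sum power_mult_distrib)
      then show ?thesis by (simp add: power2_sum)
    qed
    ultimately show "1/2 * trunc n w u0 (a j) - trunc n w ?v (a j) \<le> (bf n (nrm n w) ?u (a j))\<^sup>2"
      unfolding trunc_def by (simp split: if_splits)
  qed
  ultimately have "1 / 128 \<le> avg m (\<lambda>j. (bf n (nrm n w) ?u (a j))\<^sup>2)"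
    unfolding avg_linear(2,3) by (simp add: power2_eq_square)
  then have "(vnorm n w * vnorm n u)\<^sup>2 * (1 / 128) \<le> (vnorm n w * vnorm n u)\<^sup>2 * avg m (\<lambda>j. (bf n (nrm n w) ?u (a j))\<^sup>2)"
    by (intro mult_left_mono) auto
  also have "\<dots> = avg m (\<lambda>j. (bf n w u (a j))\<^sup>2)"
    unfolding avg_linear(3)[symmetric] power_mult_distrib[symmetric] bf_nrm2[symmetric] ..
  finally show ?thesis by (simp add: power_mult_distrib)
qed

section \<open>Least squares over vectors supported on a fixed set\<close>

definition gn_obj ::
  "nat \<Rightarrow> nat \<Rightarrow> (nat \<Rightarrow> real) \<Rightarrow> (nat \<Rightarrow> nat \<Rightarrow> complex) \<Rightarrow> (nat \<Rightarrow> real) \<Rightarrow> (nat \<Rightarrow> real) \<Rightarrow> real" where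
  "gn_obj n m x a w z = avg m (\<lambda>j. (bf n w (\<lambda>i. z i - x i) (a j)
     - bf n (\<lambda>i. w i - x i) (\<lambda>i. w i - x i) (a j) / 2)\<^sup>2)"

definition coord_space :: "nat \<Rightarrow> nat set \<Rightarrow> (nat \<Rightarrow> real) set" where
  "coord_space n S = {z \<in> Rn n. supp z \<subseteq> S}"

text \<open>The measurement map is quadratic, so linearizing it at \<open>w\<close> leaves exactly
  the second-order term: \<open>bf n w (z - w) + (bf n w w - bf n x x) / 2\<close> equals
  \<open>bf n w (z - x) - bf n h h / 2\<close> with h = w - x.\<close>

lemma gauss_newton_eq:
  "gauss_newton n m S a (measurements n a x) w = arg_min_on (gn_obj n m x a w) (coord_space n S)"
proof -
  have "(vnorm m (\<lambda>j. (\<Sum>i<n. jacobian n m a w j i * (z i - w i)) + residual n m a (measurements n a x) w j))\<^sup>2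
      = gn_obj n m x a w z" for z
  proof -
    let ?h = "\<lambda>i. w i - x i"
    have "(\<Sum>i<n. jacobian n m a w j i * (z i - w i)) = 1 / sqrt m * bf n w (\<lambda>i. z i - w i) (a j)" for j
    proof -
      have jac: "jacobian n m a w j i = 1 / sqrt m * (Re (a j i) * ar n w (a j) + Im (a j i) * ai n w (a j))" for i
        by (simp add: jacobian_def ar_def ai_def)
      have "(\<Sum>i<n. c * (Re (b i) * A + Im (b i) * B) * d i) = c * (A * ar n d b + B * ai n d b)"
        for A B c :: real and b d
        by (simp add: ar_def ai_def sum_distrib_left sum.distrib[symmetric] algebra_simps)
      then show ?thesis unfolding jac bf_def .
    qed
    moreover have "residual n m a (measurements n a x) w j = 1 / sqrt m * ((bf n w w (a j) - bf n x x (a j)) / 2)" for j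
      by (simp add: residual_def cmod_cinner_power2 measurements_bf)
    moreover have "bf n w (\<lambda>i. z i - w i) b + (bf n w w b - bf n x x b) / 2 = bf n w (\<lambda>i. z i - x i) b - bf n ?h ?h b / 2" for b
      by (simp add: bf_linear bf_commute[of n x w] field_simps)
    ultimately have "(\<Sum>i<n. jacobian n m a w j i * (z i - w i)) + residual n m a (measurements n a x) w j =
        1 / sqrt m * (bf n w (\<lambda>i. z i - x i) (a j) - bf n ?h ?h (a j) / 2)" for j
      by (metis distrib_left)
    then show ?thesis
      unfolding vnorm_power2 gn_obj_def avg_def by (simp add: power_divide sum_divide_distrib)
  qed
  then show ?thesis unfolding gauss_newton_def coord_space_def by simp
qed

lemma coord_space_closed:
  assumes "p \<in> coord_space n S" "q \<in> coord_space n S"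
  shows "(\<lambda>i. p i + t * q i) \<in> coord_space n S" "(\<lambda>i. p i - q i) \<in> coord_space n S"
proof -
  have "supp p \<subseteq> S" "supp q \<subseteq> S" "p \<in> Rn n" "q \<in> Rn n" using assms by (auto simp: coord_space_def)
  moreover from this have "p i + t * q i = 0" "p i - q i = 0" if "i \<notin> S" for i
  proof -
    have "p i = 0" "q i = 0" using that \<open>supp p \<subseteq> S\<close> \<open>supp q \<subseteq> S\<close> by (auto simp: supp_def)
    then show "p i + t * q i = 0" "p i - q i = 0" by auto
  qed
  ultimately show "(\<lambda>i. p i + t * q i) \<in> coord_space n S" "(\<lambda>i. p i - q i) \<in> coord_space n S"
    by (auto simp: coord_space_def Rn_def supp_def)
qed

lemma gn_obj_continuous: "continuous_on UNIV (gn_obj n m x a w)"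
  unfolding gn_obj_def avg_def bf_def ar_def ai_def divide_inverse
  by (intro continuous_on_sum continuous_on_power continuous_on_diff continuous_on_add continuous_on_mult
      continuous_on_const continuous_on_product_coordinates)

text \<open>Tychonoff's theorem. Vectors are points of an infinite product, and pinning the
  coordinates outside \<open>T\<close> to 0 is what makes the box compact.\<close>

lemma compact_box: "compact {z::nat \<Rightarrow> real. \<forall>i. z i \<in> (if i \<in> T then {l i..r i} else {0})}"
proof -
  have "compactin (product_topology (\<lambda>_. euclidean) UNIV) (Pi\<^sub>E UNIV (\<lambda>i::nat. if i \<in> T then {l i..r i} else {0::real}))"
    by (subst compactin_PiE) (auto simp: compactin_euclidean_iff)
  moreover have "Pi\<^sub>E UNIV (\<lambda>i::nat. if i \<in> T then {l i..r i} else {0::real}) = {z. \<forall>i. z i \<in> (if i \<in> T then {l i..r i} else {0})}"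
    by (auto simp: PiE_def Pi_def)
  ultimately show ?thesis by (simp only: euclidean_product_topology compactin_euclidean_iff)
qed

text \<open>\<open>arg_min_on\<close> is meaningful only if a minimum exists. The curvature bound
  makes the objective coercive, so a minimum over a compact box is global. The second claim is
  Pythagoras: at a minimizer the linear term along every admissible direction vanishes.\<close>

lemma gn_minimizer:
  fixes x :: "nat \<Rightarrow> real"
  assumes \<kappa>: "0 < \<kappa>" and low: "\<And>d. d \<in> coord_space n S \<Longrightarrow> \<kappa> * (vnorm n d)\<^sup>2 \<le> avg m (\<lambda>j. (bf n w d (a j))\<^sup>2)"
  defines "z \<equiv> gauss_newton n m S a (measurements n a x) w"
  shows "z \<in> coord_space n S"
    and "\<And>y. y \<in> coord_space n S \<Longrightarrow> gn_obj n m x a w y = gn_obj n m x a w z + avg m (\<lambda>j. (bf n w (\<lambda>i. y i - z i) (a j))\<^sup>2)"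
proof -
  let ?f = "gn_obj n m x a w" and ?V = "coord_space n S"
  let ?h = "\<lambda>i. w i - x i"
  define x1 where "x1 = (\<lambda>i. if i \<in> S \<and> i < n then x i else 0)"
  have x1: "x1 \<in> ?V" by (auto simp: x1_def coord_space_def Rn_def supp_def)
  define b where "b j = bf n w (\<lambda>i. x i - x1 i) (a j) + bf n ?h ?h (a j) / 2" for j
  have f_eq: "?f y = avg m (\<lambda>j. (bf n w (\<lambda>i. y i - x1 i) (a j) - b j)\<^sup>2)" for y
    unfolding gn_obj_def b_def by (simp add: bf_linear algebra_simps)
  have coer: "\<kappa> * (vnorm n (\<lambda>i. y i - x1 i))\<^sup>2 \<le> 2 * ?f y + 2 * ?f x1" if "y \<in> ?V" for y
  proof -
    have "\<kappa> * (vnorm n (\<lambda>i. y i - x1 i))\<^sup>2 \<le> avg m (\<lambda>j. (bf n w (\<lambda>i. y i - x1 i) (a j))\<^sup>2)"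
      by (intro low coord_space_closed that x1)
    also have "\<dots> \<le> avg m (\<lambda>j. 2 * (bf n w (\<lambda>i. y i - x1 i) (a j) - b j)\<^sup>2 + 2 * (bf n w (\<lambda>i. x1 i - x1 i) (a j) - b j)\<^sup>2)"
    proof (rule avg_mono)
      fix j
      have "p\<^sup>2 \<le> 2 * (p - c)\<^sup>2 + 2 * (0 - c)\<^sup>2" for p c :: real
      proof -
        have "0 \<le> (p - 2 * c)\<^sup>2" by simp
        then have "0 \<le> p\<^sup>2 - 4 * p * c + 4 * c\<^sup>2" by (simp add: power2_diff power_mult_distrib)
        then show ?thesis by (simp add: power2_diff)
      qed
      moreover have "bf n w (\<lambda>i. x1 i - x1 i) (a j) = 0" by (simp add: bf_def ar_def ai_def)
      ultimately show "(bf n w (\<lambda>i. y i - x1 i) (a j))\<^sup>2 \<le>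
        2 * (bf n w (\<lambda>i. y i - x1 i) (a j) - b j)\<^sup>2 + 2 * (bf n w (\<lambda>i. x1 i - x1 i) (a j) - b j)\<^sup>2" by metis
    qed
    also have "\<dots> = 2 * ?f y + 2 * ?f x1" unfolding avg_linear f_eq[of y] f_eq[of x1] ..
    finally show ?thesis .
  qed
  \<comment> \<open>By \<open>coer\<close>, an admissible \<open>y\<close> whose distance from
    \<open>x1\<close> exceeds \<open>B\<close> satisfies \<open>?f x1 \<le> ?f y\<close>, so the box
    of half-width \<open>B\<close> around \<open>x1\<close> is large enough.\<close>
  define B where "B = sqrt (4 * ?f x1 / \<kappa>)"
  have f0: "0 \<le> ?f y" for y by (simp add: gn_obj_def avg_nonneg)
  define T where "T = S \<inter> {..<n}"
  define K where "K = {y::nat \<Rightarrow> real. \<forall>i. y i \<in> (if i \<in> T then {x1 i - B..x1 i + B} else {0})}"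
  have B0: "0 \<le> B" using f0[of x1] \<kappa> by (simp add: B_def)
  have "compact K" unfolding K_def by (rule compact_box)
  moreover have x1K: "x1 \<in> K" using B0 by (auto simp: K_def x1_def T_def)
  ultimately obtain z0 where z0: "z0 \<in> K" "\<And>y. y \<in> K \<Longrightarrow> ?f z0 \<le> ?f y"
    using continuous_attains_inf[of K ?f] continuous_on_subset[OF gn_obj_continuous] by (metis empty_iff subset_UNIV)
  have KV: "K \<subseteq> ?V"
  proof
    fix y assume y: "y \<in> K"
    have "y i = 0" if "i \<notin> T" for i
    proof -
      have "y i \<in> (if i \<in> T then {x1 i - B..x1 i + B} else {0})" using y unfolding K_def by blast
      then show ?thesis using that by simp
    qed
    then show "y \<in> ?V" by (auto simp: coord_space_def Rn_def supp_def T_def)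
  qed
  have z0min: "?f z0 \<le> ?f y" if y: "y \<in> ?V" for y
  proof (cases "y \<in> K")
    case False
    have "y i = 0" if "i \<notin> T" for i using y that by (auto simp: coord_space_def Rn_def supp_def T_def)
    then obtain i where i: "i \<in> T" "y i \<notin> {x1 i - B..x1 i + B}" using False by (auto simp: K_def split: if_splits)
    then have "B < \<bar>y i - x1 i\<bar>" by auto
    also have "\<dots> \<le> vnorm n (\<lambda>i. y i - x1 i)" using i(1) abs_le_vnorm[of i n "\<lambda>i. y i - x1 i"] by (auto simp: T_def)
    finally have "B\<^sup>2 < (vnorm n (\<lambda>i. y i - x1 i))\<^sup>2" using B0 by (intro power_strict_mono) auto
    then have "4 * ?f x1 < \<kappa> * (vnorm n (\<lambda>i. y i - x1 i))\<^sup>2"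
      using \<kappa> f0[of x1] by (simp add: B_def field_simps)
    then have "?f x1 \<le> ?f y" using coer[OF y] by linarith
    then show ?thesis using z0(2)[OF x1K] by linarith
  qed (rule z0(2))
  have "is_arg_min ?f (\<lambda>y. y \<in> ?V) z0"
    unfolding is_arg_min_linorder using z0(1) KV z0min by blast
  then have "is_arg_min ?f (\<lambda>y. y \<in> ?V) z"
    unfolding z_def gauss_newton_eq arg_min_on_def arg_min_def by (rule someI[where P = "is_arg_min ?f (\<lambda>y. y \<in> ?V)"])
  then have zV: "z \<in> ?V" and zmin: "\<And>y. y \<in> ?V \<Longrightarrow> ?f z \<le> ?f y"
    unfolding is_arg_min_linorder by auto
  show "z \<in> ?V" by (rule zV)
  fix y assume y: "y \<in> ?V"
  define d where "d = (\<lambda>i. y i - z i)"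
  have dV: "d \<in> ?V" unfolding d_def by (rule coord_space_closed(2)[OF y zV])
  define c where "c j = bf n w (\<lambda>i. z i - x i) (a j) - bf n ?h ?h (a j) / 2" for j
  define P where "P = avg m (\<lambda>j. c j * bf n w d (a j))"
  define Q where "Q = avg m (\<lambda>j. (bf n w d (a j))\<^sup>2)"
  have Q0: "0 \<le> Q" by (simp add: Q_def avg_nonneg)
  have ft: "?f (\<lambda>i. z i + t * d i) = ?f z + 2 * t * P + t\<^sup>2 * Q" for t
  proof -
    have "bf n w (\<lambda>i. (z i + t * d i) - x i) (a j) - bf n ?h ?h (a j) / 2 = c j + t * bf n w d (a j)" for j
      unfolding c_def by (simp add: bf_linear)
    then have "?f (\<lambda>i. z i + t * d i) = avg m (\<lambda>j. (c j)\<^sup>2 + (2 * t) * (c j * bf n w d (a j)) + t\<^sup>2 * (bf n w d (a j))\<^sup>2)"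
      unfolding gn_obj_def by (simp add: power2_sum power_mult_distrib algebra_simps)
    then show ?thesis unfolding avg_linear P_def Q_def by (simp add: gn_obj_def c_def)
  qed
  have "P = 0"
  proof (rule ccontr)
    assume "P \<noteq> 0"
    \<comment> \<open>The vertex of the parabola is at -P/Q; the denominator Q + 1 also covers Q = 0
      and still lowers the objective, by
      \<open>P\<^sup>2 * (Q + 2) / (Q + 1)\<^sup>2\<close>.\<close>
    define t where "t = - P / (Q + 1)"
    have "0 \<le> 2 * t * P + t\<^sup>2 * Q" using zmin[OF coord_space_closed(1)[OF zV dV, of t]] ft[of t] by simp
    also have "\<dots> = (t * (Q + 1)) * (2 * P + t * Q) / (Q + 1)" using Q0 by (simp add: power2_eq_square field_simps)
    also have "t * (Q + 1) = - P" using Q0 by (simp add: t_def)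
    also have "2 * P + t * Q = P * ((Q + 2) / (Q + 1))" using Q0 by (simp add: t_def field_simps)
    also have "- P * (P * ((Q + 2) / (Q + 1))) / (Q + 1) = - (P\<^sup>2 * ((Q + 2) / (Q + 1) / (Q + 1)))"
      by (simp add: power2_eq_square)
    finally have "P\<^sup>2 * ((Q + 2) / (Q + 1) / (Q + 1)) \<le> 0" by simp
    moreover have "0 < P\<^sup>2 * ((Q + 2) / (Q + 1) / (Q + 1))" using \<open>P \<noteq> 0\<close> Q0 by (intro mult_pos_pos divide_pos_pos) auto
    ultimately show False by simp
  qed
  then show "?f y = ?f z + avg m (\<lambda>j. (bf n w (\<lambda>i. y i - z i) (a j))\<^sup>2)"
    using ft[of 1] by (simp add: d_def Q_def)
qed

text \<open>\<open>x1\<close>, the restriction of \<open>x\<close> to \<open>S\<close>, is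
  admissible, so the objective at \<open>z\<close> is at most that at \<open>x1\<close>, the average
  of the squares of \<open>b\<close>. Curvature converts this into a bound on \<open>z - x1\<close>;
  as it grows with the square of \<open>W\<close>, the lost part enters linearly and the
  second-order term as H^2/W, where W is at least X/2.\<close>

lemma gn_error:
  assumes G: "gn_good n k m x S w a" and k: "1 \<le> k" and S: "finite S" "card S \<le> k"
    and x: "x \<in> Rn n" and x0: "0 < vnorm n x" and wx: "vnorm n (\<lambda>i. w i - x i) \<le> vnorm n x / 2"
  defines "z \<equiv> gauss_newton n m S a (measurements n a x) w"
  shows "vnorm n (\<lambda>i. z i - x i) \<le> 1601 * (vnorm n (off x S) + (vnorm n (\<lambda>i. w i - x i))\<^sup>2 / vnorm n x)"
proof -
  let ?h = "\<lambda>i. w i - x i" and ?f = "gn_obj n m x a w"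
  define W where "W = vnorm n w"
  define X where "X = vnorm n x"
  define V where "V = vnorm n (off x S)"
  define H where "H = vnorm n ?h"
  have WX: "X / 2 \<le> W"
  proof -
    have "vnorm n x \<le> vnorm n w + vnorm n (\<lambda>i. w i - x i)" using vnorm_triangle_diff[of n w ?h] by simp
    then show ?thesis using wx by (simp add: W_def X_def)
  qed
  have X0: "0 < X" using x0 by (simp add: X_def)
  have W0: "0 < W" using WX X0 by linarith
  have low: "W\<^sup>2 / 128 * (vnorm n d)\<^sup>2 \<le> avg m (\<lambda>j. (bf n w d (a j))\<^sup>2)" if d: "d \<in> coord_space n S" for d
  proof -
    have "card (supp d) \<le> k" using d S card_mono[of S "supp d"] by (auto simp: coord_space_def)
    then show ?thesis unfolding W_def using d by (intro gn_lower_bound[OF G k]) (auto simp: coord_space_def)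
  qed
  have \<kappa>: "0 < W\<^sup>2 / 128" using W0 by simp
  have z: "z \<in> coord_space n S" "\<And>y. y \<in> coord_space n S \<Longrightarrow>
      ?f y = ?f z + avg m (\<lambda>j. (bf n w (\<lambda>i. y i - z i) (a j))\<^sup>2)"
    unfolding z_def by (rule gn_minimizer[OF \<kappa>], erule low, assumption?)+
  define x1 where "x1 = (\<lambda>i. if i \<in> S then x i else 0)"
  have x1: "x1 \<in> coord_space n S" using x by (auto simp: x1_def coord_space_def Rn_def supp_def)
  have xx1: "(\<lambda>i. x i - x1 i) = off x S" by (auto simp: x1_def off_def)
  define d where "d = (\<lambda>i. z i - x1 i)"
  define b where "b j = bf n w (off x S) (a j) + bf n ?h ?h (a j) / 2" for j
  have f_eq: "?f y = avg m (\<lambda>j. (bf n w (\<lambda>i. y i - x1 i) (a j) - b j)\<^sup>2)" for y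
    unfolding gn_obj_def b_def xx1[symmetric] by (simp add: bf_linear algebra_simps)
  have fx1: "?f x1 = avg m (\<lambda>j. (b j)\<^sup>2)"
    unfolding f_eq by (simp add: bf_def ar_def ai_def)
  have "0 \<le> avg m (\<lambda>j. (bf n w (\<lambda>i. x1 i - z i) (a j))\<^sup>2)" by (simp add: avg_nonneg)
  then have fz: "?f z \<le> ?f x1" using z(2)[OF x1] by linarith
  have "W\<^sup>2 / 128 * (vnorm n d)\<^sup>2 \<le> avg m (\<lambda>j. (bf n w d (a j))\<^sup>2)"
    unfolding d_def by (intro low coord_space_closed z x1)
  also have "\<dots> \<le> avg m (\<lambda>j. 2 * (bf n w d (a j) - b j)\<^sup>2 + 2 * (b j)\<^sup>2)"
  proof (rule avg_mono)
    fix j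
    have "p\<^sup>2 \<le> 2 * (p - c)\<^sup>2 + 2 * c\<^sup>2" for p c :: real
    proof -
      have "0 \<le> (p - 2 * c)\<^sup>2" by simp
      then have "0 \<le> p\<^sup>2 - 4 * p * c + 4 * c\<^sup>2" by (simp add: power2_diff power_mult_distrib)
      then show ?thesis by (simp add: power2_diff)
    qed
    then show "(bf n w d (a j))\<^sup>2 \<le> 2 * (bf n w d (a j) - b j)\<^sup>2 + 2 * (b j)\<^sup>2" .
  qed
  also have "\<dots> = 2 * ?f z + 2 * ?f x1"
    unfolding avg_linear f_eq[of z] fx1 d_def ..
  also have "\<dots> \<le> 4 * avg m (\<lambda>j. (b j)\<^sup>2)" using fz fx1 by linarith
  also have "\<dots> \<le> 4 * avg m (\<lambda>j. 2 * (bf n w (off x S) (a j))\<^sup>2 + 1/2 * (bf n ?h ?h (a j))\<^sup>2)"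
  proof (intro mult_left_mono avg_mono)
    fix j
    have "(p + q / 2)\<^sup>2 \<le> 2 * p\<^sup>2 + 1/2 * q\<^sup>2" for p q :: real
    proof -
      have "0 \<le> (p - q / 2)\<^sup>2" by simp
      then have "0 \<le> p\<^sup>2 - p * q + q\<^sup>2 / 4" by (simp add: power2_diff power_divide)
      then show ?thesis by (simp add: power2_sum power_divide)
    qed
    then show "(b j)\<^sup>2 \<le> 2 * (bf n w (off x S) (a j))\<^sup>2 + 1/2 * (bf n ?h ?h (a j))\<^sup>2" unfolding b_def .
  qed simp
  also have "\<dots> = 8 * avg m (\<lambda>j. (bf n w (off x S) (a j))\<^sup>2) + 2 * avg m (\<lambda>j. (bf n ?h ?h (a j))\<^sup>2)"
    unfolding avg_linear by simp
  also have "\<dots> \<le> 8 * ((V * W)\<^sup>2 * 2306) + 2 * ((H * H)\<^sup>2 * 2306)"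
  proof -
    have "avg m (\<lambda>j. (bf n w (off x S) (a j))\<^sup>2) = (V * W)\<^sup>2 * avg m (\<lambda>j. (bf n (nrm n (off x S)) (nrm n w) (a j))\<^sup>2)"
      unfolding avg_linear(3)[symmetric] power_mult_distrib[symmetric] V_def W_def bf_nrm2[symmetric]
      by (simp add: bf_commute[of n w])
    moreover have "avg m (\<lambda>j. (bf n ?h ?h (a j))\<^sup>2) = (H * H)\<^sup>2 * avg m (\<lambda>j. (bf n (nrm n ?h) (nrm n ?h) (a j))\<^sup>2)"
      unfolding avg_linear(3)[symmetric] power_mult_distrib[symmetric] H_def bf_nrm2[symmetric] ..
    ultimately show ?thesis using G unfolding gn_good_def
      by (intro add_mono mult_left_mono) (auto intro!: mult_left_mono)
  qed
  finally have "(vnorm n d)\<^sup>2 \<le> (18448 * (V * W)\<^sup>2 + 4612 * (H * H)\<^sup>2) * 128 / W\<^sup>2"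
    using W0 by (simp add: field_simps)
  also have "\<dots> = 2361344 * V\<^sup>2 + 590336 * ((H * H) / W)\<^sup>2"
    using W0 by (simp add: power_mult_distrib power_divide field_simps)
  also have "\<dots> \<le> 2361344 * V\<^sup>2 + 590336 * ((H * H) / (X / 2))\<^sup>2"
    using WX X0 W0 by (intro add_left_mono mult_left_mono power_mono divide_left_mono) (auto simp: H_def)
  also have "\<dots> = 2361344 * (V\<^sup>2 + ((H * H) / X)\<^sup>2)" by (simp add: power_mult_distrib power_divide)
  \<comment> \<open>2361344 = 8 * 2306 * 128 is rounded up to the square of 1600. One further
    \<open>V\<close>, from \<open>x1\<close> to \<open>x\<close>, makes it 1601.\<close>
  also have "\<dots> \<le> (1600 * (V + (H * H) / X))\<^sup>2"
  proof -
    have "0 \<le> V * ((H * H) / X)" using X0 by (simp add: V_def H_def)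
    then have "V\<^sup>2 + ((H * H) / X)\<^sup>2 \<le> (V + (H * H) / X)\<^sup>2" by (simp add: power2_sum)
    then have "2361344 * (V\<^sup>2 + ((H * H) / X)\<^sup>2) \<le> 2560000 * (V + (H * H) / X)\<^sup>2"
      by (intro mult_mono) auto
    moreover have "(1600 * (V + (H * H) / X))\<^sup>2 = 2560000 * (V + (H * H) / X)\<^sup>2"
      by (simp only: power_mult_distrib) simp
    ultimately show ?thesis by (simp only:)
  qed
  finally have dd: "vnorm n d \<le> 1600 * (V + (H * H) / X)"
    by (rule power2_le_imp_le) (use X0 in \<open>simp add: V_def H_def\<close>)
  have "vnorm n (\<lambda>i. z i - x i) \<le> vnorm n d + vnorm n (off x S)"
    using vnorm_triangle_diff[of n d "off x S"] unfolding d_def xx1[symmetric] by simp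
  also have "\<dots> \<le> 1601 * (V + (H * H) / X)"
  proof -
    have "0 \<le> (H * H) / X" using X0 by simp
    then show ?thesis using dd unfolding V_def[symmetric] by (simp add: distrib_left)
  qed
  finally show ?thesis by (simp add: V_def H_def X_def power2_eq_square)
qed

subsection \<open>Measurability of the iterates\<close>

text \<open>The minimizer is expressed by countable infima: with \<open>\<kappa>\<close> a lower bound for the curvature
  of the least-squares objective \<open>f\<close>, the \<open>i\<close>-th entry of its minimizer is the infimum of
  \<open>r i + sqrt ((f r - inf f) / \<kappa>)\<close> over a countable dense set of vectors \<open>r\<close>.\<close>

definition ratvec :: "nat \<Rightarrow> nat set \<Rightarrow> nat \<times> int list \<Rightarrow> nat \<Rightarrow> real" where
  "ratvec n S r = (\<lambda>i. if i < n \<and> i \<in> S \<and> i < length (snd r) then real_of_int (snd r ! i) / real (fst r) else 0)"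

text \<open>The infimum is taken in \<open>ereal\<close>, where it exists for all data and countable
  infima of measurable functions are measurable. The result is meaningful on the data for which the
  curvature bound holds.\<close>

definition gn_inf ::
  "nat \<Rightarrow> nat \<Rightarrow> (nat \<Rightarrow> real) \<Rightarrow> nat set \<Rightarrow> (nat \<Rightarrow> nat \<Rightarrow> complex) \<Rightarrow> (nat \<Rightarrow> real) \<Rightarrow> real" where
  "gn_inf n m x S a w = real_of_ereal (INF r. ereal (gn_obj n m x a w (ratvec n S r)))"

definition gn_sol ::
  "nat \<Rightarrow> nat \<Rightarrow> (nat \<Rightarrow> real) \<Rightarrow> nat set \<Rightarrow> (nat \<Rightarrow> nat \<Rightarrow> complex) \<Rightarrow> (nat \<Rightarrow> real) \<Rightarrow> nat \<Rightarrow> real" where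
  "gn_sol n m x S a w = (\<lambda>i. real_of_ereal (INF r. ereal (ratvec n S r i +
     sqrt ((gn_obj n m x a w (ratvec n S r) - gn_inf n m x S a w) / ((vnorm n w)\<^sup>2 / 128)))))"

lemma ratvec_coord_space: "ratvec n S r \<in> coord_space n S"
  by (auto simp: ratvec_def coord_space_def Rn_def supp_def)

lemma ratvec_dense:
  assumes z: "z \<in> coord_space n S"
  obtains r where "\<And>i. (\<lambda>N. ratvec n S (r N) i) \<longlonglongrightarrow> z i"
proof
  define r where "r N = (N, map (\<lambda>i. \<lfloor>real N * z i\<rfloor>) [0..<n])" for N :: nat
  fix i
  show "(\<lambda>N. ratvec n S (r N) i) \<longlonglongrightarrow> z i"
  proof (cases "i < n \<and> i \<in> S")
    case False
    then have "z i = 0" using z by (auto simp: coord_space_def Rn_def supp_def)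
    moreover have "ratvec n S (r N) i = 0" for N using False by (auto simp: ratvec_def)
    ultimately show ?thesis by simp
  next
    case True
    then have eq: "ratvec n S (r N) i = real_of_int \<lfloor>real N * z i\<rfloor> / N" for N
      by (simp add: ratvec_def r_def)
    show ?thesis unfolding eq
    proof (rule tendsto_sandwich)
      show "(\<lambda>N. z i - 1 / real N) \<longlonglongrightarrow> z i"
        using tendsto_diff[OF tendsto_const lim_1_over_n, of "z i"] by simp
      show "(\<lambda>N. z i) \<longlonglongrightarrow> z i" by simp
      show "\<forall>\<^sub>F N in sequentially. z i - 1 / real N \<le> real_of_int \<lfloor>real N * z i\<rfloor> / N"
        using eventually_gt_at_top[of 0]
      proof eventually_elim
        case (elim N)
        have "real N * z i - 1 \<le> real_of_int \<lfloor>real N * z i\<rfloor>" by linarith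
        then have "(real N * z i - 1) / N \<le> real_of_int \<lfloor>real N * z i\<rfloor> / N" by (intro divide_right_mono) auto
        then show ?case using elim by (simp add: diff_divide_distrib)
      qed
      show "\<forall>\<^sub>F N in sequentially. real_of_int \<lfloor>real N * z i\<rfloor> / N \<le> z i"
        using eventually_gt_at_top[of 0]
      proof eventually_elim
        case (elim N)
        have "real_of_int \<lfloor>real N * z i\<rfloor> \<le> real N * z i" by linarith
        then show ?case using elim by (simp add: field_simps)
      qed
    qed
  qed
qed

lemma INF_ereal_eqI:
  fixes f :: "'a \<Rightarrow> real"
  assumes "\<And>r. c \<le> f r" and lim: "(\<lambda>N. f (r N)) \<longlonglongrightarrow> c"
  shows "(INF r. ereal (f r)) = ereal c"
proof (rule antisym)
  have l: "(\<lambda>N. ereal (f (r N))) \<longlonglongrightarrow> ereal c" using lim by simp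
  show "(INF r. ereal (f r)) \<le> ereal c"
    by (rule LIMSEQ_le_const[OF l]) (auto intro: INF_lower)
  show "ereal c \<le> (INF r. ereal (f r))" using assms(1) by (intro INF_greatest) auto
qed

text \<open>Pythagoras and curvature bound the distance of any admissible \<open>r\<close> from the
  minimizer \<open>z\<close> by the square root term, so every candidate is at least
  \<open>z i\<close>. Along rational vectors tending to \<open>z\<close> that term vanishes, so the
  infimum is \<open>z i\<close>.\<close>

lemma gn_sol_eq:
  assumes w: "vnorm n w \<noteq> 0"
    and low: "\<And>d. d \<in> coord_space n S \<Longrightarrow> (vnorm n w)\<^sup>2 / 128 * (vnorm n d)\<^sup>2 \<le> avg m (\<lambda>j. (bf n w d (a j))\<^sup>2)"
  shows "gn_sol n m x S a w = gauss_newton n m S a (measurements n a x) w"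
proof -
  define z where "z = gauss_newton n m S a (measurements n a x) w"
  let ?f = "gn_obj n m x a w" and ?k = "(vnorm n w)\<^sup>2 / 128"
  have k: "0 < ?k" using w by simp
  have z: "z \<in> coord_space n S" "\<And>y. y \<in> coord_space n S \<Longrightarrow>
      ?f y = ?f z + avg m (\<lambda>j. (bf n w (\<lambda>i. y i - z i) (a j))\<^sup>2)"
    unfolding z_def by (rule gn_minimizer[OF k], erule low, assumption?)+
  obtain r where r: "\<And>i. (\<lambda>N. ratvec n S (r N) i) \<longlonglongrightarrow> z i" using ratvec_dense[OF z(1)] by blast
  have fr: "(\<lambda>N. ?f (ratvec n S (r N))) \<longlonglongrightarrow> ?f z"
    unfolding gn_obj_def avg_def bf_def ar_def ai_def divide_inverse
    by (intro tendsto_intros r)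
  have ge: "?k * (vnorm n (\<lambda>i. ratvec n S r i - z i))\<^sup>2 \<le> ?f (ratvec n S r) - ?f z" for r
    using low[OF coord_space_closed(2)[OF ratvec_coord_space z(1)]] z(2)[OF ratvec_coord_space[of n S r]] by simp
  have "?f z \<le> ?f (ratvec n S r)" for r using ge[of r] k by (smt (verit) mult_nonneg_nonneg zero_le_power2)
  then have inf: "gn_inf n m x S a w = ?f z"
    unfolding gn_inf_def using INF_ereal_eqI[of "?f z" "\<lambda>r. ?f (ratvec n S r)" r] fr by simp
  have "gn_sol n m x S a w i = z i" for i
  proof -
    let ?g = "\<lambda>r. ratvec n S r i + sqrt ((?f (ratvec n S r) - ?f z) / ?k)"
    have lo: "z i \<le> ?g r" for r
    proof -
      have "\<bar>ratvec n S r i - z i\<bar> \<le> vnorm n (\<lambda>i. ratvec n S r i - z i)"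
      proof (cases "i < n")
        case False
        then have "z i = 0" "ratvec n S r i = 0" using z(1) by (auto simp: coord_space_def Rn_def ratvec_def)
        then show ?thesis by simp
      qed (rule abs_le_vnorm)
      also have "\<dots> = sqrt ((vnorm n (\<lambda>i. ratvec n S r i - z i))\<^sup>2)" by simp
      also have "\<dots> \<le> sqrt ((?f (ratvec n S r) - ?f z) / ?k)"
        using ge[of r] k by (intro real_sqrt_le_mono) (simp only: pos_le_divide_eq mult.commute)
      finally show ?thesis by linarith
    qed
    have "(\<lambda>N. ?g (r N)) \<longlonglongrightarrow> z i + sqrt ((?f z - ?f z) / ?k)"
      unfolding divide_inverse by (intro tendsto_intros r fr)
    then have "(\<lambda>N. ?g (r N)) \<longlonglongrightarrow> z i" by simp
    from INF_ereal_eqI[of "z i" ?g, OF lo this] show ?thesis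
      unfolding gn_sol_def inf by simp
  qed
  then show ?thesis unfolding z_def by blast
qed

text \<open>Measurability is asked entry by entry below \<open>n\<close>, since nothing else
  influences the algorithm; no sigma-algebra on \<open>nat \<Rightarrow> real\<close> has to be
  fixed.\<close>

definition coord_measurable :: "nat \<Rightarrow> 'a measure \<Rightarrow> ('a \<Rightarrow> nat \<Rightarrow> real) \<Rightarrow> bool" where
  "coord_measurable n M p \<longleftrightarrow> (\<forall>i<n. (\<lambda>\<omega>. p \<omega> i) \<in> borel_measurable M)"

definition data_measurable :: "nat \<Rightarrow> nat \<Rightarrow> 'a measure \<Rightarrow> ('a \<Rightarrow> nat \<Rightarrow> nat \<Rightarrow> complex) \<Rightarrow> bool" where
  "data_measurable n m M a \<longleftrightarrow> (\<forall>j<m. \<forall>i<n. (\<lambda>\<omega>. a \<omega> j i) \<in> borel_measurable M)"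

lemma coord_measurable_const: "coord_measurable n M (\<lambda>_. p)"
  by (simp add: coord_measurable_def)

lemma coord_measurable_diff:
  "coord_measurable n M p \<Longrightarrow> coord_measurable n M q \<Longrightarrow> coord_measurable n M (\<lambda>\<omega> i. p \<omega> i - q \<omega> i)"
  by (auto simp: coord_measurable_def intro!: borel_measurable_diff)

lemma vnorm_measurable:
  "coord_measurable n M p \<Longrightarrow> (\<lambda>\<omega>. vnorm n (p \<omega>)) \<in> borel_measurable M"
  unfolding coord_measurable_def vnorm_def L2_set_def
  by (intro borel_measurable_sqrt[THEN measurable_compose_rev] measurable_compose[OF _ borel_measurable_sqrt] borel_measurable_sum borel_measurable_power) auto

lemma nrm_measurable:
  "coord_measurable n M p \<Longrightarrow> coord_measurable n M (\<lambda>\<omega>. nrm n (p \<omega>))"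
  using vnorm_measurable[of n M p] by (auto simp: coord_measurable_def nrm_def)

lemma bf_measurable_data:
  assumes "coord_measurable n M p" "coord_measurable n M q" "data_measurable n m M a" "j < m"
  shows "(\<lambda>\<omega>. bf n (p \<omega>) (q \<omega>) (a \<omega> j)) \<in> borel_measurable M"
proof -
  have re: "(\<lambda>\<omega>. Re (a \<omega> j i)) \<in> borel_measurable M" "(\<lambda>\<omega>. Im (a \<omega> j i)) \<in> borel_measurable M" if "i < n" for i
    using assms(3,4) that unfolding data_measurable_def by (auto intro!: measurable_compose[OF _ borel_measurable_Re] measurable_compose[OF _ borel_measurable_Im])
  show ?thesis
    unfolding bf_def ar_def ai_def using assms(1,2) re unfolding coord_measurable_def
    by (intro borel_measurable_add borel_measurable_times borel_measurable_sum) auto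
qed

lemma avg_measurable:
  assumes "\<And>j. j < m \<Longrightarrow> (\<lambda>\<omega>. f \<omega> j) \<in> borel_measurable M"
  shows "(\<lambda>\<omega>. avg m (f \<omega>)) \<in> borel_measurable M"
  unfolding avg_def using assms by (intro borel_measurable_divide borel_measurable_sum) auto

lemma gn_obj_measurable:
  assumes "coord_measurable n M w" "data_measurable n m M a"
  shows "(\<lambda>\<omega>. gn_obj n m x (a \<omega>) (w \<omega>) z) \<in> borel_measurable M"
  unfolding gn_obj_def
  by (intro avg_measurable borel_measurable_power borel_measurable_diff borel_measurable_divide
      borel_measurable_const bf_measurable_data[where m = m] coord_measurable_diff coord_measurable_const assms)

lemma gn_inf_measurable:
  assumes "coord_measurable n M w" "data_measurable n m M a"
  shows "(\<lambda>\<omega>. gn_inf n m x S (a \<omega>) (w \<omega>)) \<in> borel_measurable M"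
  unfolding gn_inf_def
  by (intro borel_measurable_real_of_ereal borel_measurable_INF borel_measurable_ereal gn_obj_measurable assms) auto

lemma gn_sol_measurable:
  assumes "coord_measurable n M w" "data_measurable n m M a"
  shows "coord_measurable n M (\<lambda>\<omega>. gn_sol n m x S (a \<omega>) (w \<omega>))"
proof -
  note [measurable] = gn_inf_measurable[OF assms, of x S] vnorm_measurable[OF assms(1)] gn_obj_measurable[OF assms]
  show ?thesis
    unfolding coord_measurable_def gn_sol_def
    by (intro allI impI borel_measurable_real_of_ereal borel_measurable_INF borel_measurable_ereal) (auto, measurable)
qed

lemma gn_good_measurable:
  assumes w: "coord_measurable n M w" and a: "data_measurable n m M a"
  shows "Measurable.pred M (\<lambda>\<omega>. gn_good n k m x S (w \<omega>) (a \<omega>))"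
proof -
  note b = bf_measurable_data[OF _ _ a] and c = coord_measurable_const and nw = nrm_measurable[OF w]
  have 1 [measurable]: "(\<lambda>\<omega>. avg m (\<lambda>j. bf n u u (a \<omega> j))) \<in> borel_measurable M" for u
    by (intro avg_measurable b c)
  have 2 [measurable]: "(\<lambda>\<omega>. avg m (\<lambda>j. trunc n (w \<omega>) u (a \<omega> j))) \<in> borel_measurable M" for u
  proof (rule avg_measurable)
    fix j assume j: "j < m"
    note [measurable] = b[OF nw nw j] b[OF nw c j]
    show "(\<lambda>\<omega>. trunc n (w \<omega>) u (a \<omega> j)) \<in> borel_measurable M" unfolding trunc_def by measurable
  qed
  have 3 [measurable]: "(\<lambda>\<omega>. avg m (\<lambda>j. (bf n (nrm n (off x S)) (nrm n (w \<omega>)) (a \<omega> j))\<^sup>2)) \<in> borel_measurable M"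
    by (intro avg_measurable borel_measurable_power b c nw)
  have 4 [measurable]: "(\<lambda>\<omega>. avg m (\<lambda>j. (bf n (nrm n (\<lambda>i. w \<omega> i - x i)) (nrm n (\<lambda>i. w \<omega> i - x i)) (a \<omega> j))\<^sup>2)) \<in> borel_measurable M"
    by (intro avg_measurable borel_measurable_power b nrm_measurable coord_measurable_diff c w)
  show ?thesis unfolding gn_good_def rip_net_def using finite_net[of n k] by measurable
qed

lemma hard_threshold_measurable:
  assumes v: "coord_measurable n M v"
  shows "coord_measurable n M (\<lambda>\<omega>. hard_threshold n s (v \<omega>))"
  unfolding coord_measurable_def
proof (intro allI impI)
  fix i assume i: "i < n"
  have [measurable]: "(\<lambda>\<omega>. v \<omega> i) \<in> borel_measurable M" if "i < n" for i
    using v that by (auto simp: coord_measurable_def)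
  \<comment> \<open>The rank of \<open>i\<close> as a finite sum of indicators: selection of
    \<open>i\<close> becomes a measurable inequality.\<close>
  define c where "c \<omega> = (\<Sum>j<n. if \<bar>v \<omega> i\<bar> < \<bar>v \<omega> j\<bar> \<or> (\<bar>v \<omega> j\<bar> = \<bar>v \<omega> i\<bar> \<and> j < i) then 1 else 0 :: real)" for \<omega>
  have "(\<lambda>\<omega>. c \<omega>) \<in> borel_measurable M"
    unfolding c_def
  proof (rule borel_measurable_sum)
    fix j assume "j \<in> {..<n}"
    then have [measurable]: "(\<lambda>\<omega>. v \<omega> j) \<in> borel_measurable M" "(\<lambda>\<omega>. v \<omega> i) \<in> borel_measurable M"
      using v i by (auto simp: coord_measurable_def)
    show "(\<lambda>\<omega>. if \<bar>v \<omega> i\<bar> < \<bar>v \<omega> j\<bar> \<or> (\<bar>v \<omega> j\<bar> = \<bar>v \<omega> i\<bar> \<and> j < i) then 1 else 0 :: real) \<in> borel_measurable M"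
      by measurable
  qed
  moreover have "i \<in> top_entries n s (v \<omega>) \<longleftrightarrow> c \<omega> < real s" for \<omega>
  proof -
    have "c \<omega> = real (card {j \<in> {..<n}. \<bar>v \<omega> i\<bar> < \<bar>v \<omega> j\<bar> \<or> (\<bar>v \<omega> j\<bar> = \<bar>v \<omega> i\<bar> \<and> j < i)})"
      unfolding c_def by (subst sum.inter_filter[symmetric]) auto
    then show ?thesis using i by (simp add: top_entries_def)
  qed
  moreover have "(\<lambda>\<omega>. v \<omega> i) \<in> borel_measurable M" using v i by (auto simp: coord_measurable_def)
  ultimately show "(\<lambda>\<omega>. hard_threshold n s (v \<omega>) i) \<in> borel_measurable M"
    unfolding hard_threshold_def by simp
qed

lemma ht_step_measurable:
  assumes a: "data_measurable n m M a"
  shows "coord_measurable n M (\<lambda>\<omega>. ht_step n m s \<mu> x (a \<omega>) z)"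
  unfolding ht_step_def
proof (rule hard_threshold_measurable, unfold coord_measurable_def, intro allI impI)
  fix i assume i: "i < n"
  note b = bf_measurable_data[OF coord_measurable_const coord_measurable_const a]
  show "(\<lambda>\<omega>. z i - \<mu> * gradient n (loss n m (a \<omega>) (measurements n (a \<omega>) x)) z i) \<in> borel_measurable M"
    unfolding gradient_loss[OF i]
    by (intro borel_measurable_diff borel_measurable_times borel_measurable_const avg_measurable b)
qed

subsection \<open>Resampling\<close>

text \<open>Fubini with one coordinate integrated first. This is how freshness of a block is
  exploited: with all other blocks frozen, the iterate and the support are deterministic.\<close>

lemma prob_PiM_le:
  assumes ps: "\<And>i. prob_space (M i)" and I: "finite I" "i \<in> I"
    and B: "B \<in> sets (Pi\<^sub>M I M)"
    and le: "\<And>\<omega>. \<omega> \<in> space (Pi\<^sub>M (I - {i}) M) \<Longrightarrow> measure (M i) {y \<in> space (M i). fun_upd \<omega> i y \<in> B} \<le> p"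
    and p: "0 \<le> p"
  shows "measure (Pi\<^sub>M I M) B \<le> p"
proof -
  interpret P: product_prob_space M by (intro product_prob_space.intro product_sigma_finite.intro product_prob_space_axioms.intro ps prob_space_imp_sigma_finite)
  have ins: "insert i (I - {i}) = I" using I by auto
  have "emeasure (Pi\<^sub>M I M) B = (\<integral>\<^sup>+\<omega>. indicator B \<omega> \<partial>Pi\<^sub>M (insert i (I - {i})) M)"
    unfolding ins using B by simp
  also have "\<dots> = (\<integral>\<^sup>+\<omega>. (\<integral>\<^sup>+y. indicator B (fun_upd \<omega> i y) \<partial>M i) \<partial>Pi\<^sub>M (I - {i}) M)"
    by (rule P.product_nn_integral_insert) (use I B in \<open>auto simp: insert_absorb\<close>)
  also have "\<dots> \<le> (\<integral>\<^sup>+\<omega>. ennreal p \<partial>Pi\<^sub>M (I - {i}) M)"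
  proof (rule nn_integral_mono)
    fix \<omega> assume \<omega>: "\<omega> \<in> space (Pi\<^sub>M (I - {i}) M)"
    have "(\<lambda>y. fun_upd \<omega> i y) \<in> measurable (M i) (Pi\<^sub>M (insert i (I - {i})) M)"
      using \<omega> by (intro measurable_component_update) auto
    then have "(\<lambda>y. fun_upd \<omega> i y) \<in> measurable (M i) (Pi\<^sub>M I M)" unfolding ins .
    then have s: "{y \<in> space (M i). fun_upd \<omega> i y \<in> B} \<in> sets (M i)"
      using measurable_sets[OF _ B] by (simp add: vimage_def Int_def conj_commute)
    have "(\<integral>\<^sup>+y. indicator B (fun_upd \<omega> i y) \<partial>M i) = (\<integral>\<^sup>+y. indicator {y \<in> space (M i). fun_upd \<omega> i y \<in> B} y \<partial>M i)"
      by (intro nn_integral_cong) (auto simp: indicator_def)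
    also have "\<dots> = ennreal (measure (M i) {y \<in> space (M i). fun_upd \<omega> i y \<in> B})"
      using s by (simp add: finite_measure.emeasure_eq_measure[OF prob_space.finite_measure[OF ps]])
    also have "\<dots> \<le> ennreal p" by (intro ennreal_leI le \<omega>)
    finally show "(\<integral>\<^sup>+y. indicator B (fun_upd \<omega> i y) \<partial>M i) \<le> ennreal p" .
  qed
  also have "\<dots> = ennreal p" by (simp add: prob_space.emeasure_space_1[OF prob_space_PiM[OF ps]])
  finally show ?thesis using p by (simp add: finite_measure.emeasure_eq_measure[OF prob_space.finite_measure[OF prob_space_PiM[OF ps]]])
qed

lemma resampled_data_block: "resampled_data n m L = (\<Pi>\<^sub>M t\<in>{..L}. block n m)"
  by (simp add: resampled_data_def block_def)

lemma data_measurable_resampled: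
  assumes "t \<le> L"
  shows "data_measurable n m (resampled_data n m L) (\<lambda>\<omega>. \<omega> t)"
  unfolding data_measurable_def
proof (intro allI impI)
  fix j i assume ji: "j < m" "i < n"
  have 1: "(\<lambda>\<omega>. \<omega> t) \<in> measurable (resampled_data n m L) (block n m)"
    unfolding resampled_data_block using assms by (intro measurable_component_singleton) auto
  have 2: "(\<lambda>a. a j) \<in> measurable (block n m) (complex_gaussian n)"
    unfolding block_def using ji by (intro measurable_component_singleton) auto
  have 3: "(\<lambda>b. b i) \<in> measurable (complex_gaussian n) borel"
    unfolding measurable_cong_sets[OF sets_complex_gaussian refl] using ji by (intro measurable_component_singleton) auto
  show "(\<lambda>\<omega>. \<omega> t j i) \<in> borel_measurable (resampled_data n m L)"
    using measurable_compose[OF measurable_compose[OF 1 2] 3] .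
qed

text \<open>The inner iteration with \<open>gn_sol\<close> in place of the chosen minimizer and with
  the support as a parameter. For a fixed \<open>S\<close> it is measurable in the data; the random
  support is restored by splitting over its finitely many values.\<close>

primrec gn_chain ::
  "nat \<Rightarrow> nat \<Rightarrow> (nat \<Rightarrow> real) \<Rightarrow> nat set \<Rightarrow> (nat \<Rightarrow> nat \<Rightarrow> nat \<Rightarrow> complex) \<Rightarrow> (nat \<Rightarrow> real) \<Rightarrow> nat \<Rightarrow> nat \<Rightarrow> real" where
  "gn_chain n m x S \<omega> u 0 = u"
| "gn_chain n m x S \<omega> u (Suc l) = gn_sol n m x S (\<omega> (Suc l)) (gn_chain n m x S \<omega> u l)"

lemma gn_chain_measurable:
  assumes u: "coord_measurable n (resampled_data n m L) u" and "l \<le> L"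
  shows "coord_measurable n (resampled_data n m L) (\<lambda>\<omega>. gn_chain n m x S \<omega> (u \<omega>) l)"
  using assms(2) by (induction l) (auto intro!: u gn_sol_measurable data_measurable_resampled)

text \<open>Iterate \<open>l\<close> uses the blocks 1 to \<open>l\<close>, and the start uses block
  0, so block \<open>Suc l\<close> is still fresh when the next step is taken.\<close>

lemma gn_chain_cong:
  assumes "\<And>t. 1 \<le> t \<Longrightarrow> t \<le> l \<Longrightarrow> \<omega> t = \<omega>' t"
  shows "gn_chain n m x S \<omega> u l = gn_chain n m x S \<omega>' u l"
  using assms by (induction l) auto

text \<open>The good event is assumed only for iterates within half the norm of \<open>x\<close>,
  and the induction provides this closeness from the bound by five times the initial error. The same
  induction has to carry the equality with \<open>gn_chain\<close>, because \<open>gn_sol_eq\<close>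
  needs the curvature at the current iterate.\<close>

lemma outer_step_error:
  assumes x: "x \<in> Rn n" "0 < vnorm n x" and s: "1 \<le> s" "s \<le> n"
    and h: "vnorm n (\<lambda>i. z i - x i) \<le> 1 / 2560000 * vnorm n x"
    and u: "ht_good n s (1 / 10000) x z u"
    and G: "\<And>l. l < L \<Longrightarrow> vnorm n (\<lambda>i. gn_chain n m x (supp u) \<omega> u l i - x i) \<le> vnorm n x / 2 \<Longrightarrow>
      gn_good n (min (2 * s) n) m x (supp u) (gn_chain n m x (supp u) \<omega> u l) (\<omega> (Suc l))"
    and l: "l \<le> L"
  shows "gn_chain n m x (supp u) \<omega> u l = inner_iterate n m x \<omega> u l \<and>
    vnorm n (\<lambda>i. inner_iterate n m x \<omega> u l i - x i) \<le> 5 * vnorm n (\<lambda>i. z i - x i) \<and>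
    (1 \<le> l \<longrightarrow> vnorm n (\<lambda>i. inner_iterate n m x \<omega> u l i - x i) \<le>
      1601 * (vnorm n (off x (supp u)) + 25 * (vnorm n (\<lambda>i. z i - x i))\<^sup>2 / vnorm n x))"
  using l
proof (induction l)
  case 0
  show ?case using u by (simp add: ht_good_def)
next
  case (Suc l)
  define X where "X = vnorm n x"
  define H where "H = vnorm n (\<lambda>i. z i - x i)"
  define S where "S = supp u"
  define V where "V = vnorm n (off x S)"
  let ?w = "inner_iterate n m x \<omega> u l"
  define W where "W = vnorm n (\<lambda>i. ?w i - x i)"
  have X0: "0 < X" using x by (simp add: X_def)
  have H0: "0 \<le> H" by (simp add: H_def)
  have HX: "H \<le> 1 / 2560000 * X" using h by (simp add: H_def X_def)
  have IH: "gn_chain n m x S \<omega> u l = ?w" "W \<le> 5 * H" using Suc by (auto simp: W_def H_def S_def)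
  have WX: "W \<le> X / 2" using IH(2) HX X0 by linarith
  have uR: "u \<in> Rn n" "card S \<le> s" and V: "V \<le> 1 / 10000 * H" using u by (auto simp: ht_good_def S_def V_def H_def)
  have Sn: "S \<subseteq> {..<n}" unfolding S_def by (rule supp_Rn[OF uR(1)])
  then have fS: "finite S" by (rule finite_subset) simp
  have cS: "card S \<le> min (2 * s) n" using uR(2) card_mono[OF _ Sn] by simp
  have k1: "1 \<le> min (2 * s) n" using s by simp
  have good: "gn_good n (min (2 * s) n) m x S ?w (\<omega> (Suc l))"
    using G[of l] Suc.prems WX IH(1) by (simp add: S_def W_def X_def)
  have w0: "vnorm n ?w \<noteq> 0"
  proof -
    have "X \<le> vnorm n ?w + W" using vnorm_triangle_diff[of n ?w "\<lambda>i. ?w i - x i"] by (simp add: X_def W_def)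
    then show ?thesis using WX X0 by linarith
  qed
  have "gn_sol n m x S (\<omega> (Suc l)) ?w = gauss_newton n m S (\<omega> (Suc l)) (measurements n (\<omega> (Suc l)) x) ?w"
  proof (rule gn_sol_eq[OF w0])
    fix d assume d: "d \<in> coord_space n S"
    then have "card (supp d) \<le> min (2 * s) n"
      using cS card_mono[OF fS, of "supp d"] by (auto simp: coord_space_def)
    then show "(vnorm n ?w)\<^sup>2 / 128 * (vnorm n d)\<^sup>2 \<le> avg m (\<lambda>j. (bf n ?w d (\<omega> (Suc l) j))\<^sup>2)"
      using d by (intro gn_lower_bound[OF good k1]) (auto simp: coord_space_def)
  qed
  then have eq: "gn_chain n m x S \<omega> u (Suc l) = inner_iterate n m x \<omega> u (Suc l)"
    by (simp add: IH(1)) (simp add: S_def)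
  have W0: "0 \<le> W" by (simp add: W_def)
  have "vnorm n (\<lambda>i. inner_iterate n m x \<omega> u (Suc l) i - x i) \<le> 1601 * (V + W\<^sup>2 / X)"
    using gn_error[OF good k1 fS cS x(1,2)] WX by (simp add: V_def W_def X_def S_def)
  also have "\<dots> \<le> 1601 * (V + 25 * H\<^sup>2 / X)"
  proof -
    have "W\<^sup>2 \<le> (5 * H)\<^sup>2" using IH(2) W0 by (intro power_mono) auto
    then have "W\<^sup>2 / X \<le> 25 * H\<^sup>2 / X" using X0 by (intro divide_right_mono) (auto simp: power_mult_distrib)
    then show ?thesis by simp
  qed
  finally have E: "vnorm n (\<lambda>i. inner_iterate n m x \<omega> u (Suc l) i - x i) \<le> 1601 * (V + 25 * H\<^sup>2 / X)" .
  \<comment> \<open>1601 * (1/10000 + 25/2560000) is below 1/5.\<close>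
  also have "\<dots> \<le> 5 * H"
  proof -
    have "H\<^sup>2 \<le> H * (1 / 2560000 * X)" unfolding power2_eq_square using HX H0 by (intro mult_left_mono) auto
    then have "25 * H\<^sup>2 / X \<le> 25 * (H * (1 / 2560000 * X)) / X" using X0 by (intro divide_right_mono mult_left_mono) auto
    also have "\<dots> = 25 / 2560000 * H" using X0 by simp
    finally have t: "25 * H\<^sup>2 / X \<le> 25 / 2560000 * H" .
    have "1601 * (V + t) \<le> 5 * H" if "t \<le> 25 / 2560000 * H" for t
      using that V H0 by (simp add: distrib_left)
    then show ?thesis using t by blast
  qed
  finally show ?case using E eq by (simp add: X_def H_def V_def S_def)
qed

text \<open>Each inner step fails with probability at most \<open>gn_const / m\<close> whatever
  happened before, so a plain union bound over the steps suffices.\<close>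

lemma outer_step_prob:
  assumes x: "0 < vnorm n x" and s: "1 \<le> s" "s \<le> n"
    and m: "gn_const * sparse_size n k \<le> real m" and k: "1 \<le> k" "k \<le> n"
    and HT: "with_prob_ge (block n m) (1 - C / m) (\<lambda>a. ht_good n s \<epsilon> x z (ht_step n m s \<mu> x a z))"
  shows "with_prob_ge (resampled_data n m L) (1 - (C + L * gn_const) / m) (\<lambda>\<omega>.
    let u = ht_step n m s \<mu> x (\<omega> 0) z in ht_good n s \<epsilon> x z u \<and>
    (\<forall>l<L. vnorm n (\<lambda>i. gn_chain n m x (supp u) \<omega> u l i - x i) \<le> vnorm n x / 2 \<longrightarrow>
      gn_good n k m x (supp u) (gn_chain n m x (supp u) \<omega> u l) (\<omega> (Suc l))))"
proof -
  let ?M = "resampled_data n m L"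
  have psM: "prob_space ?M" unfolding resampled_data_block by (intro prob_space_PiM prob_space_block)
  interpret M: prob_space ?M by (rule psM)
  obtain A0 where A0: "A0 \<in> sets (block n m)" "1 - C / m \<le> measure (block n m) A0"
    "\<And>a. a \<in> A0 \<Longrightarrow> ht_good n s \<epsilon> x z (ht_step n m s \<mu> x a z)"
    using HT by (auto simp: with_prob_ge_def)
  define u where "u \<omega> = ht_step n m s \<mu> x (\<omega> 0) z" for \<omega> :: "nat \<Rightarrow> nat \<Rightarrow> nat \<Rightarrow> complex"
  have cu: "coord_measurable n ?M u"
    unfolding u_def by (intro ht_step_measurable data_measurable_resampled) simp
  have comp: "(\<lambda>\<omega>. \<omega> 0) \<in> measurable ?M (block n m)"
    unfolding resampled_data_block by (intro measurable_component_singleton) auto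
  define E where "E = {\<omega> \<in> space ?M. \<omega> 0 \<in> A0}"
  have Es: "E \<in> sets ?M" unfolding E_def using measurable_sets[OF comp A0(1)] by (simp add: vimage_def Int_def conj_commute)
  have "distr ?M (block n m) (\<lambda>\<omega>. \<omega> 0) = block n m"
    unfolding resampled_data_block by (intro distr_PiM_component prob_space_block) auto
  then have "measure (block n m) A0 = measure ?M ((\<lambda>\<omega>. \<omega> 0) -` A0 \<inter> space ?M)"
    using measure_distr[OF comp A0(1)] by simp
  also have "(\<lambda>\<omega>. \<omega> 0) -` A0 \<inter> space ?M = E" by (auto simp: E_def)
  finally have PE: "1 - C / m \<le> measure ?M E" using A0(2) by simp
  define W where "W S \<omega> l = gn_chain n m x S \<omega> (u \<omega>) l" for S \<omega> l
  \<comment> \<open>Closeness to \<open>x\<close> is built into the failure event, so no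
    conditioning on the success of earlier steps is required. It also guarantees
    \<open>w \<noteq> 0\<close>, which \<open>gn_good_prob\<close> assumes.\<close>
  define P where "P S l \<omega> \<longleftrightarrow> vnorm n (\<lambda>i. W S \<omega> l i - x i) \<le> vnorm n x / 2 \<and>
      \<not> gn_good n k m x S (W S \<omega> l) (\<omega> (Suc l))" for S l \<omega>
  define B where "B l = {\<omega> \<in> space ?M. supp (u \<omega>) \<subseteq> {..<n} \<and> P (supp (u \<omega>)) l \<omega>}" for l
  have un: "supp (u \<omega>) \<subseteq> {..<n}" for \<omega>
    by (auto simp: u_def ht_step_def hard_threshold_def supp_def top_entries_def split: if_splits)
  have Pm: "Measurable.pred ?M (P S l)" if "l < L" for S l
  proof -
    have w: "coord_measurable n ?M (\<lambda>\<omega>. W S \<omega> l)" unfolding W_def using that by (intro gn_chain_measurable cu) auto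
    have d: "data_measurable n m ?M (\<lambda>\<omega>. \<omega> (Suc l))" using that by (intro data_measurable_resampled) auto
    note [measurable] = gn_good_measurable[OF w d, of k x S] vnorm_measurable[OF coord_measurable_diff[OF w coord_measurable_const[of n ?M x]]]
    show ?thesis unfolding P_def by measurable
  qed
  have Sm: "Measurable.pred ?M (\<lambda>\<omega>. supp (u \<omega>) = S)" for S
  proof (cases "S \<subseteq> {..<n}")
    case True
    have "supp (u \<omega>) = S \<longleftrightarrow> (\<forall>i\<in>{..<n}. u \<omega> i \<noteq> 0 \<longleftrightarrow> i \<in> S)" for \<omega>
      using un[of \<omega>] True by (auto simp: supp_def)
    moreover have "Measurable.pred ?M (\<lambda>\<omega>. u \<omega> i \<noteq> 0 \<longleftrightarrow> i \<in> S)" if "i \<in> {..<n}" for i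
    proof -
      have [measurable]: "(\<lambda>\<omega>. u \<omega> i) \<in> borel_measurable ?M" using cu that by (auto simp: coord_measurable_def)
      show ?thesis by measurable
    qed
    ultimately show ?thesis by (simp add: pred_intros_finite)
  next
    case False
    then have "supp (u \<omega>) \<noteq> S" for \<omega> using un[of \<omega>] by blast
    then show ?thesis by simp
  qed
  have Bs: "B l \<in> sets ?M" if "l < L" for l
  proof -
    have "B l = (\<Union>S\<in>Pow {..<n}. {\<omega> \<in> space ?M. supp (u \<omega>) = S \<and> P S l \<omega>})" by (auto simp: B_def)
    moreover have "{\<omega> \<in> space ?M. supp (u \<omega>) = S \<and> P S l \<omega>} \<in> sets ?M" for S
      using Sm[of S] Pm[OF that, of S] by measurable
    ultimately show ?thesis by (auto intro: sets.finite_UN)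
  qed
  have gc: "0 \<le> gn_const / m" by (simp add: gn_const_def)
  have PB: "measure ?M (B l) \<le> gn_const / m" if l: "l < L" for l
  proof -
    have "measure (\<Pi>\<^sub>M t\<in>{..L}. block n m) (B l) \<le> gn_const / m"
    proof (rule prob_PiM_le[where i = "Suc l", OF prob_space_block _ _ _ _ gc])
      show "B l \<in> sets (\<Pi>\<^sub>M t\<in>{..L}. block n m)" using Bs[OF l] by (simp add: resampled_data_block)
      fix \<omega> assume "\<omega> \<in> space (\<Pi>\<^sub>M t\<in>{..L} - {Suc l}. block n m)"
      define S where "S = supp (u \<omega>)"
      define w where "w = W S \<omega> l"
      \<comment> \<open>\<open>u\<close> reads block 0 only, so replacing block \<open>Suc l\<close>
        changes neither it nor its support.\<close>
      have u_upd: "u (fun_upd \<omega> (Suc l) y) = u \<omega>" for y by (simp add: u_def)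
      have w_upd: "W S (fun_upd \<omega> (Suc l) y) l = w" for y
        unfolding w_def W_def u_upd by (rule gn_chain_cong) auto
      show "measure (block n m) {y \<in> space (block n m). fun_upd \<omega> (Suc l) y \<in> B l} \<le> gn_const / m"
      proof (cases "vnorm n (\<lambda>i. w i - x i) \<le> vnorm n x / 2")
        case False
        then have e: "{y \<in> space (block n m). fun_upd \<omega> (Suc l) y \<in> B l} = {}"
          by (auto simp: B_def P_def u_upd S_def[symmetric] w_upd)
        show ?thesis unfolding e using gc by simp
      next
        case True
        have "vnorm n x \<le> vnorm n w + vnorm n (\<lambda>i. w i - x i)" using vnorm_triangle_diff[of n w "\<lambda>i. w i - x i"] by simp
        then have w0: "vnorm n w \<noteq> 0" using True x by linarith
        interpret B: prob_space "block n m" by (rule prob_space_block)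
        have "{y \<in> space (block n m). fun_upd \<omega> (Suc l) y \<in> B l} \<subseteq> {y \<in> space (block n m). \<not> gn_good n k m x S w y}"
          by (auto simp: B_def P_def u_upd S_def[symmetric] w_upd)
        then have "measure (block n m) {y \<in> space (block n m). fun_upd \<omega> (Suc l) y \<in> B l} \<le>
            measure (block n m) {y \<in> space (block n m). \<not> gn_good n k m x S w y}"
          by (rule B.finite_measure_mono) (rule gn_good_prob(1)[OF k m w0])
        also have "\<dots> \<le> gn_const / m" by (rule gn_good_prob(2)[OF k m w0])
        finally show ?thesis .
      qed
    qed (use l in auto)
    then show ?thesis by (simp add: resampled_data_block)
  qed
  let ?U = "\<Union>l\<in>{..<L}. B l"
  have Us: "?U \<in> sets ?M" using Bs by auto
  have PU: "measure ?M ?U \<le> L * gn_const / m"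
  proof -
    have "measure ?M ?U \<le> (\<Sum>l\<in>{..<L}. measure ?M (B l))"
      using Bs by (intro M.finite_measure_subadditive_finite) auto
    also have "\<dots> \<le> (\<Sum>l\<in>{..<L}. gn_const / m)" using PB by (intro sum_mono) auto
    finally show ?thesis by simp
  qed
  have "measure ?M E \<le> measure ?M (E - ?U) + measure ?M ?U"
  proof -
    have "measure ?M E \<le> measure ?M ((E - ?U) \<union> ?U)" using Es Us by (intro M.finite_measure_mono) auto
    also have "\<dots> \<le> measure ?M (E - ?U) + measure ?M ?U" using Es Us by (intro measure_Un_le) auto
    finally show ?thesis .
  qed
  then have "1 - (C + L * gn_const) / m \<le> measure ?M (E - ?U)"
    using PE PU by (simp add: add_divide_distrib)
  moreover have "E - ?U \<in> sets ?M" using Es Us by auto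
  moreover have "let u = ht_step n m s \<mu> x (\<omega> 0) z in ht_good n s \<epsilon> x z u \<and>
    (\<forall>l<L. vnorm n (\<lambda>i. gn_chain n m x (supp u) \<omega> u l i - x i) \<le> vnorm n x / 2 \<longrightarrow>
      gn_good n k m x (supp u) (gn_chain n m x (supp u) \<omega> u l) (\<omega> (Suc l)))" if "\<omega> \<in> E - ?U" for \<omega>
    using that A0(3) un unfolding Let_def u_def[symmetric] by (auto simp: E_def B_def P_def W_def u_def)
  ultimately show ?thesis unfolding with_prob_ge_def by blast
qed

lemma sparse_size_le:
  assumes s: "1 \<le> s" "s \<le> n"
  shows "sparse_size n (min (2 * s) n) \<le> 2 * (s * ln (n / s)) + 2 * s"
proof -
  define k where "k = min (2 * s) n"
  have k: "s \<le> k" "k \<le> 2 * s" "k \<le> n" using s by (auto simp: k_def)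
  have "ln (n / k) \<le> ln (n / s)" using s k by (intro ln_mono divide_left_mono) auto
  moreover have "0 \<le> ln (n / k)" using s k by (intro ln_ge_zero) auto
  ultimately have "real k * ln (n / k) \<le> (2 * real s) * ln (n / s)"
    using k by (intro mult_mono) auto
  then show ?thesis unfolding sparse_size_def k_def[symmetric] using k by simp
qed

lemma measurements_uminus: "measurements n a (\<lambda>i. - x i) = measurements n a x"
  by (intro ext) (simp add: measurements_bf bf_linear)

text \<open>The iteration sees \<open>x\<close> only through its measurements, which do not
  determine the sign; this permits replacing \<open>x\<close> by the nearer of the two
  solutions.\<close>

lemma grahtp_step_uminus: "grahtp_step n m s \<mu> L (\<lambda>i. - x i) \<omega> z = grahtp_step n m s \<mu> L x \<omega> z"
proof -
  have "inner_iterate n m (\<lambda>i. - x i) \<omega> u l = inner_iterate n m x \<omega> u l" for u l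
    by (induction l) (simp_all add: measurements_uminus)
  then show ?thesis by (simp add: grahtp_step_def ht_step_def measurements_uminus)
qed

lemma supp_uminus: "supp (\<lambda>i. - x i) = supp x"
  by (simp add: supp_def)

lemma min_entry_uminus: "min_entry (\<lambda>i. - x i) = min_entry x"
  by (simp add: min_entry_def supp_uminus)

text \<open>The contraction factor is 1601 * (1/10000 + 25/2560000), less than 1/2. When no entry of
  \<open>x\<close> is lost only the quadratic term survives, and 40025 = 1601 * 25, where 25 is the
  square of the factor 5 in \<open>ht_good\<close>.\<close>

lemma grahtp_conclusion:
  assumes x: "x \<in> Rn n" "0 < vnorm n x" and s: "1 \<le> s" "s \<le> n" and L: "1 \<le> L"
    and h: "vnorm n (\<lambda>i. z i - x i) \<le> 1 / 2560000 * vnorm n x"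
    and u: "ht_good n s (1 / 10000) x z (ht_step n m s \<mu> x (\<omega> 0) z)"
    and G: "\<And>l. l < L \<Longrightarrow> vnorm n (\<lambda>i. gn_chain n m x (supp (ht_step n m s \<mu> x (\<omega> 0) z)) \<omega> (ht_step n m s \<mu> x (\<omega> 0) z) l i - x i) \<le> vnorm n x / 2 \<Longrightarrow>
      gn_good n (min (2 * s) n) m x (supp (ht_step n m s \<mu> x (\<omega> 0) z)) (gn_chain n m x (supp (ht_step n m s \<mu> x (\<omega> 0) z)) \<omega> (ht_step n m s \<mu> x (\<omega> 0) z) l) (\<omega> (Suc l))"
  defines "z' \<equiv> grahtp_step n m s \<mu> L x \<omega> z"
  shows "vnorm n (\<lambda>i. z' i - x i) \<le> 1/2 * vnorm n (\<lambda>i. z i - x i)"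
    and "vnorm n (\<lambda>i. z i - x i) \<le> min_entry x \<Longrightarrow>
      vnorm n (\<lambda>i. z' i - x i) \<le> 40025 / vnorm n x * (vnorm n (\<lambda>i. z i - x i))\<^sup>2"
proof -
  define u where "u = ht_step n m s \<mu> x (\<omega> 0) z"
  define X where "X = vnorm n x"
  define H where "H = vnorm n (\<lambda>i. z i - x i)"
  define V where "V = vnorm n (off x (supp u))"
  have X0: "0 < X" using x by (simp add: X_def)
  have H0: "0 \<le> H" by (simp add: H_def)
  have HX: "H \<le> 1 / 2560000 * X" using h by (simp add: H_def X_def)
  have V: "V \<le> 1 / 10000 * H" using u by (simp add: ht_good_def V_def H_def u_def)
  have E: "vnorm n (\<lambda>i. z' i - x i) \<le> 1601 * (V + 25 * H\<^sup>2 / X)"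
    using outer_step_error[OF x s h u G order_refl] L
    by (simp add: z'_def grahtp_step_def u_def[symmetric] V_def H_def X_def)
  have "H\<^sup>2 \<le> H * (1 / 2560000 * X)" unfolding power2_eq_square using HX H0 by (intro mult_left_mono) auto
  then have "25 * H\<^sup>2 / X \<le> 25 * (H * (1 / 2560000 * X)) / X" using X0 by (intro divide_right_mono mult_left_mono) auto
  also have "\<dots> = 25 / 2560000 * H" using X0 by simp
  finally have t: "25 * H\<^sup>2 / X \<le> 25 / 2560000 * H" .
  have "1601 * (V + t) \<le> 1/2 * H" if "t \<le> 25 / 2560000 * H" for t
    using that V H0 by (simp add: distrib_left)
  then have "1601 * (V + 25 * H\<^sup>2 / X) \<le> 1/2 * H" using t by blast
  then show "vnorm n (\<lambda>i. z' i - x i) \<le> 1/2 * vnorm n (\<lambda>i. z i - x i)" using E by (simp add: H_def)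
  show "vnorm n (\<lambda>i. z' i - x i) \<le> 40025 / vnorm n x * (vnorm n (\<lambda>i. z i - x i))\<^sup>2"
    if small: "vnorm n (\<lambda>i. z i - x i) \<le> min_entry x"
  proof -
    \<comment> \<open>A lost entry would have size at most V \<le> H/10000 and at least the smallest
      entry of \<open>x\<close>, hence at least H; this forces H = 0 and then V = 0.\<close>
    have "off x (supp u) i = 0" for i
    proof (rule ccontr)
      assume ne: "off x (supp u) i \<noteq> 0"
      then have xi: "x i \<noteq> 0" "off x (supp u) i = x i" by (auto simp: off_def split: if_splits)
      then have i: "i \<in> supp x" "i < n" using supp_Rn[OF x(1)] by (auto simp: supp_def)
      have "min_entry x \<le> \<bar>x i\<bar>"
        unfolding min_entry_def using i finite_supp_Rn[OF x(1)] by (intro Min_le) auto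
      moreover have "\<bar>x i\<bar> \<le> V" using abs_le_vnorm[OF i(2), of "off x (supp u)"] xi by (simp add: V_def)
      ultimately have "H \<le> 1 / 10000 * H" "0 < V" using small V xi by (auto simp: H_def)
      then show False using V H0 by linarith
    qed
    then have "V = 0" by (simp add: V_def vnorm_def L2_set_def)
    then show ?thesis using E by (simp add: H_def X_def)
  qed
qed

theorem mainTheorem1:
  "\<exists>\<gamma>::real. 0 < \<gamma> \<and> \<gamma> < 1 \<and>
    (\<forall>L0::nat. 1 \<le> L0 \<longrightarrow>
      (\<exists>\<mu>1 \<mu>2 C1 C2 \<alpha> \<beta> :: real.
        0 < \<mu>1 \<and> \<mu>1 < \<mu>2 \<and> 0 < C1 \<and> 0 < C2 \<and> 0 < \<alpha> \<and> \<alpha> < 1 \<and> 0 < \<beta> \<and>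
        (\<forall>(n::nat) (s::nat) (m::nat) (x::nat \<Rightarrow> real) (z::nat \<Rightarrow> real) (\<mu>::real).
          1 \<le> s \<and> s \<le> n \<and>
          x \<in> Rn n \<and> norm0 x \<le> s \<and>
          z \<in> nbhd n s x \<gamma> \<and>
          \<mu>1 / (vnorm n x)\<^sup>2 < \<mu> \<and> \<mu> < \<mu>2 / (vnorm n x)\<^sup>2 \<and>
          C2 * real s * ln (real n / real s) \<le> real m \<and>
          C2 * real s \<le> real m
          \<longrightarrow>
          with_prob_ge (resampled_data n m L0) (1 - C1 / real m)
            (\<lambda>\<omega>. let z' = grahtp_step n m s \<mu> L0 x \<omega> z in
              sdist n z' x \<le> \<alpha> * sdist n z x \<and>
              (z \<in> nbhd n s x (min_entry x / vnorm n x) \<longrightarrow>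
                sdist n z' x \<le> \<beta> / vnorm n x * (sdist n z x)\<^sup>2)))))"
proof -
  let ?e = "1 / 10000 :: real"
  have e: "0 < ?e" "?e \<le> 1" by simp_all
  obtain C where C: "0 < C" and HT: "\<And>n s m x z \<mu>. 1 \<le> s \<Longrightarrow> s \<le> n \<Longrightarrow> x \<in> Rn n \<Longrightarrow> norm0 x \<le> s \<Longrightarrow> 0 < vnorm n x \<Longrightarrow>
    vnorm n (\<lambda>i. z i - x i) \<le> ?e / 256 * vnorm n x \<Longrightarrow>
    (1 - ?e / 16) / (vnorm n x)\<^sup>2 < \<mu> \<Longrightarrow> \<mu> < (1 + ?e / 16) / (vnorm n x)\<^sup>2 \<Longrightarrow>
    C * sparse_size n (min (2 * s) n) \<le> real m \<Longrightarrow>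
    with_prob_ge (block n m) (1 - C / m) (\<lambda>a. ht_good n s ?e x z (ht_step n m s \<mu> x a z))"
    using ht_step_prob[OF e] by blast
  have gc: "0 < gn_const" by (simp add: gn_const_def)
  show ?thesis
  \<comment> \<open>\<epsilon>/256 for \<epsilon> = 1/10000, the radius required by the thresholding
    step.\<close>
  proof (rule exI[of _ "1 / 2560000"], intro conjI allI impI)
    fix L0 :: nat assume L0: "1 \<le> L0"
    show "\<exists>\<mu>1 \<mu>2 C1 C2 \<alpha> \<beta> :: real.
        0 < \<mu>1 \<and> \<mu>1 < \<mu>2 \<and> 0 < C1 \<and> 0 < C2 \<and> 0 < \<alpha> \<and> \<alpha> < 1 \<and> 0 < \<beta> \<and>
        (\<forall>(n::nat) (s::nat) (m::nat) (x::nat \<Rightarrow> real) (z::nat \<Rightarrow> real) (\<mu>::real).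
          1 \<le> s \<and> s \<le> n \<and> x \<in> Rn n \<and> norm0 x \<le> s \<and> z \<in> nbhd n s x (1 / 2560000) \<and>
          \<mu>1 / (vnorm n x)\<^sup>2 < \<mu> \<and> \<mu> < \<mu>2 / (vnorm n x)\<^sup>2 \<and>
          C2 * real s * ln (real n / real s) \<le> real m \<and> C2 * real s \<le> real m \<longrightarrow>
          with_prob_ge (resampled_data n m L0) (1 - C1 / real m)
            (\<lambda>\<omega>. let z' = grahtp_step n m s \<mu> L0 x \<omega> z in
              sdist n z' x \<le> \<alpha> * sdist n z x \<and>
              (z \<in> nbhd n s x (min_entry x / vnorm n x) \<longrightarrow>
                sdist n z' x \<le> \<beta> / vnorm n x * (sdist n z x)\<^sup>2)))"
    \<comment> \<open>Among the witnesses only the failure constant depends on \<open>L0\<close>: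
      one thresholding step and \<open>L0\<close> inner steps. The factor 4 pays for working with
      \<open>2 * s\<close>-sparse vectors, which doubles both terms of \<open>sparse_size\<close>,
      and for two separate lower bounds on \<open>m\<close>, whose average is taken in
      \<open>size\<close>.\<close>
    proof (rule exI[of _ "1 - ?e / 16"], rule exI[of _ "1 + ?e / 16"], rule exI[of _ "C + L0 * gn_const"],
        rule exI[of _ "4 * (C + gn_const)"], rule exI[of _ "1/2"], rule exI[of _ 40025], intro conjI allI impI)
      show "0 < C + L0 * gn_const" using C gc by (intro add_pos_nonneg) auto
      show "0 < 4 * (C + gn_const)" using C gc by simp
      fix n s m :: nat and x0 z :: "nat \<Rightarrow> real" and \<mu> :: real
      assume A: "1 \<le> s \<and> s \<le> n \<and> x0 \<in> Rn n \<and> norm0 x0 \<le> s \<and> z \<in> nbhd n s x0 (1 / 2560000) \<and>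
          (1 - ?e / 16) / (vnorm n x0)\<^sup>2 < \<mu> \<and> \<mu> < (1 + ?e / 16) / (vnorm n x0)\<^sup>2 \<and>
          4 * (C + gn_const) * real s * ln (real n / real s) \<le> real m \<and> 4 * (C + gn_const) * real s \<le> real m"
      then have s: "1 \<le> s" "s \<le> n" by auto
      define x where "x = (if vnorm n (\<lambda>i. z i - x0 i) \<le> vnorm n (\<lambda>i. z i + x0 i) then x0 else (\<lambda>i. - x0 i))"
      have x_cases: "x = x0 \<or> x = (\<lambda>i. - x0 i)" by (auto simp: x_def)
      have xR: "x \<in> Rn n" "norm0 x \<le> s" using x_cases A by (auto simp: Rn_def norm0_def supp_uminus)
      have nx: "vnorm n x = vnorm n x0" using x_cases by (auto simp: vnorm_uminus)
      have dx: "vnorm n (\<lambda>i. z i - x i) = sdist n z x0" by (auto simp: x_def sdist_def min_def)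
      have dx': "sdist n z' x0 \<le> vnorm n (\<lambda>i. z' i - x i)" for z' using x_cases by (auto simp: sdist_def)
      have mx: "min_entry x = min_entry x0" using x_cases by (auto simp: min_entry_uminus)
      have gx: "grahtp_step n m s \<mu> L0 x \<omega> z = grahtp_step n m s \<mu> L0 x0 \<omega> z" for \<omega>
        using x_cases by (auto simp: grahtp_step_uminus)
      \<comment> \<open>For a vanishing signal both ends of the step-size interval are divisions by
        0, hence 0, and no \<open>\<mu>\<close> lies strictly between them.\<close>
      have x0: "0 < vnorm n x"
      proof (rule ccontr)
        assume "\<not> 0 < vnorm n x"
        then have "vnorm n x0 = 0" using nx vnorm_nonneg[of n x0] by linarith
        then show False using A by auto
      qed
      have h: "vnorm n (\<lambda>i. z i - x i) \<le> 1 / 2560000 * vnorm n x"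
        using A unfolding dx nx by (simp add: nbhd_def)
      have size: "c * sparse_size n (min (2 * s) n) \<le> real m" if "0 \<le> c" "c \<le> C + gn_const" for c
      proof -
        have "c * sparse_size n (min (2 * s) n) \<le> (C + gn_const) * (2 * (s * ln (n / s)) + 2 * s)"
          using that sparse_size_le[OF s] sparse_size_ge[of "min (2 * s) n" n] s by (intro mult_mono) auto
        also have "\<dots> = (4 * (C + gn_const) * real s * ln (real n / real s) + 4 * (C + gn_const) * real s) / 2"
          by (simp add: algebra_simps)
        also have "\<dots> \<le> real m"
        proof -
          have "(p + q) / 2 \<le> r" if "p \<le> r" "q \<le> r" for p q r :: real using that by (simp add: field_simps)
          then show ?thesis using A by blast
        qed
        finally show ?thesis .
      qed
      have ht: "with_prob_ge (block n m) (1 - C / m) (\<lambda>a. ht_good n s ?e x z (ht_step n m s \<mu> x a z))"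
        using A h gc C by (intro HT s xR x0 size) (auto simp: nx)
      have "with_prob_ge (resampled_data n m L0) (1 - (C + L0 * gn_const) / m) (\<lambda>\<omega>.
          let u = ht_step n m s \<mu> x (\<omega> 0) z in ht_good n s ?e x z u \<and>
          (\<forall>l<L0. vnorm n (\<lambda>i. gn_chain n m x (supp u) \<omega> u l i - x i) \<le> vnorm n x / 2 \<longrightarrow>
            gn_good n (min (2 * s) n) m x (supp u) (gn_chain n m x (supp u) \<omega> u l) (\<omega> (Suc l))))"
        using gc C s by (intro outer_step_prob x0 s size ht) auto
      then show "with_prob_ge (resampled_data n m L0) (1 - (C + L0 * gn_const) / real m)
            (\<lambda>\<omega>. let z' = grahtp_step n m s \<mu> L0 x0 \<omega> z in
              sdist n z' x0 \<le> 1/2 * sdist n z x0 \<and>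
              (z \<in> nbhd n s x0 (min_entry x0 / vnorm n x0) \<longrightarrow>
                sdist n z' x0 \<le> 40025 / vnorm n x0 * (sdist n z x0)\<^sup>2))"
      proof (rule with_prob_ge_mono[OF _ order_refl], goal_cases)
        case (1 \<omega>)
        note c = grahtp_conclusion[OF xR(1) x0 s L0 h, where m = m and \<mu> = \<mu> and \<omega> = \<omega>]
        have c1: "vnorm n (\<lambda>i. grahtp_step n m s \<mu> L0 x \<omega> z i - x i) \<le> 1/2 * vnorm n (\<lambda>i. z i - x i)"
          using 1 by (intro c(1)) (auto simp: Let_def)
        have c2: "vnorm n (\<lambda>i. z i - x i) \<le> min_entry x \<Longrightarrow>
            vnorm n (\<lambda>i. grahtp_step n m s \<mu> L0 x \<omega> z i - x i) \<le> 40025 / vnorm n x * (vnorm n (\<lambda>i. z i - x i))\<^sup>2"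
          using 1 by (intro c(2)) (auto simp: Let_def)
        let ?z = "grahtp_step n m s \<mu> L0 x0 \<omega> z"
        have "sdist n ?z x0 \<le> 1/2 * sdist n z x0"
          using dx'[of ?z] c1 unfolding gx dx by linarith
        moreover have "sdist n ?z x0 \<le> 40025 / vnorm n x0 * (sdist n z x0)\<^sup>2"
          if "z \<in> nbhd n s x0 (min_entry x0 / vnorm n x0)"
        proof -
          have "sdist n z x0 \<le> min_entry x0" using that x0 nx by (simp add: nbhd_def)
          then show ?thesis using dx'[of ?z] c2 unfolding gx dx nx mx by linarith
        qed
        ultimately show ?case unfolding Let_def by blast
      qed
    qed simp_all
  qed simp_all
qed

end
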